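(* Let $(\mathbb{D},\circ,I,\ast,J)$ be a duoidal category with $\mathbb{D}$ Cauchy complete. Assume any one of the conditions (i) the morphism $\tau:I\to J$ is a split epimorphism, or (ii) the counit $\phi_JU^I\phi^IU_J\to1$ of the composite adjunction $\phi_JU^I\dashv\phi^IU_J:\mathbb{D}_J\to\mathbb{D}^I$ is a split epimorphism, or (iii) the composite $\phi^IU_J:\mathbb{D}_J\to\mathbb{D}^I$ is full and faithful. Then, for any bimonoid $(A,m,e,\delta,\varepsilon)$ in $\mathbb{D}$, the functor $K'=-\ast A:\mathbb{D}_J\to\mathbb{D}^A_A$ is an equivalence of categories if and only if $\phi^AU_J:\mathbb{D}_J\to\mathbb{D}^A$ is $\mathcal{T}^r_A$-Galois.
   Context: A duoidal category $(\mathbb{D},\circ,I,\ast,J)$ is a category with two monoidal structures $(\mathbb{D},\circ,I)$ and $(\mathbb{D},\ast,J)$, a natural transformation (interchange law) $\zeta_{W,X,Y,Z}:(W\ast X)\circ(Y\ast Z)\to(W\circ Y)\ast(X\circ Z)$ and morphisms $\Delta:I\to I\ast I$, $\mu:J\circ J\to J$, $\tau:I\to J$ such that, up to the coherence isomorphisms: (1) the two maps $(U\ast V)\circ(W\ast X)\circ(Y\ast Z)\to(U\circ W\circ Y)\ast(V\circ X\circ Z)$ given by $\zeta\cdot(\zeta\circ\mathrm{id})$ and $\zeta\cdot(\mathrm{id}\circ\zeta)$ agree; (2) the two maps $(U\ast V\ast W)\circ(X\ast Y\ast Z)\to(U\circ X)\ast(V\circ Y)\ast(W\circ Z)$ given by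 $(\zeta\ast\mathrm{id})\cdot\zeta$ and $(\mathrm{id}\ast\zeta)\cdot\zeta$ agree; (3) $I\circ(X\ast Y)\xrightarrow{\Delta\circ\mathrm{id}}(I\ast I)\circ(X\ast Y)\xrightarrow{\zeta}(I\circ X)\ast(I\circ Y)\simeq X\ast Y$ is the unit isomorphism, and symmetrically with $I$ on the right; (4) $X\circ Y\simeq(J\ast X)\circ(J\ast Y)\xrightarrow{\zeta}(J\circ J)\ast(X\circ Y)\xrightarrow{\mu\ast\mathrm{id}}J\ast(X\circ Y)\simeq X\circ Y$ is the identity, and symmetrically with $J$ on the right; (5) $(J,\mu,\tau)$ is a monoid in $(\mathbb{D},\circ,I)$ and $(I,\Delta,\tau)$ is a comonoid in $(\mathbb{D},\ast,J)$. A bimonoid in $\mathbb{D}$ is an object $A$ with a monoid structure $(A,m,e)$ in $(\mathbb{D},\circ,I)$ and a comonoid structure $(A,\delta,\varepsilon)$ in $(\mathbb{D},\ast,J)$ such that $\delta\cdot m=(m\ast m)\cdot\zeta_{A,A,A,A}\cdot(\delta\circ\delta)$, $\varepsilon\cdot m=\mu\cdot(\varepsilon\circ\varepsilon)$, $\delta\cdot e=(e\ast e)\cdot\Delta$, $\varepsilon\cdot e=\tau$. $\mathbb{D}_J$ is the category of right modules over the monoid $(J,\mu,\tau)$ in $(\mathbb{D},\circ,I)$ (Eilenberg–Moore category of the monad $-\circ J$), with free–forgetful adjunction $\phi_J\dashv U_J$, $\phi_J(X)=X\circ J$. For a comonoid $C$ in $(\mathbb{D},\ast,J)$ (here $C=A$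 or $C=(I,\Delta,\tau)$), $\mathbb{D}^C$ is the category of right $C$-comodules (Eilenberg–Moore category of the comonad $-\ast C$), with forgetful–cofree adjunction $U^C\dashv\phi^C$, $\phi^C(X)=X\ast C$. Thus $\phi_JU^C\dashv\phi^CU_J$. Let $\lambda_X:(X\ast A)\circ A\xrightarrow{(X\ast A)\circ\delta}(X\ast A)\circ(A\ast A)\xrightarrow{\zeta}(X\circ A)\ast(A\circ A)\xrightarrow{(X\circ A)\ast m}(X\circ A)\ast A$ (a mixed distributive law from the monad $\mathcal{T}^r_A=-\circ A$ to the comonad $-\ast A$). The category $\mathbb{D}^A_A$ of $A$-Hopf modules has as objects triples $(X,h,\vartheta)$ with $(X,h:X\circ A\to X)$ a right $A$-module in $(\mathbb{D},\circ,I)$, $(X,\vartheta:X\to X\ast A)$ a right $A$-comodule in $(\mathbb{D},\ast,J)$, and $\vartheta\cdot h=(h\ast A)\cdot\lambda_X\cdot(\vartheta\circ A)$; morphisms are morphisms of both structures. It is the Eilenberg–Moore category of modules over the monad $\widehat{\mathcal{T}}$ on $\mathbb{D}^A$ lifting $\mathcal{T}^r_A$, $\widehat{\mathcal{T}}(X,\vartheta)=(X\circ A,\lambda_X\cdot(\vartheta\circ A))$. The comparison functor $K'=-\ast A$ sends a right $J$-module $(X,h:X\circ J\to X)$ to $X\ast A$ with cofree coaction $X\ast A\xrightarrow{X\ast\delta}X\ast(A\ast A)\simeq(X\ast A)\ast A$ and action $\rho_{(X,h)}:(X\ast A)\circ A\simeq(X\ast A)\circ(J\ast A)\xrightarrow{\zeta}(X\circ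 J)\ast(A\circ A)\xrightarrow{h\ast m}X\ast A$. Galois: write $Q=\phi^AU_J$, $F=\phi_JU^A$ for its left adjoint, and $\eta:1\to QF$ for the unit. The actions $\rho$ form a natural transformation $\rho:\widehat{\mathcal{T}}Q\to Q$, and $Q$ is called $\mathcal{T}^r_A$-Galois if the monad morphism $t_{K'}:\widehat{\mathcal{T}}\xrightarrow{\widehat{\mathcal{T}}\eta}\widehat{\mathcal{T}}QF\xrightarrow{\rho F}QF$ is an isomorphism. The counit being a split epimorphism means that it has a right inverse natural transformation. A category is Cauchy complete if all idempotents split in it. *)

theory Defs
  imports Main
begin

text \<open>
  Hom-sets with different end points may overlap, so that categories of modules and comodules can
  use morphisms of the base category as their own morphisms.  A functor therefore acts on a
  morphism together with its source and target.  Every category has an isomorphic copy with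
  disjoint hom-sets, for which a composition (and a tensor product of morphisms) on the bare
  type of morphisms is no restriction.
\<close>

record ('o, 'm) cat =
  Ob :: "'o set"
  Hom :: "'o \<Rightarrow> 'o \<Rightarrow> 'm set"
  Id :: "'o \<Rightarrow> 'm"
  Comp :: "'m \<Rightarrow> 'm \<Rightarrow> 'm"  (infixr "\<cdot>\<index>" 55)

locale category =
  fixes C :: "('o, 'm, 'z) cat_scheme" (structure)
  assumes Hom_Ob: "f \<in> Hom C X Y \<Longrightarrow> X \<in> Ob C \<and> Y \<in> Ob C"
    and Id_Hom: "X \<in> Ob C \<Longrightarrow> Id C X \<in> Hom C X X"
    and Comp_Hom: "\<lbrakk>f \<in> Hom C X Y; g \<in> Hom C Y Z\<rbrakk> \<Longrightarrow> g \<cdot> f \<in> Hom C X Z"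
    and Id_left: "f \<in> Hom C X Y \<Longrightarrow> Id C Y \<cdot> f = f"
    and Id_right: "f \<in> Hom C X Y \<Longrightarrow> f \<cdot> Id C X = f"
    and Comp_assoc: "\<lbrakk>f \<in> Hom C W X; g \<in> Hom C X Y; h \<in> Hom C Y Z\<rbrakk>
      \<Longrightarrow> (h \<cdot> g) \<cdot> f = h \<cdot> (g \<cdot> f)"

context
  fixes C :: "('o, 'm, 'z) cat_scheme" (structure)
begin

definition mutually_inverse :: "'o \<Rightarrow> 'o \<Rightarrow> 'm \<Rightarrow> 'm \<Rightarrow> bool" where
  "mutually_inverse X Y f g \<longleftrightarrow>
     f \<in> Hom C X Y \<and> g \<in> Hom C Y X \<and> g \<cdot> f = Id C X \<and> f \<cdot> g = Id C Y"

definition is_iso :: "'o \<Rightarrow> 'o \<Rightarrow> 'm \<Rightarrow> bool" where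
  "is_iso X Y f \<longleftrightarrow> (\<exists>g. mutually_inverse X Y f g)"

definition inverse_of :: "'o \<Rightarrow> 'o \<Rightarrow> 'm \<Rightarrow> 'm" where
  "inverse_of X Y f = (THE g. mutually_inverse X Y f g)"

definition split_epi :: "'o \<Rightarrow> 'o \<Rightarrow> 'm \<Rightarrow> bool" where
  "split_epi X Y f \<longleftrightarrow> f \<in> Hom C X Y \<and> (\<exists>s \<in> Hom C Y X. f \<cdot> s = Id C Y)"

definition cauchy_complete :: bool where
  "cauchy_complete \<longleftrightarrow>
     (\<forall>X p. p \<in> Hom C X X \<and> p \<cdot> p = p \<longrightarrow>
        (\<exists>Y r s. r \<in> Hom C X Y \<and> s \<in> Hom C Y X \<and> r \<cdot> s = Id C Y \<and> s \<cdot> r = p))"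

end

record ('o, 'm, 'p, 'n) func =
  fob :: "'o \<Rightarrow> 'p"
  fmor :: "'o \<Rightarrow> 'o \<Rightarrow> 'm \<Rightarrow> 'n"

definition id_func :: "('o, 'm, 'o, 'm) func" where
  "id_func = \<lparr>fob = (\<lambda>X. X), fmor = (\<lambda>X Y f. f)\<rparr>"

definition comp_func ::
  "('p, 'n, 'q, 'l) func \<Rightarrow> ('o, 'm, 'p, 'n) func \<Rightarrow> ('o, 'm, 'q, 'l) func"
  (infixr "\<circ>\<^sub>F" 55) where
  "G \<circ>\<^sub>F F = \<lparr>fob = (\<lambda>X. fob G (fob F X)),
            fmor = (\<lambda>X Y f. fmor G (fob F X) (fob F Y) (fmor F X Y f))\<rparr>"

context
  fixes C :: "('o, 'm, 'z) cat_scheme" and D :: "('p, 'n, 'y) cat_scheme"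
begin

definition is_functor :: "('o, 'm, 'p, 'n) func \<Rightarrow> bool" where
  "is_functor F \<longleftrightarrow>
     (\<forall>X \<in> Ob C. fob F X \<in> Ob D) \<and>
     (\<forall>X Y. \<forall>f \<in> Hom C X Y. fmor F X Y f \<in> Hom D (fob F X) (fob F Y)) \<and>
     (\<forall>X \<in> Ob C. fmor F X X (Id C X) = Id D (fob F X)) \<and>
     (\<forall>X Y Z. \<forall>f \<in> Hom C X Y. \<forall>g \<in> Hom C Y Z.
        fmor F X Z (g \<cdot>\<^bsub>C\<^esub> f) = fmor F Y Z g \<cdot>\<^bsub>D\<^esub> fmor F X Y f)"

definition full_and_faithful :: "('o, 'm, 'p, 'n) func \<Rightarrow> bool" where
  "full_and_faithful F \<longleftrightarrow> is_functor F \<and>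
     (\<forall>X \<in> Ob C. \<forall>Y \<in> Ob C.
        bij_betw (fmor F X Y) (Hom C X Y) (Hom D (fob F X) (fob F Y)))"

definition nat_trans ::
  "('o, 'm, 'p, 'n) func \<Rightarrow> ('o, 'm, 'p, 'n) func \<Rightarrow> ('o \<Rightarrow> 'n) \<Rightarrow> bool" where
  "nat_trans F G \<alpha> \<longleftrightarrow> is_functor F \<and> is_functor G \<and>
     (\<forall>X \<in> Ob C. \<alpha> X \<in> Hom D (fob F X) (fob G X)) \<and>
     (\<forall>X Y. \<forall>f \<in> Hom C X Y. \<alpha> Y \<cdot>\<^bsub>D\<^esub> fmor F X Y f = fmor G X Y f \<cdot>\<^bsub>D\<^esub> \<alpha> X)"

definition nat_iso ::
  "('o, 'm, 'p, 'n) func \<Rightarrow> ('o, 'm, 'p, 'n) func \<Rightarrow> ('o \<Rightarrow> 'n) \<Rightarrow> bool" where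
  "nat_iso F G \<alpha> \<longleftrightarrow> nat_trans F G \<alpha> \<and>
     (\<forall>X \<in> Ob C. is_iso D (fob F X) (fob G X) (\<alpha> X))"

definition nat_split_epi ::
  "('o, 'm, 'p, 'n) func \<Rightarrow> ('o, 'm, 'p, 'n) func \<Rightarrow> ('o \<Rightarrow> 'n) \<Rightarrow> bool" where
  "nat_split_epi F G \<alpha> \<longleftrightarrow> nat_trans F G \<alpha> \<and>
     (\<exists>\<sigma>. nat_trans G F \<sigma> \<and> (\<forall>X \<in> Ob C. \<alpha> X \<cdot>\<^bsub>D\<^esub> \<sigma> X = Id D (fob G X)))"

end

definition equivalence ::
  "('o, 'm, 'z) cat_scheme \<Rightarrow> ('p, 'n, 'y) cat_scheme \<Rightarrow> ('o, 'm, 'p, 'n) func \<Rightarrow> bool" where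
  "equivalence C D F \<longleftrightarrow> is_functor C D F \<and>
     (\<exists>G \<alpha> \<beta>. is_functor D C G \<and>
        nat_iso C C id_func (G \<circ>\<^sub>F F) \<alpha> \<and> nat_iso D D (F \<circ>\<^sub>F G) id_func \<beta>)"

text \<open>
  Unit and counit of a composite \<open>F' F \<stileturn> G G'\<close> of adjunctions \<open>F \<stileturn> G : D \<rightarrow> C\<close> and
  \<open>F' \<stileturn> G' : E \<rightarrow> D\<close> with units \<open>\<eta>\<close>, \<open>\<eta>'\<close> and counits \<open>\<epsilon>\<close>, \<open>\<epsilon>'\<close>.
\<close>

definition composite_unit ::
  "('o, 'm, 'z) cat_scheme \<Rightarrow> ('o, 'm, 'p, 'n) func \<Rightarrow> ('p, 'n, 'o, 'm) func \<Rightarrow> ('o \<Rightarrow> 'm)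
   \<Rightarrow> ('p, 'n, 'q, 'l) func \<Rightarrow> ('q, 'l, 'p, 'n) func \<Rightarrow> ('p \<Rightarrow> 'n) \<Rightarrow> 'o \<Rightarrow> 'm" where
  "composite_unit C F G \<eta> F' G' \<eta>' X =
     fmor G (fob F X) (fob (G' \<circ>\<^sub>F F' \<circ>\<^sub>F F) X) (\<eta>' (fob F X)) \<cdot>\<^bsub>C\<^esub> \<eta> X"

definition composite_counit ::
  "('q, 'l, 'z) cat_scheme \<Rightarrow> ('o, 'm, 'p, 'n) func \<Rightarrow> ('p, 'n, 'o, 'm) func \<Rightarrow> ('p \<Rightarrow> 'n)
   \<Rightarrow> ('p, 'n, 'q, 'l) func \<Rightarrow> ('q, 'l, 'p, 'n) func \<Rightarrow> ('q \<Rightarrow> 'l) \<Rightarrow> 'q \<Rightarrow> 'l" where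
  "composite_counit E F G \<epsilon> F' G' \<epsilon>' Y =
     \<epsilon>' Y \<cdot>\<^bsub>E\<^esub> fmor F' (fob (F \<circ>\<^sub>F G \<circ>\<^sub>F G') Y) (fob G' Y) (\<epsilon> (fob G' Y))"

record ('o, 'm) mon_struct =
  tensor_ob :: "'o \<Rightarrow> 'o \<Rightarrow> 'o"  ("(_ \<otimes>\<index> _)" [71, 71] 70)
  tensor_mor :: "'m \<Rightarrow> 'm \<Rightarrow> 'm"  ("(_ \<otimes>\<^sub>m\<index> _)" [71, 71] 70)
  unit_ob :: 'o
  assoc :: "'o \<Rightarrow> 'o \<Rightarrow> 'o \<Rightarrow> 'm"
  lunit :: "'o \<Rightarrow> 'm"
  runit :: "'o \<Rightarrow> 'm"

locale monoidal = category C
  for C :: "('o, 'm, 'z) cat_scheme" (structure) and V :: "('o, 'm) mon_struct" +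
  assumes tensor_Ob: "\<lbrakk>X \<in> Ob C; Y \<in> Ob C\<rbrakk> \<Longrightarrow> X \<otimes>\<^bsub>V\<^esub> Y \<in> Ob C"
    and tensor_Hom: "\<lbrakk>f \<in> Hom C X X'; g \<in> Hom C Y Y'\<rbrakk>
      \<Longrightarrow> f \<otimes>\<^sub>m\<^bsub>V\<^esub> g \<in> Hom C (X \<otimes>\<^bsub>V\<^esub> Y) (X' \<otimes>\<^bsub>V\<^esub> Y')"
    and tensor_Id: "\<lbrakk>X \<in> Ob C; Y \<in> Ob C\<rbrakk> \<Longrightarrow> Id C X \<otimes>\<^sub>m\<^bsub>V\<^esub> Id C Y = Id C (X \<otimes>\<^bsub>V\<^esub> Y)"
    and tensor_Comp: "\<lbrakk>f \<in> Hom C X X'; f' \<in> Hom C X' X''; g \<in> Hom C Y Y'; g' \<in> Hom C Y' Y''\<rbrakk>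
      \<Longrightarrow> (f' \<cdot> f) \<otimes>\<^sub>m\<^bsub>V\<^esub> (g' \<cdot> g) = (f' \<otimes>\<^sub>m\<^bsub>V\<^esub> g') \<cdot> (f \<otimes>\<^sub>m\<^bsub>V\<^esub> g)"
    and unit_Ob: "unit_ob V \<in> Ob C"
    and assoc_iso: "\<lbrakk>X \<in> Ob C; Y \<in> Ob C; Z \<in> Ob C\<rbrakk>
      \<Longrightarrow> is_iso C ((X \<otimes>\<^bsub>V\<^esub> Y) \<otimes>\<^bsub>V\<^esub> Z) (X \<otimes>\<^bsub>V\<^esub> (Y \<otimes>\<^bsub>V\<^esub> Z)) (assoc V X Y Z)"
    and assoc_nat: "\<lbrakk>f \<in> Hom C X X'; g \<in> Hom C Y Y'; h \<in> Hom C Z Z'\<rbrakk>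
      \<Longrightarrow> assoc V X' Y' Z' \<cdot> ((f \<otimes>\<^sub>m\<^bsub>V\<^esub> g) \<otimes>\<^sub>m\<^bsub>V\<^esub> h)
        = (f \<otimes>\<^sub>m\<^bsub>V\<^esub> (g \<otimes>\<^sub>m\<^bsub>V\<^esub> h)) \<cdot> assoc V X Y Z"
    and lunit_iso: "X \<in> Ob C \<Longrightarrow> is_iso C (unit_ob V \<otimes>\<^bsub>V\<^esub> X) X (lunit V X)"
    and lunit_nat: "f \<in> Hom C X Y \<Longrightarrow> lunit V Y \<cdot> (Id C (unit_ob V) \<otimes>\<^sub>m\<^bsub>V\<^esub> f) = f \<cdot> lunit V X"
    and runit_iso: "X \<in> Ob C \<Longrightarrow> is_iso C (X \<otimes>\<^bsub>V\<^esub> unit_ob V) X (runit V X)"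
    and runit_nat: "f \<in> Hom C X Y \<Longrightarrow> runit V Y \<cdot> (f \<otimes>\<^sub>m\<^bsub>V\<^esub> Id C (unit_ob V)) = f \<cdot> runit V X"
    and pentagon: "\<lbrakk>W \<in> Ob C; X \<in> Ob C; Y \<in> Ob C; Z \<in> Ob C\<rbrakk>
      \<Longrightarrow> (Id C W \<otimes>\<^sub>m\<^bsub>V\<^esub> assoc V X Y Z) \<cdot> assoc V W (X \<otimes>\<^bsub>V\<^esub> Y) Z \<cdot> (assoc V W X Y \<otimes>\<^sub>m\<^bsub>V\<^esub> Id C Z)
        = assoc V W X (Y \<otimes>\<^bsub>V\<^esub> Z) \<cdot> assoc V (W \<otimes>\<^bsub>V\<^esub> X) Y Z"
    and triangle: "\<lbrakk>X \<in> Ob C; Y \<in> Ob C\<rbrakk>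
      \<Longrightarrow> (Id C X \<otimes>\<^sub>m\<^bsub>V\<^esub> lunit V Y) \<cdot> assoc V X (unit_ob V) Y = runit V X \<otimes>\<^sub>m\<^bsub>V\<^esub> Id C Y"

context
  fixes C :: "('o, 'm, 'z) cat_scheme" (structure) and V :: "('o, 'm) mon_struct"
begin

definition assoc_inv :: "'o \<Rightarrow> 'o \<Rightarrow> 'o \<Rightarrow> 'm" where
  "assoc_inv X Y Z =
     inverse_of C ((X \<otimes>\<^bsub>V\<^esub> Y) \<otimes>\<^bsub>V\<^esub> Z) (X \<otimes>\<^bsub>V\<^esub> (Y \<otimes>\<^bsub>V\<^esub> Z)) (assoc V X Y Z)"

definition lunit_inv :: "'o \<Rightarrow> 'm" where
  "lunit_inv X = inverse_of C (unit_ob V \<otimes>\<^bsub>V\<^esub> X) X (lunit V X)"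

definition runit_inv :: "'o \<Rightarrow> 'm" where
  "runit_inv X = inverse_of C (X \<otimes>\<^bsub>V\<^esub> unit_ob V) X (runit V X)"

definition is_monoid :: "'o \<Rightarrow> 'm \<Rightarrow> 'm \<Rightarrow> bool" where
  "is_monoid M m e \<longleftrightarrow> M \<in> Ob C \<and> m \<in> Hom C (M \<otimes>\<^bsub>V\<^esub> M) M \<and> e \<in> Hom C (unit_ob V) M \<and>
     m \<cdot> (m \<otimes>\<^sub>m\<^bsub>V\<^esub> Id C M) = m \<cdot> (Id C M \<otimes>\<^sub>m\<^bsub>V\<^esub> m) \<cdot> assoc V M M M \<and>
     m \<cdot> (e \<otimes>\<^sub>m\<^bsub>V\<^esub> Id C M) = lunit V M \<and>
     m \<cdot> (Id C M \<otimes>\<^sub>m\<^bsub>V\<^esub> e) = runit V M"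

definition is_comonoid :: "'o \<Rightarrow> 'm \<Rightarrow> 'm \<Rightarrow> bool" where
  "is_comonoid K \<delta> \<epsilon> \<longleftrightarrow> K \<in> Ob C \<and> \<delta> \<in> Hom C K (K \<otimes>\<^bsub>V\<^esub> K) \<and> \<epsilon> \<in> Hom C K (unit_ob V) \<and>
     assoc V K K K \<cdot> (\<delta> \<otimes>\<^sub>m\<^bsub>V\<^esub> Id C K) \<cdot> \<delta> = (Id C K \<otimes>\<^sub>m\<^bsub>V\<^esub> \<delta>) \<cdot> \<delta> \<and>
     lunit V K \<cdot> (\<epsilon> \<otimes>\<^sub>m\<^bsub>V\<^esub> Id C K) \<cdot> \<delta> = Id C K \<and>
     runit V K \<cdot> (Id C K \<otimes>\<^sub>m\<^bsub>V\<^esub> \<epsilon>) \<cdot> \<delta> = Id C K"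

definition is_module :: "'o \<Rightarrow> 'm \<Rightarrow> 'm \<Rightarrow> 'o \<Rightarrow> 'm \<Rightarrow> bool" where
  "is_module M m e X h \<longleftrightarrow> X \<in> Ob C \<and> h \<in> Hom C (X \<otimes>\<^bsub>V\<^esub> M) X \<and>
     h \<cdot> (h \<otimes>\<^sub>m\<^bsub>V\<^esub> Id C M) = h \<cdot> (Id C X \<otimes>\<^sub>m\<^bsub>V\<^esub> m) \<cdot> assoc V X M M \<and>
     h \<cdot> (Id C X \<otimes>\<^sub>m\<^bsub>V\<^esub> e) = runit V X"

definition is_comodule :: "'o \<Rightarrow> 'm \<Rightarrow> 'm \<Rightarrow> 'o \<Rightarrow> 'm \<Rightarrow> bool" where
  "is_comodule K \<delta> \<epsilon> X \<theta> \<longleftrightarrow> X \<in> Ob C \<and> \<theta> \<in> Hom C X (X \<otimes>\<^bsub>V\<^esub> K) \<and>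
     assoc V X K K \<cdot> (\<theta> \<otimes>\<^sub>m\<^bsub>V\<^esub> Id C K) \<cdot> \<theta> = (Id C X \<otimes>\<^sub>m\<^bsub>V\<^esub> \<delta>) \<cdot> \<theta> \<and>
     runit V X \<cdot> (Id C X \<otimes>\<^sub>m\<^bsub>V\<^esub> \<epsilon>) \<cdot> \<theta> = Id C X"

definition module_mor :: "'o \<Rightarrow> 'o \<times> 'm \<Rightarrow> 'o \<times> 'm \<Rightarrow> 'm \<Rightarrow> bool" where
  "module_mor M = (\<lambda>(X, h) (Y, k) f. f \<in> Hom C X Y \<and> f \<cdot> h = k \<cdot> (f \<otimes>\<^sub>m\<^bsub>V\<^esub> Id C M))"

definition comodule_mor :: "'o \<Rightarrow> 'o \<times> 'm \<Rightarrow> 'o \<times> 'm \<Rightarrow> 'm \<Rightarrow> bool" where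
  "comodule_mor K = (\<lambda>(X, \<theta>) (Y, \<kappa>) f. f \<in> Hom C X Y \<and> (f \<otimes>\<^sub>m\<^bsub>V\<^esub> Id C K) \<cdot> \<theta> = \<kappa> \<cdot> f)"

definition modules :: "'o \<Rightarrow> 'm \<Rightarrow> 'm \<Rightarrow> ('o \<times> 'm, 'm) cat" where
  "modules M m e =
     \<lparr>Ob = {(X, h). is_module M m e X h},
      Hom = (\<lambda>(X, h) (Y, k). {f. is_module M m e X h \<and> is_module M m e Y k
                               \<and> module_mor M (X, h) (Y, k) f}),
      Id = (\<lambda>(X, h). Id C X),
      Comp = Comp C\<rparr>"

definition comodules :: "'o \<Rightarrow> 'm \<Rightarrow> 'm \<Rightarrow> ('o \<times> 'm, 'm) cat" where
  "comodules K \<delta> \<epsilon> =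
     \<lparr>Ob = {(X, \<theta>). is_comodule K \<delta> \<epsilon> X \<theta>},
      Hom = (\<lambda>(X, \<theta>) (Y, \<kappa>). {f. is_comodule K \<delta> \<epsilon> X \<theta> \<and> is_comodule K \<delta> \<epsilon> Y \<kappa>
                               \<and> comodule_mor K (X, \<theta>) (Y, \<kappa>) f}),
      Id = (\<lambda>(X, \<theta>). Id C X),
      Comp = Comp C\<rparr>"

definition free_module :: "'o \<Rightarrow> 'm \<Rightarrow> ('o, 'm, 'o \<times> 'm, 'm) func" where
  "free_module M m =
     \<lparr>fob = (\<lambda>X. (X \<otimes>\<^bsub>V\<^esub> M, (Id C X \<otimes>\<^sub>m\<^bsub>V\<^esub> m) \<cdot> assoc V X M M)),
      fmor = (\<lambda>X Y f. f \<otimes>\<^sub>m\<^bsub>V\<^esub> Id C M)\<rparr>"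

definition cofree_comodule :: "'o \<Rightarrow> 'm \<Rightarrow> ('o, 'm, 'o \<times> 'm, 'm) func" where
  "cofree_comodule K \<delta> =
     \<lparr>fob = (\<lambda>X. (X \<otimes>\<^bsub>V\<^esub> K, assoc_inv X K K \<cdot> (Id C X \<otimes>\<^sub>m\<^bsub>V\<^esub> \<delta>))),
      fmor = (\<lambda>X Y f. f \<otimes>\<^sub>m\<^bsub>V\<^esub> Id C K)\<rparr>"

definition free_module_unit :: "'m \<Rightarrow> 'o \<Rightarrow> 'm" where
  "free_module_unit e X = (Id C X \<otimes>\<^sub>m\<^bsub>V\<^esub> e) \<cdot> runit_inv X"

definition cofree_comodule_counit :: "'m \<Rightarrow> 'o \<Rightarrow> 'm" where
  "cofree_comodule_counit \<epsilon> X = runit V X \<cdot> (Id C X \<otimes>\<^sub>m\<^bsub>V\<^esub> \<epsilon>)"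

end

text \<open>
  The forgetful functors \<open>(X, h) \<mapsto> X\<close> and \<open>(X, \<theta>) \<mapsto> X\<close>.  The counit of the free-forgetful
  adjunction at a module \<open>(X, h)\<close> is its action \<open>h\<close>, and the unit of the forgetful-cofree
  adjunction at a comodule \<open>(X, \<theta>)\<close> is its coaction \<open>\<theta>\<close>; both are the projection \<open>snd\<close>.
\<close>

definition forget :: "('o \<times> 'm, 'm, 'o, 'm) func" where
  "forget = \<lparr>fob = fst, fmor = (\<lambda>_ _ f. f)\<rparr>"

text \<open>
  The paper's first product \<open>\<circ>\<close> with unit \<open>I\<close> is \<open>circ\<close>, written \<open>\<odot>\<close>; the second product \<open>\<ast>\<close> with
  unit \<open>J\<close> is \<open>star\<close>.
\<close>

record ('o, 'm) duoidal_data = "('o, 'm) cat" +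
  circ :: "('o, 'm) mon_struct"
  star :: "('o, 'm) mon_struct"
  zeta :: "'o \<Rightarrow> 'o \<Rightarrow> 'o \<Rightarrow> 'o \<Rightarrow> 'm"
  Delta :: 'm
  mu :: 'm
  tau :: 'm

abbreviation circ_ob ("(_ \<odot>\<index> _)" [71, 71] 70) where
  "X \<odot>\<^bsub>D\<^esub> Y \<equiv> tensor_ob (circ D) X Y"

abbreviation circ_mor ("(_ \<odot>\<^sub>m\<index> _)" [71, 71] 70) where
  "f \<odot>\<^sub>m\<^bsub>D\<^esub> g \<equiv> tensor_mor (circ D) f g"

abbreviation star_ob ("(_ \<ast>\<index> _)" [71, 71] 70) where
  "X \<ast>\<^bsub>D\<^esub> Y \<equiv> tensor_ob (star D) X Y"

abbreviation star_mor ("(_ \<ast>\<^sub>m\<index> _)" [71, 71] 70) where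
  "f \<ast>\<^sub>m\<^bsub>D\<^esub> g \<equiv> tensor_mor (star D) f g"

abbreviation I_ob ("\<I>\<index>") where "\<I>\<^bsub>D\<^esub> \<equiv> unit_ob (circ D)"

abbreviation J_ob ("\<J>\<index>") where "\<J>\<^bsub>D\<^esub> \<equiv> unit_ob (star D)"

locale duoidal = category D
  for D :: "('o, 'm) duoidal_data" (structure) +
  assumes circ_monoidal: "monoidal D (circ D)"
    and star_monoidal: "monoidal D (star D)"
    and zeta_Hom: "\<lbrakk>W \<in> Ob D; X \<in> Ob D; Y \<in> Ob D; Z \<in> Ob D\<rbrakk>
      \<Longrightarrow> zeta D W X Y Z \<in> Hom D ((W \<ast> X) \<odot> (Y \<ast> Z)) ((W \<odot> Y) \<ast> (X \<odot> Z))"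
    and zeta_nat:
      "\<lbrakk>f \<in> Hom D W W'; g \<in> Hom D X X'; h \<in> Hom D Y Y'; k \<in> Hom D Z Z'\<rbrakk>
       \<Longrightarrow> zeta D W' X' Y' Z' \<cdot> ((f \<ast>\<^sub>m g) \<odot>\<^sub>m (h \<ast>\<^sub>m k))
         = ((f \<odot>\<^sub>m h) \<ast>\<^sub>m (g \<odot>\<^sub>m k)) \<cdot> zeta D W X Y Z"
    and Delta_Hom: "Delta D \<in> Hom D \<I> (\<I> \<ast> \<I>)"
    and mu_Hom: "mu D \<in> Hom D (\<J> \<odot> \<J>) \<J>"
    and tau_Hom: "tau D \<in> Hom D \<I> \<J>"
    and zeta_circ_assoc:
      "\<lbrakk>U \<in> Ob D; V \<in> Ob D; W \<in> Ob D; X \<in> Ob D; Y \<in> Ob D; Z \<in> Ob D\<rbrakk>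
       \<Longrightarrow> (assoc (circ D) U W Y \<ast>\<^sub>m assoc (circ D) V X Z)
             \<cdot> zeta D (U \<odot> W) (V \<odot> X) Y Z \<cdot> (zeta D U V W X \<odot>\<^sub>m Id D (Y \<ast> Z))
         = zeta D U V (W \<odot> Y) (X \<odot> Z) \<cdot> (Id D (U \<ast> V) \<odot>\<^sub>m zeta D W X Y Z)
             \<cdot> assoc (circ D) (U \<ast> V) (W \<ast> X) (Y \<ast> Z)"
    and zeta_star_assoc:
      "\<lbrakk>U \<in> Ob D; V \<in> Ob D; W \<in> Ob D; X \<in> Ob D; Y \<in> Ob D; Z \<in> Ob D\<rbrakk>
       \<Longrightarrow> assoc (star D) (U \<odot> X) (V \<odot> Y) (W \<odot> Z)
             \<cdot> (zeta D U V X Y \<ast>\<^sub>m Id D (W \<odot> Z)) \<cdot> zeta D (U \<ast> V) W (X \<ast> Y) Z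
         = (Id D (U \<odot> X) \<ast>\<^sub>m zeta D V W Y Z) \<cdot> zeta D U (V \<ast> W) X (Y \<ast> Z)
             \<cdot> (assoc (star D) U V W \<odot>\<^sub>m assoc (star D) X Y Z)"
    and Delta_left: "\<lbrakk>X \<in> Ob D; Y \<in> Ob D\<rbrakk>
      \<Longrightarrow> (lunit (circ D) X \<ast>\<^sub>m lunit (circ D) Y) \<cdot> zeta D \<I> \<I> X Y \<cdot> (Delta D \<odot>\<^sub>m Id D (X \<ast> Y))
        = lunit (circ D) (X \<ast> Y)"
    and Delta_right: "\<lbrakk>X \<in> Ob D; Y \<in> Ob D\<rbrakk>
      \<Longrightarrow> (runit (circ D) X \<ast>\<^sub>m runit (circ D) Y) \<cdot> zeta D X Y \<I> \<I> \<cdot> (Id D (X \<ast> Y) \<odot>\<^sub>m Delta D)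
        = runit (circ D) (X \<ast> Y)"
    and mu_left: "\<lbrakk>X \<in> Ob D; Y \<in> Ob D\<rbrakk>
      \<Longrightarrow> lunit (star D) (X \<odot> Y) \<cdot> (mu D \<ast>\<^sub>m Id D (X \<odot> Y)) \<cdot> zeta D \<J> X \<J> Y
            \<cdot> (lunit_inv D (star D) X \<odot>\<^sub>m lunit_inv D (star D) Y)
        = Id D (X \<odot> Y)"
    and mu_right: "\<lbrakk>X \<in> Ob D; Y \<in> Ob D\<rbrakk>
      \<Longrightarrow> runit (star D) (X \<odot> Y) \<cdot> (Id D (X \<odot> Y) \<ast>\<^sub>m mu D) \<cdot> zeta D X \<J> Y \<J>
            \<cdot> (runit_inv D (star D) X \<odot>\<^sub>m runit_inv D (star D) Y)
        = Id D (X \<odot> Y)"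
    and J_monoid: "is_monoid D (circ D) \<J> (mu D) (tau D)"
    and I_comonoid: "is_comonoid D (star D) \<I> (Delta D) (tau D)"

context
  fixes D :: "('o, 'm) duoidal_data" (structure)
begin

definition bimonoid :: "'o \<Rightarrow> 'm \<Rightarrow> 'm \<Rightarrow> 'm \<Rightarrow> 'm \<Rightarrow> bool" where
  "bimonoid A m e \<delta> \<epsilon> \<longleftrightarrow>
     is_monoid D (circ D) A m e \<and> is_comonoid D (star D) A \<delta> \<epsilon> \<and>
     \<delta> \<cdot> m = (m \<ast>\<^sub>m m) \<cdot> zeta D A A A A \<cdot> (\<delta> \<odot>\<^sub>m \<delta>) \<and>
     \<epsilon> \<cdot> m = mu D \<cdot> (\<epsilon> \<odot>\<^sub>m \<epsilon>) \<and>
     \<delta> \<cdot> e = (e \<ast>\<^sub>m e) \<cdot> Delta D \<and>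
     \<epsilon> \<cdot> e = tau D"

definition J_modules :: "('o \<times> 'm, 'm) cat" where
  "J_modules = modules D (circ D) \<J> (mu D) (tau D)"

definition phi_J :: "('o, 'm, 'o \<times> 'm, 'm) func" where
  "phi_J = free_module D (circ D) \<J> (mu D)"

text \<open>
  The adjunction \<open>\<phi>\<^sub>J U\<^sup>K \<stileturn> \<phi>\<^sup>K U\<^sub>J\<close> for a comonoid \<open>(K, \<delta>, \<epsilon>)\<close> with respect to \<open>\<ast>\<close>.
\<close>

definition adj_right :: "'o \<Rightarrow> 'm \<Rightarrow> ('o \<times> 'm, 'm, 'o \<times> 'm, 'm) func" where
  "adj_right K \<delta> = cofree_comodule D (star D) K \<delta> \<circ>\<^sub>F forget"

definition adj_left :: "('o \<times> 'm, 'm, 'o \<times> 'm, 'm) func" where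
  "adj_left = phi_J \<circ>\<^sub>F forget"

definition adj_unit :: "'o \<Rightarrow> 'm \<Rightarrow> 'm \<Rightarrow> 'o \<times> 'm \<Rightarrow> 'm" where
  "adj_unit K \<delta> \<epsilon> =
     composite_unit (comodules D (star D) K \<delta> \<epsilon>)
       forget (cofree_comodule D (star D) K \<delta>) snd
       phi_J forget (free_module_unit D (circ D) (tau D))"

definition adj_counit :: "'o \<Rightarrow> 'm \<Rightarrow> 'm \<Rightarrow> 'o \<times> 'm \<Rightarrow> 'm" where
  "adj_counit K \<delta> \<epsilon> =
     composite_counit J_modules
       forget (cofree_comodule D (star D) K \<delta>) (cofree_comodule_counit D (star D) \<epsilon>)
       phi_J forget snd"

definition mixed_law :: "'o \<Rightarrow> 'm \<Rightarrow> 'm \<Rightarrow> 'o \<Rightarrow> 'm" where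
  "mixed_law A m \<delta> X =
     (Id D (X \<odot> A) \<ast>\<^sub>m m) \<cdot> zeta D X A A A \<cdot> (Id D (X \<ast> A) \<odot>\<^sub>m \<delta>)"

definition lifted_monad :: "'o \<Rightarrow> 'm \<Rightarrow> 'm \<Rightarrow> ('o \<times> 'm, 'm, 'o \<times> 'm, 'm) func" where
  "lifted_monad A m \<delta> =
     \<lparr>fob = (\<lambda>(X, \<theta>). (X \<odot> A, mixed_law A m \<delta> X \<cdot> (\<theta> \<odot>\<^sub>m Id D A))),
      fmor = (\<lambda>_ _ f. f \<odot>\<^sub>m Id D A)\<rparr>"

definition is_hopf_module :: "'o \<Rightarrow> 'm \<Rightarrow> 'm \<Rightarrow> 'm \<Rightarrow> 'm \<Rightarrow> 'o \<Rightarrow> 'm \<Rightarrow> 'm \<Rightarrow> bool" where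
  "is_hopf_module A m e \<delta> \<epsilon> X h \<theta> \<longleftrightarrow>
     is_module D (circ D) A m e X h \<and> is_comodule D (star D) A \<delta> \<epsilon> X \<theta> \<and>
     \<theta> \<cdot> h = (h \<ast>\<^sub>m Id D A) \<cdot> mixed_law A m \<delta> X \<cdot> (\<theta> \<odot>\<^sub>m Id D A)"

definition hopf_modules :: "'o \<Rightarrow> 'm \<Rightarrow> 'm \<Rightarrow> 'm \<Rightarrow> 'm \<Rightarrow> ('o \<times> 'm \<times> 'm, 'm) cat" where
  "hopf_modules A m e \<delta> \<epsilon> =
     \<lparr>Ob = {(X, h, \<theta>). is_hopf_module A m e \<delta> \<epsilon> X h \<theta>},
      Hom = (\<lambda>(X, h, \<theta>) (Y, k, \<kappa>).
        {f. is_hopf_module A m e \<delta> \<epsilon> X h \<theta> \<and> is_hopf_module A m e \<delta> \<epsilon> Y k \<kappa> \<and>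
            module_mor D (circ D) A (X, h) (Y, k) f \<and>
            comodule_mor D (star D) A (X, \<theta>) (Y, \<kappa>) f}),
      Id = (\<lambda>(X, h, \<theta>). Id D X),
      Comp = Comp D\<rparr>"

definition comparison_action :: "'o \<Rightarrow> 'm \<Rightarrow> 'o \<times> 'm \<Rightarrow> 'm" where
  "comparison_action A m = (\<lambda>(X, h).
     (h \<ast>\<^sub>m m) \<cdot> zeta D X A \<J> A \<cdot> (Id D (X \<ast> A) \<odot>\<^sub>m lunit_inv D (star D) A))"

definition comparison_functor :: "'o \<Rightarrow> 'm \<Rightarrow> 'm \<Rightarrow> ('o \<times> 'm, 'm, 'o \<times> 'm \<times> 'm, 'm) func" where
  "comparison_functor A m \<delta> =
     \<lparr>fob = (\<lambda>(X, h). (X \<ast> A, comparison_action A m (X, h),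
                        assoc_inv D (star D) X A A \<cdot> (Id D X \<ast>\<^sub>m \<delta>))),
      fmor = (\<lambda>_ _ f. f \<ast>\<^sub>m Id D A)\<rparr>"

definition galois_mor :: "'o \<Rightarrow> 'm \<Rightarrow> 'm \<Rightarrow> 'm \<Rightarrow> 'o \<times> 'm \<Rightarrow> 'm" where
  "galois_mor A m \<delta> \<epsilon> P =
     comparison_action A m (fob adj_left P) \<cdot>\<^bsub>comodules D (star D) A \<delta> \<epsilon>\<^esub>
     fmor (lifted_monad A m \<delta>) P (fob (adj_right A \<delta> \<circ>\<^sub>F adj_left) P) (adj_unit A \<delta> \<epsilon> P)"

definition is_galois :: "'o \<Rightarrow> 'm \<Rightarrow> 'm \<Rightarrow> 'm \<Rightarrow> bool" where
  "is_galois A m \<delta> \<epsilon> \<longleftrightarrow>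
     nat_iso (comodules D (star D) A \<delta> \<epsilon>) (comodules D (star D) A \<delta> \<epsilon>)
       (lifted_monad A m \<delta>) (adj_right A \<delta> \<circ>\<^sub>F adj_left) (galois_mor A m \<delta> \<epsilon>)"

end

end

(*
  Let F be left adjoint to Q = phi^A U_J with unit eta and counit eps, and let T be the monad on
  D^A lifting - o A.  The functor K' satisfies V K' = Q for the forgetful functor V from Hopf
  modules, and the Galois map t = rho F . T eta is the T-linear extension of eta from the free Hopf
  modules.  If K' is full and faithful, composition with t is therefore a bijection on maps into
  every K'(M); if K' is also essentially surjective, t is invertible.

  Conversely, each of (i)-(iii) gives a natural section of the counit in the case A = I, and the
  comonoid map e : I -> A turns it into a natural section sigma of eps.  If t is invertible, a Hopf
  module P with action act carries the action a = act . t^-1 of the monad Q F.  The endomorphism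
  F a . sigma of F V P is then idempotent, and K'(M) is isomorphic to P for its splitting M.

  The axioms of the Hopf modules K'(M) follow from those of the mixed distributive law lambda,
  because rho_(X,h) = ((h . (X o epsilon)) * A) . lambda_X.
*)
theory Submission
  imports Defs
begin

section \<open>Arrows with source and target\<close>

text \<open>The converse is Beck's argument with the coequalizer replaced by an idempotent. An
  object with \<open>Q F\<close>-action \<open>a\<close> ought to come from a coequalizer of
  \<open>F a\<close> and the counit. A natural section \<open>\<sigma>\<close> makes this pair
  contractible: naturality of \<open>\<sigma>\<close> and associativity of \<open>a\<close> give
  \<open>(F a . \<sigma>) . F a = (F a . \<sigma>) . \<epsilon>\<close>. Such a pair is coequalized
  by any splitting of \<open>F a . \<sigma>\<close>, and every functor, hence \<open>Q\<close>,
  preserves that coequalizer. So split idempotents are the only colimits required; they are wanted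
  among \<open>J\<close>-modules, which inherit them from the base category.

  The counit of the composite adjunction for a comonoid involves the comonoid only through its own
  counit; this is why \<open>\<epsilon> \<cdot> e = \<tau>\<close> carries a section from
  \<open>I\<close> to \<open>A\<close>. In case (i) a section \<open>s\<close> of
  \<open>\<tau>\<close> forces each \<open>J\<close>-action to be the right unit constraint after
  tensoring with \<open>s\<close>, so every morphism between underlying objects is
  \<open>J\<close>-linear.\<close>

datatype ('o, 'm) arrow = Arr (src: 'o) (mor: 'm) (trg: 'o)

lemma all_arrow_iff: "(\<forall>a. P a) \<longleftrightarrow> (\<forall>X f Y. P (Arr X f Y))"
  by (metis arrow.exhaust)

text \<open>Hom-sets may overlap, so a bare morphism does not know its ends. Packing them in turns
  membership in a hom-set into a predicate of one argument and composability into the equation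
  \<open>src g = trg f\<close>, which the simplifier discharges, and it lets a functor act on one
  argument, see \<open>fmap\<close>.\<close>

definition arrow :: "('o, 'm, 'z) cat_scheme \<Rightarrow> ('o, 'm) arrow \<Rightarrow> bool" where
  "arrow C a \<longleftrightarrow> mor a \<in> Hom C (src a) (trg a)"

lemma arrow_triple [simp]: "arrow C (Arr X f Y) \<longleftrightarrow> f \<in> Hom C X Y"
  by (simp add: arrow_def)

definition comp_arrow ::
  "('o, 'm, 'z) cat_scheme \<Rightarrow> ('o, 'm) arrow \<Rightarrow> ('o, 'm) arrow \<Rightarrow> ('o, 'm) arrow"
  (infixr "\<bullet>\<index>" 55) where
  "g \<bullet>\<^bsub>C\<^esub> f = Arr (src f) (mor g \<cdot>\<^bsub>C\<^esub> mor f) (trg g)"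

definition id_arrow :: "('o, 'm, 'z) cat_scheme \<Rightarrow> 'o \<Rightarrow> ('o, 'm) arrow" where
  "id_arrow C X = Arr X (Id C X) X"

lemma comp_arrow_sel [simp]:
  "src (g \<bullet>\<^bsub>C\<^esub> f) = src f" "trg (g \<bullet>\<^bsub>C\<^esub> f) = trg g" "mor (g \<bullet>\<^bsub>C\<^esub> f) = mor g \<cdot>\<^bsub>C\<^esub> mor f"
  by (simp_all add: comp_arrow_def)

lemma comp_triple: "Arr Y g Z \<bullet>\<^bsub>C\<^esub> Arr X f Y' = Arr X (g \<cdot>\<^bsub>C\<^esub> f) Z"
  by (simp add: comp_arrow_def)

lemma id_arrow_sel [simp]:
  "src (id_arrow C X) = X" "trg (id_arrow C X) = X" "mor (id_arrow C X) = Id C X"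
  by (simp_all add: id_arrow_def)

context category
begin

lemma arrow_src [simp]: "arrow C f \<Longrightarrow> src f \<in> Ob C"
  and arrow_trg [simp]: "arrow C f \<Longrightarrow> trg f \<in> Ob C"
  using Hom_Ob by (auto simp: arrow_def)

lemma arrow_comp [simp]: "\<lbrakk>arrow C g; arrow C f; src g = trg f\<rbrakk> \<Longrightarrow> arrow C (g \<bullet> f)"
  using Comp_Hom by (auto simp: arrow_def)

lemma arrow_id [simp]: "X \<in> Ob C \<Longrightarrow> arrow C (id_arrow C X)"
  using Id_Hom by (auto simp: arrow_def)

lemma comp_id_left [simp]: "\<lbrakk>arrow C f; trg f = X\<rbrakk> \<Longrightarrow> id_arrow C X \<bullet> f = f"
  using Id_left by (intro arrow.expand) (auto simp: arrow_def)

lemma comp_id_right [simp]: "\<lbrakk>arrow C f; src f = X\<rbrakk> \<Longrightarrow> f \<bullet> id_arrow C X = f"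
  using Id_right by (intro arrow.expand) (auto simp: arrow_def)

lemma arrow_assoc [simp]:
  "\<lbrakk>arrow C h; arrow C g; arrow C f; src h = trg g; src g = trg f\<rbrakk>
   \<Longrightarrow> (h \<bullet> g) \<bullet> f = h \<bullet> (g \<bullet> f)"
  using Comp_assoc by (intro arrow.expand) (auto simp: arrow_def)

text \<open>Simplification nests composites to the right, so in a longer chain the left side of an
  equation \<open>h \<bullet> g = k\<close> no longer occurs as a subterm. This form of the
  equation, with a tail \<open>f\<close>, still applies.\<close>

lemma reassoc:
  "\<lbrakk>h \<bullet> g = k; arrow C h; arrow C g; arrow C f; src h = trg g; src g = trg f\<rbrakk>
   \<Longrightarrow> h \<bullet> (g \<bullet> f) = k \<bullet> f"
  by (metis arrow_assoc)

definition inverse_arrows :: "('o, 'm) arrow \<Rightarrow> ('o, 'm) arrow \<Rightarrow> bool" where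
  "inverse_arrows f g \<longleftrightarrow> arrow C f \<and> arrow C g \<and> src g = trg f \<and> trg g = src f \<and>
     g \<bullet> f = id_arrow C (src f) \<and> f \<bullet> g = id_arrow C (trg f)"

lemma mutually_inverse_iff:
  "mutually_inverse C X Y f g \<longleftrightarrow> inverse_arrows (Arr X f Y) (Arr Y g X)"
  by (auto simp: mutually_inverse_def inverse_arrows_def comp_triple id_arrow_def)

lemma mutually_inverse_unique:
  assumes "mutually_inverse C X Y f g" "mutually_inverse C X Y f h"
  shows "h = g"
proof -
  have "Arr Y h X = Arr Y h X \<bullet> (Arr X f Y \<bullet> Arr Y g X)"
    using assms by (simp add: mutually_inverse_iff inverse_arrows_def)
  also have "\<dots> = (Arr Y h X \<bullet> Arr X f Y) \<bullet> Arr Y g X"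
    using assms unfolding mutually_inverse_iff inverse_arrows_def by (intro arrow_assoc [symmetric]) auto
  also have "\<dots> = Arr Y g X"
    using assms by (simp add: mutually_inverse_iff inverse_arrows_def)
  finally show ?thesis by simp
qed

lemma inverse_of_mutual: "is_iso C X Y f \<Longrightarrow> mutually_inverse C X Y f (inverse_of C X Y f)"
  unfolding is_iso_def inverse_of_def using mutually_inverse_unique by (metis (mono_tags) theI')

lemma is_isoE:
  assumes "is_iso C X Y f"
  obtains g where "inverse_arrows (Arr X f Y) g" "src g = Y" "trg g = X"
  using assms unfolding is_iso_def mutually_inverse_iff by (metis arrow.sel)

lemma is_isoI: "inverse_arrows (Arr X f Y) g \<Longrightarrow> is_iso C X Y f"
  unfolding is_iso_def mutually_inverse_iff inverse_arrows_def by (metis arrow.collapse arrow.sel)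

lemma inverse_arrowsD:
  assumes "inverse_arrows f g"
  shows "arrow C f" "arrow C g" "src g = trg f" "trg g = src f"
    "g \<bullet> f = id_arrow C (src f)" "f \<bullet> g = id_arrow C (trg f)"
  using assms by (auto simp: inverse_arrows_def)

lemma inverse_arrows_cancel:
  assumes "inverse_arrows f g" "arrow C h"
  shows "trg h = src f \<Longrightarrow> g \<bullet> f \<bullet> h = h" "trg h = trg f \<Longrightarrow> f \<bullet> g \<bullet> h = h"
  using reassoc [OF inverse_arrowsD(5) [OF assms(1)], of h]
    reassoc [OF inverse_arrowsD(6) [OF assms(1)], of h]
    inverse_arrowsD[OF assms(1)] assms(2) by auto

lemma inverse_arrows_comp:
  assumes "inverse_arrows f f'" "inverse_arrows g g'" "src g = trg f"
  shows "inverse_arrows (g \<bullet> f) (f' \<bullet> g')"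
  using assms(3) inverse_arrowsD [OF assms(1)] inverse_arrowsD [OF assms(2)]
    inverse_arrows_cancel [OF assms(1)] inverse_arrows_cancel [OF assms(2)]
  unfolding inverse_arrows_def [of "g \<bullet> f"] by simp

lemma cauchy_completeE:
  assumes "cauchy_complete C" "arrow C p" "src p = trg p" "p \<bullet> p = p"
  obtains r i where "arrow C r" "arrow C i" "src r = src p" "src i = trg r" "trg i = src p"
    "r \<bullet> i = id_arrow C (trg r)" "i \<bullet> r = p"
proof -
  have "mor p \<in> Hom C (src p) (src p) \<and> mor p \<cdot> mor p = mor p"
    using assms(2,3) arg_cong [OF assms(4), of mor] by (simp add: arrow_def)
  then obtain Y r i where "r \<in> Hom C (src p) Y" "i \<in> Hom C Y (src p)" "r \<cdot> i = Id C Y" "i \<cdot> r = mor p"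
    using assms(1) unfolding cauchy_complete_def by metis
  then show ?thesis
    using assms(3) by (intro that [of "Arr (src p) r Y" "Arr Y i (src p)"])
      (simp_all add: comp_triple id_arrow_def arrow.expand)
qed

lemma iso_left_cancel:
  "\<lbrakk>inverse_arrows f g; f \<bullet> h = f \<bullet> k; arrow C h; arrow C k; trg h = src f; trg k = src f\<rbrakk> \<Longrightarrow> h = k"
  by (metis inverse_arrows_cancel(1))

lemma iso_right_cancel:
  assumes "inverse_arrows f g" "h \<bullet> f = k \<bullet> f" "arrow C h" "arrow C k" "src h = trg f" "src k = trg f"
  shows "h = k"
proof -
  have "h = (h \<bullet> f) \<bullet> g" "k = (k \<bullet> f) \<bullet> g"
    using assms(3-) inverse_arrowsD [OF assms(1)] by auto
  then show ?thesis using assms(2) by simp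
qed

end

section \<open>Functors and natural transformations on arrows\<close>

definition fmap :: "('o, 'm, 'p, 'n) func \<Rightarrow> ('o, 'm) arrow \<Rightarrow> ('p, 'n) arrow" where
  "fmap F f = Arr (fob F (src f)) (fmor F (src f) (trg f) (mor f)) (fob F (trg f))"

lemma fmap_sel [simp]: "src (fmap F f) = fob F (src f)" "trg (fmap F f) = fob F (trg f)"
  "mor (fmap F f) = fmor F (src f) (trg f) (mor f)"
  by (simp_all add: fmap_def)

lemma id_func_simps [simp]: "fob id_func X = X" "fmap id_func f = f"
  by (simp_all add: id_func_def fmap_def arrow.collapse)

lemma comp_func_simps [simp]:
  "fob (G \<circ>\<^sub>F F) X = fob G (fob F X)" "fmap (G \<circ>\<^sub>F F) f = fmap G (fmap F f)"
  by (simp_all add: comp_func_def fmap_def)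

lemma is_functor_iff:
  "is_functor C D F \<longleftrightarrow>
     (\<forall>X \<in> Ob C. fob F X \<in> Ob D) \<and> (\<forall>f. arrow C f \<longrightarrow> arrow D (fmap F f)) \<and>
     (\<forall>X \<in> Ob C. fmap F (id_arrow C X) = id_arrow D (fob F X)) \<and>
     (\<forall>f g. arrow C f \<longrightarrow> arrow C g \<longrightarrow> src g = trg f \<longrightarrow>
        fmap F (g \<bullet>\<^bsub>C\<^esub> f) = fmap F g \<bullet>\<^bsub>D\<^esub> fmap F f)"
  unfolding is_functor_def all_arrow_iff
  by (auto simp: id_arrow_def comp_triple fmap_def)

lemma nat_trans_iff:
  "nat_trans C D F G \<alpha> \<longleftrightarrow> is_functor C D F \<and> is_functor C D G \<and>
     (\<forall>X \<in> Ob C. arrow D (Arr (fob F X) (\<alpha> X) (fob G X))) \<and>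
     (\<forall>f. arrow C f \<longrightarrow>
        Arr (fob F (trg f)) (\<alpha> (trg f)) (fob G (trg f)) \<bullet>\<^bsub>D\<^esub> fmap F f
        = fmap G f \<bullet>\<^bsub>D\<^esub> Arr (fob F (src f)) (\<alpha> (src f)) (fob G (src f)))"
  unfolding nat_trans_def all_arrow_iff
  by (auto simp: comp_triple fmap_def)

locale functor_between = C: category C + D: category D
  for C :: "('o, 'm, 'z) cat_scheme" and D :: "('p, 'n, 'y) cat_scheme" +
  fixes F :: "('o, 'm, 'p, 'n) func"
  assumes is_functor: "is_functor C D F"
begin

lemma preserves [simp]:
  "X \<in> Ob C \<Longrightarrow> fob F X \<in> Ob D" "arrow C f \<Longrightarrow> arrow D (fmap F f)"
  "X \<in> Ob C \<Longrightarrow> fmap F (id_arrow C X) = id_arrow D (fob F X)"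
  "\<lbrakk>arrow C f; arrow C g; src g = trg f\<rbrakk> \<Longrightarrow> fmap F (g \<bullet>\<^bsub>C\<^esub> f) = fmap F g \<bullet>\<^bsub>D\<^esub> fmap F f"
  using is_functor unfolding is_functor_iff by blast+

lemma preserves_inverse: "C.inverse_arrows f g \<Longrightarrow> D.inverse_arrows (fmap F f) (fmap F g)"
  unfolding C.inverse_arrows_def D.inverse_arrows_def
  using preserves(3,4) by (metis C.arrow_src C.arrow_trg fmap_sel(1,2) preserves(2))

end

lemma functor_compose:
  "is_functor C D F \<Longrightarrow> is_functor D E G \<Longrightarrow> is_functor C E (G \<circ>\<^sub>F F)"
  unfolding is_functor_iff by simp

lemma id_functor: "is_functor C C id_func"
  by (simp add: is_functor_iff)

section \<open>Equivalences as full, faithful and essentially surjective functors\<close>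

definition essentially_surjective ::
  "('o, 'm, 'z) cat_scheme \<Rightarrow> ('p, 'n, 'y) cat_scheme \<Rightarrow> ('o, 'm, 'p, 'n) func \<Rightarrow> bool" where
  "essentially_surjective C D F \<longleftrightarrow> (\<forall>Y \<in> Ob D. \<exists>X \<in> Ob C. \<exists>f. is_iso D (fob F X) Y f)"

text \<open>Naturality gives \<open>\<alpha> . f = G F f . \<alpha>\<close>. The right side depends
  on \<open>f\<close> only through \<open>F f\<close> and the ends, and the component of
  \<open>\<alpha>\<close> on the left cancels.\<close>

lemma faithful_if_left_inverse:
  assumes "category C" "nat_iso C C id_func (G \<circ>\<^sub>F F) \<alpha>" "arrow C f" "arrow C g"
    "src f = src g" "trg f = trg g" "fmap F f = fmap F g"
  shows "f = g"
proof -
  interpret C: category C by fact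
  have iso: "is_iso C (trg f) (fob G (fob F (trg f))) (\<alpha> (trg f))"
    using assms(2,3) by (simp add: nat_iso_def)
  then obtain b where b: "C.inverse_arrows (Arr (trg f) (\<alpha> (trg f)) (fob G (fob F (trg f)))) b"
    by (rule C.is_isoE)
  have nat: "\<And>h. arrow C h \<Longrightarrow>
     Arr (trg h) (\<alpha> (trg h)) (fob G (fob F (trg h))) \<bullet>\<^bsub>C\<^esub> h
     = fmap G (fmap F h) \<bullet>\<^bsub>C\<^esub> Arr (src h) (\<alpha> (src h)) (fob G (fob F (src h)))"
    using assms(2) by (simp add: nat_iso_def nat_trans_iff)
  have "Arr (trg f) (\<alpha> (trg f)) (fob G (fob F (trg f))) \<bullet>\<^bsub>C\<^esub> f
      = Arr (trg f) (\<alpha> (trg f)) (fob G (fob F (trg f))) \<bullet>\<^bsub>C\<^esub> g"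
    using nat [OF assms(3)] nat [OF assms(4)] assms(5-7) by metis
  then show ?thesis
    by (rule C.iso_left_cancel [OF b]) (use assms(3,4,6) in simp_all)
qed

lemma full_and_faithful_iff:
  "full_and_faithful C D F \<longleftrightarrow> is_functor C D F \<and>
     (\<forall>f g. arrow C f \<and> arrow C g \<and> src f = src g \<and> trg f = trg g \<and> fmap F f = fmap F g
        \<and> src f \<in> Ob C \<and> trg f \<in> Ob C \<longrightarrow> f = g) \<and>
     (\<forall>X \<in> Ob C. \<forall>Y \<in> Ob C. \<forall>h. arrow D h \<and> src h = fob F X \<and> trg h = fob F Y \<longrightarrow>
        (\<exists>f. arrow C f \<and> src f = X \<and> trg f = Y \<and> fmap F f = h))"
  (is "?L \<longleftrightarrow> ?R")
proof
  assume L: ?L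
  show ?R
  proof (intro conjI allI ballI impI)
    show "is_functor C D F" using L by (simp add: full_and_faithful_def)
  next
    fix f g
    assume a: "arrow C f \<and> arrow C g \<and> src f = src g \<and> trg f = trg g \<and> fmap F f = fmap F g
      \<and> src f \<in> Ob C \<and> trg f \<in> Ob C"
    then have "inj_on (fmor F (src f) (trg f)) (Hom C (src f) (trg f))"
      using L by (auto simp: full_and_faithful_def bij_betw_def)
    then have "mor f = mor g"
      using a by (auto simp: arrow_def fmap_def inj_on_def)
    then show "f = g" using a by (intro arrow.expand) auto
  next
    fix X Y h
    assume XY: "X \<in> Ob C" "Y \<in> Ob C" and h: "arrow D h \<and> src h = fob F X \<and> trg h = fob F Y"
    then have "mor h \<in> fmor F X Y ` Hom C X Y"
      using L by (auto simp: full_and_faithful_def bij_betw_def arrow_def)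
    then obtain k where "k \<in> Hom C X Y" "mor h = fmor F X Y k" by auto
    then show "\<exists>f. arrow C f \<and> src f = X \<and> trg f = Y \<and> fmap F f = h"
      using h by (intro exI [of _ "Arr X k Y"]) (auto intro!: arrow.expand)
  qed
next
  assume R: ?R
  show ?L unfolding full_and_faithful_def
  proof (intro conjI ballI)
    show F: "is_functor C D F" using R by simp
    fix X Y assume XY: "X \<in> Ob C" "Y \<in> Ob C"
    show "bij_betw (fmor F X Y) (Hom C X Y) (Hom D (fob F X) (fob F Y))"
      unfolding bij_betw_def
    proof
      show "inj_on (fmor F X Y) (Hom C X Y)"
      proof (rule inj_onI)
        fix f g assume fg: "f \<in> Hom C X Y" "g \<in> Hom C X Y" "fmor F X Y f = fmor F X Y g"
        have "fmap F (Arr X f Y) = fmap F (Arr X g Y)" using fg(3) by (simp add: fmap_def)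
        then have "Arr X f Y = Arr X g Y" using R XY fg(1,2) by (metis arrow.sel arrow_triple)
        then show "f = g" by simp
      qed
      show "fmor F X Y ` Hom C X Y = Hom D (fob F X) (fob F Y)"
      proof
        show "fmor F X Y ` Hom C X Y \<subseteq> Hom D (fob F X) (fob F Y)"
          using F by (auto simp: is_functor_def)
        show "Hom D (fob F X) (fob F Y) \<subseteq> fmor F X Y ` Hom C X Y"
        proof
          fix h assume "h \<in> Hom D (fob F X) (fob F Y)"
          then obtain f where "arrow C f" "src f = X" "trg f = Y" "fmap F f = Arr (fob F X) h (fob F Y)"
            using R XY by (metis arrow.sel arrow_triple)
          then show "h \<in> fmor F X Y ` Hom C X Y"
            by (intro image_eqI [of _ _ "mor f"]) (auto simp: arrow_def fmap_def)
        qed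
      qed
    qed
  qed
qed

lemma equivalence_imp:
  assumes "category C" "category D" "equivalence C D F"
  shows "full_and_faithful C D F" "essentially_surjective C D F"
proof -
  interpret C: category C by fact
  interpret D: category D by fact
  obtain G \<alpha> \<beta> where G: "is_functor D C G" and \<alpha>: "nat_iso C C id_func (G \<circ>\<^sub>F F) \<alpha>"
    and \<beta>: "nat_iso D D (F \<circ>\<^sub>F G) id_func \<beta>"
    using assms(3) by (auto simp: equivalence_def)
  interpret F: functor_between C D F
    using assms by unfold_locales (simp add: equivalence_def)
  interpret G: functor_between D C G
    by unfold_locales (rule G)
  show "essentially_surjective C D F"
    unfolding essentially_surjective_def using \<beta> by (auto simp: nat_iso_def intro!: bexI[of _ "fob G _"])
  have \<alpha>_nat: "Arr (trg f) (\<alpha> (trg f)) (fob G (fob F (trg f))) \<bullet>\<^bsub>C\<^esub> f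
      = fmap G (fmap F f) \<bullet>\<^bsub>C\<^esub> Arr (src f) (\<alpha> (src f)) (fob G (fob F (src f)))" if "arrow C f" for f
    using \<alpha> that by (simp add: nat_iso_def nat_trans_iff)
  have \<beta>_nat: "Arr (fob F (fob G (trg f))) (\<beta> (trg f)) (trg f) \<bullet>\<^bsub>D\<^esub> fmap F (fmap G f)
      = f \<bullet>\<^bsub>D\<^esub> Arr (fob F (fob G (src f))) (\<beta> (src f)) (src f)" if "arrow D f" for f
    using \<beta> that by (simp add: nat_iso_def nat_trans_iff)
  \<comment> \<open>Dual to \<open>faithful_if_left_inverse\<close>: naturality of
    \<open>\<beta>\<close> expresses \<open>f . \<beta>\<close> through \<open>G f\<close>.
    Faithfulness of \<open>G\<close> is what turns \<open>G F f = G h\<close> into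
    \<open>F f = h\<close> below.\<close>
  have G_faithful: "f = g" if fg: "arrow D f" "arrow D g" "src f = src g" "trg f = trg g"
    "fmap G f = fmap G g" for f g
  proof -
    have "is_iso D (fob F (fob G (src f))) (src f) (\<beta> (src f))"
      using \<beta> fg by (simp add: nat_iso_def)
    then obtain b where b: "D.inverse_arrows (Arr (fob F (fob G (src f))) (\<beta> (src f)) (src f)) b"
      by (rule D.is_isoE)
    have "f \<bullet>\<^bsub>D\<^esub> Arr (fob F (fob G (src f))) (\<beta> (src f)) (src f)
        = g \<bullet>\<^bsub>D\<^esub> Arr (fob F (fob G (src f))) (\<beta> (src f)) (src f)"
      using \<beta>_nat [OF fg(1)] \<beta>_nat [OF fg(2)] fg(3-5) by metis
    then show "f = g"
      by (rule D.iso_right_cancel [OF b]) (use fg(1-3) in simp_all)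
  qed
  show "full_and_faithful C D F"
    unfolding full_and_faithful_iff
  proof (intro conjI allI ballI impI)
    show "is_functor C D F" by (rule F.is_functor)
  next
    fix f g
    assume "arrow C f \<and> arrow C g \<and> src f = src g \<and> trg f = trg g \<and> fmap F f = fmap F g
        \<and> src f \<in> Ob C \<and> trg f \<in> Ob C"
    then show "f = g" using faithful_if_left_inverse [OF assms(1) \<alpha>] by blast
  next
    fix X Y h
    assume X: "X \<in> Ob C" and Y: "Y \<in> Ob C"
      and h: "arrow D h \<and> src h = fob F X \<and> trg h = fob F Y"
    let ?a = "\<lambda>X. Arr X (\<alpha> X) (fob G (fob F X))"
    obtain b where b: "C.inverse_arrows (?a Y) b" "src b = fob G (fob F Y)" "trg b = Y"
      using \<alpha> Y by (auto simp: nat_iso_def elim!: C.is_isoE)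
    obtain c where c: "C.inverse_arrows (?a X) c"
      using \<alpha> X by (auto simp: nat_iso_def elim!: C.is_isoE)
    note arr = C.inverse_arrowsD(1,2) [OF b(1)] C.inverse_arrowsD(1,2) [OF c(1)]
    \<comment> \<open>Naturality of \<open>\<alpha>\<close> gives
      \<open>\<alpha> . f = G (F f) . \<alpha>\<close>, so the wish \<open>F f = h\<close> leaves no
      other choice for \<open>f\<close>.\<close>
    define f where "f = b \<bullet>\<^bsub>C\<^esub> fmap G h \<bullet>\<^bsub>C\<^esub> ?a X"
    have f: "arrow C f" "src f = X" "trg f = Y"
      using arr b h unfolding f_def by (auto simp del: arrow_triple)
    have "fmap G (fmap F f) \<bullet>\<^bsub>C\<^esub> ?a X = ?a Y \<bullet>\<^bsub>C\<^esub> f"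
      using \<alpha>_nat [OF f(1)] f by simp
    also have "\<dots> = fmap G h \<bullet>\<^bsub>C\<^esub> ?a X"
      using arr h f C.inverse_arrows_cancel(2) [OF b(1)] unfolding f_def
      by (simp del: arrow_triple)
    finally have "fmap G (fmap F f) = fmap G h"
      by (rule C.iso_right_cancel [OF c]) (use f h in simp_all)
    then have "fmap F f = h" by (intro G_faithful) (use f h in simp_all)
    then show "\<exists>f. arrow C f \<and> src f = X \<and> trg f = Y \<and> fmap F f = h" using f by blast
  qed
qed

lemma equivalenceI:
  assumes "category C" "category D" and ff: "full_and_faithful C D F"
    and es: "essentially_surjective C D F"
  shows "equivalence C D F"
proof -
  interpret C: category C by fact
  interpret D: category D by fact
  interpret F: functor_between C D F
    using ff by unfold_locales (simp add: full_and_faithful_def)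
  have faithful: "f = g" if "arrow C f" "arrow C g" "src f = src g" "trg f = trg g"
    "fmap F f = fmap F g" for f g
    using ff that C.arrow_src [of f] C.arrow_trg [of f] unfolding full_and_faithful_iff by blast
  have full: "\<exists>f. arrow C f \<and> src f = X \<and> trg f = Y \<and> fmap F f = h"
    if "X \<in> Ob C" "Y \<in> Ob C" "arrow D h" "src h = fob F X" "trg h = fob F Y" for X Y h
    using ff that unfolding full_and_faithful_iff by blast
  \<comment> \<open>Object, isomorphism and inverse are packed into one value so that a single
    application of choice yields all three; they become \<open>g\<close>, \<open>b\<close> and
    \<open>b'\<close>.\<close>
  have "\<exists>g\<beta>\<gamma>. fst g\<beta>\<gamma> \<in> Ob C \<and> D.inverse_arrows (fst (snd g\<beta>\<gamma>)) (snd (snd g\<beta>\<gamma>)) \<and>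
      src (fst (snd g\<beta>\<gamma>)) = fob F (fst g\<beta>\<gamma>) \<and> trg (fst (snd g\<beta>\<gamma>)) = Y" if "Y \<in> Ob D" for Y
    using es that unfolding essentially_surjective_def
    by (metis D.is_isoE arrow.sel(1,3) fst_conv snd_conv)
  then obtain w where w: "\<And>Y. Y \<in> Ob D \<Longrightarrow> fst (w Y) \<in> Ob C \<and>
      D.inverse_arrows (fst (snd (w Y))) (snd (snd (w Y))) \<and>
      src (fst (snd (w Y))) = fob F (fst (w Y)) \<and> trg (fst (snd (w Y))) = Y"
    by metis
  define g where "g Y = fst (w Y)" for Y
  define b where "b Y = fst (snd (w Y))" for Y
  define b' where "b' Y = snd (snd (w Y))" for Y
  have g [simp]: "g Y \<in> Ob C" if "Y \<in> Ob D" for Y using w that by (simp add: g_def)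
  have b_inv: "D.inverse_arrows (b Y) (b' Y)" if "Y \<in> Ob D" for Y
    using w that by (simp add: b_def b'_def)
  have b_sel [simp]: "src (b Y) = fob F (g Y)" "trg (b Y) = Y" if "Y \<in> Ob D" for Y
    using w that by (simp_all add: b_def g_def)
  have b [simp]: "arrow D (b Y)" "arrow D (b' Y)" "src (b' Y) = Y" "trg (b' Y) = fob F (g Y)"
    "b' Y \<bullet>\<^bsub>D\<^esub> b Y = id_arrow D (fob F (g Y))" "b Y \<bullet>\<^bsub>D\<^esub> b' Y = id_arrow D Y" if "Y \<in> Ob D" for Y
    using D.inverse_arrowsD [OF b_inv [OF that]] that by auto
  note bc [simp] = D.inverse_arrows_cancel [OF b_inv]
  \<comment> \<open>By faithfulness the preimage is unique. Hence equations between such preimages,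
    including functoriality of \<open>G\<close> and naturality of the unit, may be checked after
    applying \<open>F\<close>.\<close>
  define pre where "pre X Y h = (SOME f. arrow C f \<and> src f = X \<and> trg f = Y \<and> fmap F f = h)" for X Y h
  have pre: "arrow C (pre X Y h) \<and> src (pre X Y h) = X \<and> trg (pre X Y h) = Y \<and> fmap F (pre X Y h) = h"
    if "X \<in> Ob C" "Y \<in> Ob C" "arrow D h" "src h = fob F X" "trg h = fob F Y" for X Y h
    unfolding pre_def by (rule someI_ex [OF full [OF that]])
  define Gm where "Gm h = pre (g (src h)) (g (trg h)) (b' (trg h) \<bullet>\<^bsub>D\<^esub> h \<bullet>\<^bsub>D\<^esub> b (src h))" for h
  define G where "G = \<lparr>fob = g, fmor = (\<lambda>X Y h. mor (Gm (Arr X h Y)))\<rparr>"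
  have Gm: "arrow C (Gm h)" "src (Gm h) = g (src h)" "trg (Gm h) = g (trg h)"
    "fmap F (Gm h) = b' (trg h) \<bullet>\<^bsub>D\<^esub> h \<bullet>\<^bsub>D\<^esub> b (src h)" if "arrow D h" for h
    using pre [of "g (src h)" "g (trg h)" "b' (trg h) \<bullet>\<^bsub>D\<^esub> h \<bullet>\<^bsub>D\<^esub> b (src h)"] that
    unfolding Gm_def by auto
  have G_ob [simp]: "fob G X = g X" for X by (simp add: G_def)
  have fmapG: "fmap G h = Gm h" if "arrow D h" for h
    using Gm(2,3) [OF that] by (intro arrow.expand) (simp_all add: G_def fmap_def arrow.collapse)
  have G: "is_functor D C G"
    unfolding is_functor_iff
  proof (intro conjI ballI allI impI)
    fix X assume X: "X \<in> Ob D"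
    show "fob G X \<in> Ob C" using X by simp
    show "fmap G (id_arrow D X) = id_arrow C (fob G X)"
      using X Gm [of "id_arrow D X"] by (intro faithful) (auto simp: fmapG)
  next
    fix f assume "arrow D f" then show "arrow C (fmap G f)" by (simp add: fmapG Gm)
  next
    fix f h assume fh: "arrow D f" "arrow D h" "src h = trg f"
    show "fmap G (h \<bullet>\<^bsub>D\<^esub> f) = fmap G h \<bullet>\<^bsub>C\<^esub> fmap G f"
      using fh Gm [of f] Gm [of h] Gm [of "h \<bullet>\<^bsub>D\<^esub> f"] by (intro faithful) (auto simp: fmapG)
  qed
  interpret G: functor_between D C G by unfold_locales (rule G)
  \<comment> \<open>The unit at \<open>X\<close> is the preimage of the inverse of the counit at
    \<open>F X\<close>, as a triangle identity demands.\<close>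
  define a where "a X = pre X (g (fob F X)) (b' (fob F X))" for X
  have a: "arrow C (a X)" "src (a X) = X" "trg (a X) = g (fob F X)" "fmap F (a X) = b' (fob F X)"
    if "X \<in> Ob C" for X
    using pre [of X "g (fob F X)" "b' (fob F X)"] that unfolding a_def by auto
  have a_triple: "Arr X (mor (a X)) (g (fob F X)) = a X" if "X \<in> Ob C" for X
    using a(2,3) [OF that] by (intro arrow.expand) auto
  have a_iso: "is_iso C X (g (fob F X)) (mor (a X))" if X: "X \<in> Ob C" for X
  proof (rule C.is_isoI)
    let ?c = "pre (g (fob F X)) X (b (fob F X))"
    have c: "arrow C ?c" "src ?c = g (fob F X)" "trg ?c = X" "fmap F ?c = b (fob F X)"
      using pre [of "g (fob F X)" X "b (fob F X)"] X by auto
    show "C.inverse_arrows (Arr X (mor (a X)) (g (fob F X))) ?c"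
      unfolding a_triple [OF X] C.inverse_arrows_def using X c a [OF X] by (auto intro!: faithful)
  qed
  have "nat_iso C C id_func (G \<circ>\<^sub>F F) (\<lambda>X. mor (a X))"
    unfolding nat_iso_def nat_trans_iff
    using a a_iso id_functor [of C] functor_compose [OF F.is_functor G]
    by (auto simp: a_triple simp del: arrow_triple intro!: faithful) (simp_all add: fmapG Gm)
  moreover have b_triple: "Arr (fob F (g Y)) (mor (b Y)) Y = b Y" if "Y \<in> Ob D" for Y
    using that by (intro arrow.expand) auto
  then have "nat_iso D D (F \<circ>\<^sub>F G) id_func (\<lambda>Y. mor (b Y))"
    unfolding nat_iso_def nat_trans_iff
    using functor_compose [OF G F.is_functor] id_functor [of D] b_inv
    by (auto simp: simp del: arrow_triple intro!: D.is_isoI) (simp_all add: fmapG Gm)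
  ultimately show ?thesis
    unfolding equivalence_def using F.is_functor G by blast
qed

section \<open>Adjunctions given by unit and counit\<close>

locale adjunction = C: category C + B: category B
  for C :: "('o, 'm, 'z) cat_scheme" (structure) and B :: "('p, 'n, 'y) cat_scheme" +
  fixes F :: "('o, 'm, 'p, 'n) func" and Q :: "('p, 'n, 'o, 'm) func"
    and \<eta> :: "'o \<Rightarrow> 'm" and \<epsilon> :: "'p \<Rightarrow> 'n"
  assumes left_functor: "is_functor C B F" and right_functor: "is_functor B C Q"
    and unit_nat: "nat_trans C C id_func (Q \<circ>\<^sub>F F) \<eta>"
    and counit_nat: "nat_trans B B (F \<circ>\<^sub>F Q) id_func \<epsilon>"
    and triangle_left: "X \<in> Ob C \<Longrightarrow>
      \<epsilon> (fob F X) \<cdot>\<^bsub>B\<^esub> fmor F X (fob Q (fob F X)) (\<eta> X) = Id B (fob F X)"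
    and triangle_right: "Y \<in> Ob B \<Longrightarrow>
      fmor Q (fob F (fob Q Y)) Y (\<epsilon> Y) \<cdot> \<eta> (fob Q Y) = Id C (fob Q Y)"
begin

sublocale F: functor_between C B F by unfold_locales (rule left_functor)
sublocale Q: functor_between B C Q by unfold_locales (rule right_functor)

definition eta :: "'o \<Rightarrow> ('o, 'm) arrow" where "eta X = Arr X (\<eta> X) (fob Q (fob F X))"
definition eps :: "'p \<Rightarrow> ('p, 'n) arrow" where "eps Y = Arr (fob F (fob Q Y)) (\<epsilon> Y) Y"

lemma eta_eps_sel [simp]: "src (eta X) = X" "trg (eta X) = fob Q (fob F X)"
  "src (eps Y) = fob F (fob Q Y)" "trg (eps Y) = Y"
  by (simp_all add: eta_def eps_def)

lemma eta_arrow [simp]: "X \<in> Ob C \<Longrightarrow> arrow C (eta X)"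
  and eps_arrow [simp]: "Y \<in> Ob B \<Longrightarrow> arrow B (eps Y)"
  using unit_nat counit_nat by (auto simp: nat_trans_iff eta_def eps_def)

lemma eta_natural: "arrow C f \<Longrightarrow> eta (trg f) \<bullet> f = fmap Q (fmap F f) \<bullet> eta (src f)"
  using unit_nat by (auto simp: nat_trans_iff eta_def)

lemma eps_natural: "arrow B f \<Longrightarrow> eps (trg f) \<bullet>\<^bsub>B\<^esub> fmap F (fmap Q f) = f \<bullet>\<^bsub>B\<^esub> eps (src f)"
  using counit_nat by (auto simp: nat_trans_iff eps_def)

lemma triangle1 [simp]: "X \<in> Ob C \<Longrightarrow> eps (fob F X) \<bullet>\<^bsub>B\<^esub> fmap F (eta X) = id_arrow B (fob F X)"
  using triangle_left by (simp add: comp_arrow_def eta_def eps_def fmap_def id_arrow_def)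

lemma triangle2 [simp]: "Y \<in> Ob B \<Longrightarrow> fmap Q (eps Y) \<bullet> eta (fob Q Y) = id_arrow C (fob Q Y)"
  using triangle_right by (simp add: comp_arrow_def eta_def eps_def fmap_def id_arrow_def)

text \<open>The transpose \<open>Q f . \<eta>\<close> determines \<open>f\<close>, since
  \<open>\<epsilon> . F (Q f . \<eta>) = f . \<epsilon> . F \<eta> = f\<close> by naturality and the
  first triangle identity.\<close>

lemma transpose_inject:
  assumes "arrow B f" "arrow B g" "src f = fob F X" "src g = fob F X" "trg f = trg g" "X \<in> Ob C"
    "fmap Q f \<bullet> eta X = fmap Q g \<bullet> eta X"
  shows "f = g"
proof -
  have "eps (trg h) \<bullet>\<^bsub>B\<^esub> fmap F (fmap Q h \<bullet> eta X) = h"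
    if "arrow B h" "src h = fob F X" for h
    using B.reassoc [OF eps_natural [of h], of "fmap F (eta X)"] that assms(6) by simp
  then show ?thesis using assms by metis
qed

end

section \<open>Adjunctions and the comparison functor\<close>

text \<open>Accepts unit and counit as families of arrows \<open>e\<close> and \<open>d\<close>,
  which are \<open>\<eta>\<close> and \<open>\<epsilon>\<close> with their ends attached, so that
  naturality and the triangle identities can be verified as equations between arrows.\<close>

lemma adjunctionI:
  fixes e :: "'o \<Rightarrow> ('o, 'm) arrow" and d :: "'p \<Rightarrow> ('p, 'n) arrow"
  assumes C: "category C" and B: "category B" and F: "is_functor C B F" and Q: "is_functor B C Q"
    and e: "\<And>X. e X = Arr X (\<eta> X) (fob Q (fob F X))"
    and d: "\<And>Y. d Y = Arr (fob F (fob Q Y)) (\<epsilon> Y) Y"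
    and e_arrow: "\<And>X. X \<in> Ob C \<Longrightarrow> arrow C (e X)"
    and d_arrow: "\<And>Y. Y \<in> Ob B \<Longrightarrow> arrow B (d Y)"
    and e_nat: "\<And>f. arrow C f \<Longrightarrow> e (trg f) \<bullet>\<^bsub>C\<^esub> f = fmap Q (fmap F f) \<bullet>\<^bsub>C\<^esub> e (src f)"
    and d_nat: "\<And>f. arrow B f \<Longrightarrow> d (trg f) \<bullet>\<^bsub>B\<^esub> fmap F (fmap Q f) = f \<bullet>\<^bsub>B\<^esub> d (src f)"
    and t1: "\<And>X. X \<in> Ob C \<Longrightarrow> d (fob F X) \<bullet>\<^bsub>B\<^esub> fmap F (e X) = id_arrow B (fob F X)"
    and t2: "\<And>Y. Y \<in> Ob B \<Longrightarrow> fmap Q (d Y) \<bullet>\<^bsub>C\<^esub> e (fob Q Y) = id_arrow C (fob Q Y)"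
  shows "adjunction C B F Q \<eta> \<epsilon>"
proof (intro adjunction.intro adjunction_axioms.intro C B F Q)
  show "nat_trans C C id_func (Q \<circ>\<^sub>F F) \<eta>"
    unfolding nat_trans_iff
    using functor_compose [OF F Q] id_functor [of C] e_arrow e_nat by (simp add: e)
  show "nat_trans B B (F \<circ>\<^sub>F Q) id_func \<epsilon>"
    unfolding nat_trans_iff
    using functor_compose [OF Q F] id_functor [of B] d_arrow d_nat by (simp add: d)
  show "\<epsilon> (fob F X) \<cdot>\<^bsub>B\<^esub> fmor F X (fob Q (fob F X)) (\<eta> X) = Id B (fob F X)" if "X \<in> Ob C" for X
    using arg_cong [OF t1 [OF that], of mor] by (simp add: e d)
  show "fmor Q (fob F (fob Q Y)) Y (\<epsilon> Y) \<cdot>\<^bsub>C\<^esub> \<eta> (fob Q Y) = Id C (fob Q Y)" if "Y \<in> Ob B" for Y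
    using arg_cong [OF t2 [OF that], of mor] by (simp add: e d)
qed

text \<open>In the first triangle identity naturality of \<open>A.eps\<close>, in the second
  naturality of \<open>A'.eta\<close>, moves the two middle factors past each other. What is left is
  one triangle identity of each given adjunction.\<close>

lemma adjunction_compose:
  assumes "adjunction C D F G \<eta> \<epsilon>" "adjunction D E F' G' \<eta>' \<epsilon>'"
  shows "adjunction C E (F' \<circ>\<^sub>F F) (G \<circ>\<^sub>F G')
    (composite_unit C F G \<eta> F' G' \<eta>') (composite_counit E F G \<epsilon> F' G' \<epsilon>')"
proof -
  interpret A: adjunction C D F G \<eta> \<epsilon> by fact
  interpret A': adjunction D E F' G' \<eta>' \<epsilon>' by fact
  let ?e = "\<lambda>X. fmap G (A'.eta (fob F X)) \<bullet>\<^bsub>C\<^esub> A.eta X"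
  let ?d = "\<lambda>Y. A'.eps Y \<bullet>\<^bsub>E\<^esub> fmap F' (A.eps (fob G' Y))"
  show ?thesis
  proof (rule adjunctionI [where e = ?e and d = ?d])
    show "category C" "category E" by unfold_locales
    show "is_functor C E (F' \<circ>\<^sub>F F)" "is_functor E C (G \<circ>\<^sub>F G')"
      by (auto intro: functor_compose A.left_functor A.right_functor A'.left_functor A'.right_functor)
    show "?e X = Arr X (composite_unit C F G \<eta> F' G' \<eta>' X) (fob (G \<circ>\<^sub>F G') (fob (F' \<circ>\<^sub>F F) X))" for X
      by (simp add: comp_arrow_def composite_unit_def A.eta_def A'.eta_def)
    show "?d Y = Arr (fob (F' \<circ>\<^sub>F F) (fob (G \<circ>\<^sub>F G') Y)) (composite_counit E F G \<epsilon> F' G' \<epsilon>' Y) Y" for Y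
      by (simp add: comp_arrow_def composite_counit_def A.eps_def A'.eps_def)
    show "arrow C (?e X)" if "X \<in> Ob C" for X using that by simp
    show "arrow E (?d Y)" if "Y \<in> Ob E" for Y using that by simp
    show "?e (trg f) \<bullet>\<^bsub>C\<^esub> f = fmap (G \<circ>\<^sub>F G') (fmap (F' \<circ>\<^sub>F F) f) \<bullet>\<^bsub>C\<^esub> ?e (src f)" if f: "arrow C f" for f
    proof -
      have "?e (trg f) \<bullet>\<^bsub>C\<^esub> f = fmap G (A'.eta (fob F (trg f))) \<bullet>\<^bsub>C\<^esub> fmap G (fmap F f) \<bullet>\<^bsub>C\<^esub> A.eta (src f)"
        using f by (simp add: A.eta_natural)
      also have "\<dots> = fmap G (A'.eta (trg (fmap F f)) \<bullet>\<^bsub>D\<^esub> fmap F f) \<bullet>\<^bsub>C\<^esub> A.eta (src f)"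
        using f by simp
      also have "A'.eta (trg (fmap F f)) \<bullet>\<^bsub>D\<^esub> fmap F f = fmap G' (fmap F' (fmap F f)) \<bullet>\<^bsub>D\<^esub> A'.eta (fob F (src f))"
        using A'.eta_natural [of "fmap F f"] f by simp
      finally show ?thesis using f by simp
    qed
    show "?d (trg f) \<bullet>\<^bsub>E\<^esub> fmap (F' \<circ>\<^sub>F F) (fmap (G \<circ>\<^sub>F G') f) = f \<bullet>\<^bsub>E\<^esub> ?d (src f)" if f: "arrow E f" for f
    proof -
      have "?d (trg f) \<bullet>\<^bsub>E\<^esub> fmap (F' \<circ>\<^sub>F F) (fmap (G \<circ>\<^sub>F G') f)
          = A'.eps (trg f) \<bullet>\<^bsub>E\<^esub> fmap F' (A.eps (trg (fmap G' f)) \<bullet>\<^bsub>D\<^esub> fmap F (fmap G (fmap G' f)))"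
        using f by simp
      also have "A.eps (trg (fmap G' f)) \<bullet>\<^bsub>D\<^esub> fmap F (fmap G (fmap G' f)) = fmap G' f \<bullet>\<^bsub>D\<^esub> A.eps (fob G' (src f))"
        using A.eps_natural [of "fmap G' f"] f by simp
      also have "A'.eps (trg f) \<bullet>\<^bsub>E\<^esub> fmap F' (fmap G' f \<bullet>\<^bsub>D\<^esub> A.eps (fob G' (src f)))
          = (A'.eps (trg f) \<bullet>\<^bsub>E\<^esub> fmap F' (fmap G' f)) \<bullet>\<^bsub>E\<^esub> fmap F' (A.eps (fob G' (src f)))"
        using f by simp
      also have "\<dots> = f \<bullet>\<^bsub>E\<^esub> ?d (src f)"
        using f by (simp add: A'.eps_natural)
      finally show ?thesis .
    qed
    show "?d (fob (F' \<circ>\<^sub>F F) X) \<bullet>\<^bsub>E\<^esub> fmap (F' \<circ>\<^sub>F F) (?e X) = id_arrow E (fob (F' \<circ>\<^sub>F F) X)"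
      if X: "X \<in> Ob C" for X
    proof -
      let ?Y = "fob F X"
      have "?d (fob (F' \<circ>\<^sub>F F) X) \<bullet>\<^bsub>E\<^esub> fmap (F' \<circ>\<^sub>F F) (?e X)
        = A'.eps (fob F' ?Y) \<bullet>\<^bsub>E\<^esub> fmap F' (A.eps (trg (A'.eta ?Y)) \<bullet>\<^bsub>D\<^esub> fmap F (fmap G (A'.eta ?Y))) \<bullet>\<^bsub>E\<^esub> fmap F' (fmap F (A.eta X))"
        using X by simp
      also have "A.eps (trg (A'.eta ?Y)) \<bullet>\<^bsub>D\<^esub> fmap F (fmap G (A'.eta ?Y)) = A'.eta ?Y \<bullet>\<^bsub>D\<^esub> A.eps ?Y"
        using A.eps_natural [of "A'.eta ?Y"] X by simp
      also have "A'.eps (fob F' ?Y) \<bullet>\<^bsub>E\<^esub> fmap F' (A'.eta ?Y \<bullet>\<^bsub>D\<^esub> A.eps ?Y) \<bullet>\<^bsub>E\<^esub> fmap F' (fmap F (A.eta X))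
        = (A'.eps (fob F' ?Y) \<bullet>\<^bsub>E\<^esub> fmap F' (A'.eta ?Y)) \<bullet>\<^bsub>E\<^esub> fmap F' (A.eps ?Y \<bullet>\<^bsub>D\<^esub> fmap F (A.eta X))"
        using X by (simp del: A.triangle1 A'.triangle1)
      finally show ?thesis using X by simp
    qed
    show "fmap (G \<circ>\<^sub>F G') (?d Y) \<bullet>\<^bsub>C\<^esub> ?e (fob (G \<circ>\<^sub>F G') Y) = id_arrow C (fob (G \<circ>\<^sub>F G') Y)"
      if Y: "Y \<in> Ob E" for Y
    proof -
      let ?X = "fob G' Y"
      have "fmap (G \<circ>\<^sub>F G') (?d Y) \<bullet>\<^bsub>C\<^esub> ?e (fob (G \<circ>\<^sub>F G') Y)
        = fmap G (fmap G' (A'.eps Y)) \<bullet>\<^bsub>C\<^esub> fmap G (fmap G' (fmap F' (A.eps ?X)) \<bullet>\<^bsub>D\<^esub> A'.eta (src (A.eps ?X))) \<bullet>\<^bsub>C\<^esub> A.eta (fob G ?X)"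
        using Y by simp
      also have "fmap G' (fmap F' (A.eps ?X)) \<bullet>\<^bsub>D\<^esub> A'.eta (src (A.eps ?X)) = A'.eta ?X \<bullet>\<^bsub>D\<^esub> A.eps ?X"
        using A'.eta_natural [of "A.eps ?X"] Y by simp
      also have "fmap G (fmap G' (A'.eps Y)) \<bullet>\<^bsub>C\<^esub> fmap G (A'.eta ?X \<bullet>\<^bsub>D\<^esub> A.eps ?X) \<bullet>\<^bsub>C\<^esub> A.eta (fob G ?X)
        = fmap G (fmap G' (A'.eps Y) \<bullet>\<^bsub>D\<^esub> A'.eta ?X) \<bullet>\<^bsub>C\<^esub> (fmap G (A.eps ?X) \<bullet>\<^bsub>C\<^esub> A.eta (fob G ?X))"
        using Y by (simp del: A.triangle2 A'.triangle2)
      finally show ?thesis using Y by simp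
    qed
  qed
qed

lemma nat_split_epi_iff:
  assumes "category C"
  shows "nat_split_epi C D F G \<alpha> \<longleftrightarrow> nat_trans C D F G \<alpha> \<and>
    (\<exists>s. (\<forall>X \<in> Ob C. arrow D (s X) \<and> src (s X) = fob G X \<and> trg (s X) = fob F X \<and>
           Arr (fob F X) (\<alpha> X) (fob G X) \<bullet>\<^bsub>D\<^esub> s X = id_arrow D (fob G X)) \<and>
         (\<forall>f. arrow C f \<longrightarrow> s (trg f) \<bullet>\<^bsub>D\<^esub> fmap G f = fmap F f \<bullet>\<^bsub>D\<^esub> s (src f)))"
    (is "?L \<longleftrightarrow> ?N \<and> (\<exists>s. ?R s)")
proof
  interpret C: category C by fact
  show "?N \<and> (\<exists>s. ?R s)" if L: ?L
  proof -
    obtain \<sigma> where "nat_trans C D F G \<alpha>" "nat_trans C D G F \<sigma>"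
      "\<And>X. X \<in> Ob C \<Longrightarrow> \<alpha> X \<cdot>\<^bsub>D\<^esub> \<sigma> X = Id D (fob G X)"
      using L by (auto simp: nat_split_epi_def)
    then show ?thesis
      by (intro conjI exI [of _ "\<lambda>X. Arr (fob G X) (\<sigma> X) (fob F X)"])
        (auto simp: nat_trans_iff comp_triple id_arrow_def)
  qed
  show ?L if R: "?N \<and> (\<exists>s. ?R s)"
  proof -
    obtain s where s: "?R s" and N: ?N using R by blast
    have eq: "Arr (fob G X) (mor (s X)) (fob F X) = s X" if "X \<in> Ob C" for X
      using s that by (metis arrow.collapse)
    have "nat_trans C D G F (\<lambda>X. mor (s X))"
      using s N by (auto simp: nat_trans_iff eq simp del: arrow_triple)
    moreover have "\<alpha> X \<cdot>\<^bsub>D\<^esub> mor (s X) = Id D (fob G X)" if "X \<in> Ob C" for X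
    proof -
      have "Arr (fob F X) (\<alpha> X) (fob G X) \<bullet>\<^bsub>D\<^esub> s X = id_arrow D (fob G X)" using s that by blast
      from arg_cong [OF this, of mor] show ?thesis by simp
    qed
    ultimately show ?thesis using N unfolding nat_split_epi_def by blast
  qed
qed

section \<open>Natural sections of the counit\<close>

context adjunction
begin

lemma counit_split_epi_iff:
  "nat_split_epi B B (F \<circ>\<^sub>F Q) id_func \<epsilon> \<longleftrightarrow>
    (\<exists>s. (\<forall>Y \<in> Ob B. arrow B (s Y) \<and> src (s Y) = Y \<and> trg (s Y) = fob F (fob Q Y) \<and>
           eps Y \<bullet>\<^bsub>B\<^esub> s Y = id_arrow B Y) \<and>
         (\<forall>f. arrow B f \<longrightarrow> s (trg f) \<bullet>\<^bsub>B\<^esub> f = fmap F (fmap Q f) \<bullet>\<^bsub>B\<^esub> s (src f)))"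
  unfolding nat_split_epi_iff [OF B.category_axioms] eps_def using counit_nat by simp

text \<open>Condition (iii). Fullness lifts the unit at \<open>Q Y\<close> to a map
  \<open>s Y : Y -> F Q Y\<close>. By the second triangle identity \<open>Q\<close> sends
  \<open>\<epsilon> . s\<close> to an identity, and faithfulness reflects this as well as the
  naturality of \<open>\<eta>\<close>.\<close>

lemma counit_split_epi_if_full_and_faithful:
  assumes "full_and_faithful B C Q"
  shows "nat_split_epi B B (F \<circ>\<^sub>F Q) id_func \<epsilon>"
proof -
  have faithful: "f = g" if "arrow B f" "arrow B g" "src f = src g" "trg f = trg g"
    "fmap Q f = fmap Q g" for f g
    using assms that B.arrow_src [of f] B.arrow_trg [of f] unfolding full_and_faithful_iff by blast
  have "\<exists>s. arrow B s \<and> src s = Y \<and> trg s = fob F (fob Q Y) \<and> fmap Q s = eta (fob Q Y)"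
    if "Y \<in> Ob B" for Y
    using assms that unfolding full_and_faithful_iff by auto
  then obtain s where s [simp]: "\<And>Y. Y \<in> Ob B \<Longrightarrow> arrow B (s Y)" "\<And>Y. Y \<in> Ob B \<Longrightarrow> src (s Y) = Y"
    "\<And>Y. Y \<in> Ob B \<Longrightarrow> trg (s Y) = fob F (fob Q Y)" "\<And>Y. Y \<in> Ob B \<Longrightarrow> fmap Q (s Y) = eta (fob Q Y)"
    by metis
  have "eps Y \<bullet>\<^bsub>B\<^esub> s Y = id_arrow B Y" if "Y \<in> Ob B" for Y
    using that by (intro faithful) simp_all
  moreover have "s (trg f) \<bullet>\<^bsub>B\<^esub> f = fmap F (fmap Q f) \<bullet>\<^bsub>B\<^esub> s (src f)" if "arrow B f" for f
    using that eta_natural [of "fmap Q f"] by (intro faithful) simp_all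
  ultimately show ?thesis
    unfolding counit_split_epi_iff by (intro exI [of _ s]) simp
qed

end

text \<open>
  \<open>H\<close> plays the role of the Eilenberg-Moore category of the monad \<open>(T, u, n)\<close> on \<open>C\<close>: an object
  \<open>P\<close> consists of the underlying object \<open>V P\<close> and the action \<open>act P\<close>, but need not be literally
  that pair.
\<close>

locale monadic_comparison = adjunction C B F Q \<eta> \<epsilon> + H: category H + T: functor_between C C T
  for C :: "('o, 'm, 'z) cat_scheme" (structure) and B :: "('p, 'n, 'y) cat_scheme"
    and F :: "('o, 'm, 'p, 'n) func" and Q :: "('p, 'n, 'o, 'm) func"
    and \<eta> :: "'o \<Rightarrow> 'm" and \<epsilon> :: "'p \<Rightarrow> 'n"
    and H :: "('h, 'm, 'x) cat_scheme" and T :: "('o, 'm, 'o, 'm) func" +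
  fixes u n :: "'o \<Rightarrow> 'm" and V :: "'h \<Rightarrow> 'o" and act :: "'h \<Rightarrow> 'm"
    and K :: "('p, 'n, 'h, 'm) func"
  assumes Comp_H: "Comp H = Comp C"
    and Id_H: "P \<in> Ob H \<Longrightarrow> Id H P = Id C (V P)"
    and Hom_H: "\<lbrakk>P \<in> Ob H; P' \<in> Ob H\<rbrakk> \<Longrightarrow> Hom H P P' =
      {f \<in> Hom C (V P) (V P'). f \<cdot> act P = act P' \<cdot> fmor T (V P) (V P') f}"
    and u_nat: "nat_trans C C id_func T u"
    and n_nat: "nat_trans C C (T \<circ>\<^sub>F T) T n"
    and n_unit: "X \<in> Ob C \<Longrightarrow> n X \<cdot> fmor T X (fob T X) (u X) = Id C (fob T X)"
    and V_Ob: "P \<in> Ob H \<Longrightarrow> V P \<in> Ob C"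
    and act_Hom: "P \<in> Ob H \<Longrightarrow> act P \<in> Hom C (fob T (V P)) (V P)"
    and act_u: "P \<in> Ob H \<Longrightarrow> act P \<cdot> u (V P) = Id C (V P)"
    and act_n: "P \<in> Ob H \<Longrightarrow>
      act P \<cdot> fmor T (fob T (V P)) (V P) (act P) = act P \<cdot> n (V P)"
    and free: "X \<in> Ob C \<Longrightarrow> \<exists>P \<in> Ob H. V P = fob T X \<and> act P = n X"
    and K_functor: "is_functor B H K"
    and V_K: "Y \<in> Ob B \<Longrightarrow> V (fob K Y) = fob Q Y"
    and K_mor: "f \<in> Hom B Y Y' \<Longrightarrow> fmor K Y Y' f = fmor Q Y Y' f"
begin

sublocale K: functor_between B H K by unfold_locales (rule K_functor)

definition "ac P = Arr (fob T (V P)) (act P) (V P)"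
definition "un X = Arr X (u X) (fob T X)"
definition "mu_T X = Arr (fob T (fob T X)) (n X) (fob T X)"
definition "underlying f = Arr (V (src f)) (mor f) (V (trg f))"

lemma structure_sel [simp]:
  "src (ac P) = fob T (V P)" "trg (ac P) = V P" "src (un X) = X" "trg (un X) = fob T X"
  "src (mu_T X) = fob T (fob T X)" "trg (mu_T X) = fob T X"
  "src (underlying f) = V (src f)" "trg (underlying f) = V (trg f)" "mor (underlying f) = mor f"
  by (simp_all add: ac_def un_def mu_T_def underlying_def)

lemma structure_arrow [simp]:
  "P \<in> Ob H \<Longrightarrow> arrow C (ac P)" "X \<in> Ob C \<Longrightarrow> arrow C (un X)" "X \<in> Ob C \<Longrightarrow> arrow C (mu_T X)"
  using act_Hom u_nat n_nat by (auto simp: ac_def un_def mu_T_def nat_trans_iff)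

declare V_Ob [simp] V_K [simp]

lemma un_natural: "arrow C f \<Longrightarrow> un (trg f) \<bullet> f = fmap T f \<bullet> un (src f)"
  using u_nat by (simp add: nat_trans_iff un_def)

lemma mu_natural: "arrow C f \<Longrightarrow> mu_T (trg f) \<bullet> fmap T (fmap T f) = fmap T f \<bullet> mu_T (src f)"
  using n_nat by (simp add: nat_trans_iff mu_T_def)

lemma mu_unit: "X \<in> Ob C \<Longrightarrow> mu_T X \<bullet> fmap T (un X) = id_arrow C (fob T X)"
  using n_unit by (simp add: mu_T_def un_def fmap_def comp_triple id_arrow_def)

lemma ac_unit: "P \<in> Ob H \<Longrightarrow> ac P \<bullet> un (V P) = id_arrow C (V P)"
  using act_u by (simp add: ac_def un_def comp_triple id_arrow_def)

lemma ac_mult: "P \<in> Ob H \<Longrightarrow> ac P \<bullet> fmap T (ac P) = ac P \<bullet> mu_T (V P)"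
  using act_n by (simp add: ac_def mu_T_def comp_triple fmap_def)

lemma arrow_H_iff: "arrow H f \<longleftrightarrow> src f \<in> Ob H \<and> trg f \<in> Ob H \<and> arrow C (underlying f) \<and>
    underlying f \<bullet> ac (src f) = ac (trg f) \<bullet> fmap T (underlying f)"
proof (cases "src f \<in> Ob H \<and> trg f \<in> Ob H")
  case True
  then show ?thesis
    using Hom_H [of "src f" "trg f"]
    by (auto simp: arrow_def [of H] underlying_def ac_def comp_triple fmap_def)
next
  case False
  then show ?thesis using H.arrow_src H.arrow_trg by blast
qed

lemma underlying_comp [simp]: "underlying (g \<bullet>\<^bsub>H\<^esub> f) = underlying g \<bullet> underlying f"
  by (simp add: underlying_def comp_arrow_def Comp_H)

lemma underlying_id [simp]: "P \<in> Ob H \<Longrightarrow> underlying (id_arrow H P) = id_arrow C (V P)"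
  by (simp add: underlying_def id_arrow_def Id_H)

lemma underlying_arrow [simp]: "arrow H f \<Longrightarrow> arrow C (underlying f)"
  using arrow_H_iff by blast

lemma underlying_action: "arrow H f \<Longrightarrow> underlying f \<bullet> ac (src f) = ac (trg f) \<bullet> fmap T (underlying f)"
  using arrow_H_iff by blast

lemma underlying_K [simp]: "arrow B f \<Longrightarrow> underlying (fmap K f) = fmap Q f"
  using K_mor B.arrow_src [of f] B.arrow_trg [of f] by (simp add: underlying_def fmap_def arrow_def)

lemma underlying_inject: "\<lbrakk>underlying f = underlying g; src f = src g; trg f = trg g\<rbrakk> \<Longrightarrow> f = g"
  by (metis arrow.expand structure_sel(9))

lemma lift_arrow:
  assumes "arrow C g" "src g = V P" "trg g = V P'" "P \<in> Ob H" "P' \<in> Ob H"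
    "g \<bullet> ac P = ac P' \<bullet> fmap T g"
  obtains f where "arrow H f" "src f = P" "trg f = P'" "underlying f = g"
proof
  show "underlying (Arr P (mor g) P') = g"
    using assms(2,3) by (intro arrow.expand) simp
  then show "arrow H (Arr P (mor g) P')"
    using assms unfolding arrow_H_iff by simp
qed simp_all

text \<open>The inverse of a linear map is linear: \<open>g . act = g . act . T f . T g = g . f .
  act . T g = act . T g\<close>.\<close>

lemma underlying_reflects_iso:
  assumes "arrow H f" "C.inverse_arrows (underlying f) g"
  shows "\<exists>g'. H.inverse_arrows f g'"
proof -
  note g [simp] = C.inverse_arrowsD [OF assms(2), simplified]
  note [simp] = H.arrow_src [OF assms(1)] H.arrow_trg [OF assms(1)]
  have Tfg: "fmap T (underlying f) \<bullet> fmap T g = id_arrow C (fob T (V (trg f)))"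
    by (simp flip: T.preserves(4))
  have "g \<bullet> ac (trg f) = g \<bullet> (ac (trg f) \<bullet> fmap T (underlying f)) \<bullet> fmap T g"
    by (simp add: Tfg)
  also have "\<dots> = (g \<bullet> underlying f) \<bullet> ac (src f) \<bullet> fmap T g"
    unfolding underlying_action [OF assms(1), symmetric] by (simp del: g(5))
  finally have "g \<bullet> ac (trg f) = ac (src f) \<bullet> fmap T g" by simp
  then obtain g' where g': "arrow H g'" "src g' = trg f" "trg g' = src f" "underlying g' = g"
    by (rule lift_arrow [rotated 5]) simp_all
  have "H.inverse_arrows f g'"
    unfolding H.inverse_arrows_def using assms(1) g'(1-3) by (auto intro!: underlying_inject simp: g'(4))
  then show ?thesis ..
qed

text \<open>This is naturality of \<open>\<rho> : T Q -> Q\<close>, whose component at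
  \<open>Y\<close> is the action \<open>ac (fob K Y)\<close>: the arrows \<open>fmap K f\<close> are
  linear, and \<open>fmap Q f\<close> is what underlies them.\<close>

lemma K_action: "arrow B f \<Longrightarrow>
    fmap Q f \<bullet> ac (fob K (src f)) = ac (fob K (trg f)) \<bullet> fmap T (fmap Q f)"
  using underlying_action [of "fmap K f"] by simp

text \<open>A linear map out of a free algebra is determined by its restriction along the unit:
  insert \<open>mu_unit\<close> and use linearity once.\<close>

lemma extend_from_free:
  assumes "P \<in> Ob H" "X \<in> Ob C" "arrow C g" "src g = fob T X" "trg g = V P"
    "g \<bullet> mu_T X = ac P \<bullet> fmap T g"
  shows "g = ac P \<bullet> fmap T (g \<bullet> un X)"
proof -
  have "g = g \<bullet> mu_T X \<bullet> fmap T (un X)"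
    using assms(1-5) by (simp add: mu_unit)
  also have "\<dots> = (g \<bullet> mu_T X) \<bullet> fmap T (un X)"
    using assms(1-5) by simp
  also have "\<dots> = ac P \<bullet> fmap T (g \<bullet> un X)"
    unfolding assms(6) using assms(1-5) by simp
  finally show ?thesis .
qed

section \<open>The Galois map and the comparison theorem\<close>

definition galois :: "'o \<Rightarrow> ('o, 'm) arrow" where
  "galois X = ac (fob K (fob F X)) \<bullet> fmap T (eta X)"

lemma galois_arrow [simp]: "X \<in> Ob C \<Longrightarrow> arrow C (galois X)"
  and galois_sel [simp]: "src (galois X) = fob T X"
    "X \<in> Ob C \<Longrightarrow> trg (galois X) = fob Q (fob F X)"
  by (simp_all add: galois_def)

lemma galois_natural:
  assumes "arrow C f"
  shows "galois (trg f) \<bullet> fmap T f = fmap Q (fmap F f) \<bullet> galois (src f)"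
proof -
  have "galois (trg f) \<bullet> fmap T f
      = ac (fob K (fob F (trg f))) \<bullet> fmap T (eta (trg f) \<bullet> f)"
    using assms by (simp add: galois_def)
  also have "\<dots> = (ac (fob K (trg (fmap F f))) \<bullet> fmap T (fmap Q (fmap F f))) \<bullet> fmap T (eta (src f))"
    unfolding eta_natural [OF assms] using assms by simp
  also have "\<dots> = fmap Q (fmap F f) \<bullet> galois (src f)"
    using assms C.reassoc [OF K_action [of "fmap F f"], of "fmap T (eta (src f))"]
    by (simp add: galois_def)
  finally show ?thesis .
qed

lemma galois_unit: "X \<in> Ob C \<Longrightarrow> galois X \<bullet> un X = eta X"
  using un_natural [of "eta X"] C.reassoc [OF ac_unit, of "fob K (fob F X)" "eta X"]
  by (simp add: galois_def flip: un_natural)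

text \<open>Naturality of \<open>mu_T\<close> and associativity of the action on
  \<open>K (F X)\<close> combine. The result is linearity for the free action \<open>mu_T X\<close>,
  which lets the Galois map be lifted to an arrow of \<open>H\<close>.\<close>

lemma galois_mult:
  assumes "X \<in> Ob C"
  shows "galois X \<bullet> mu_T X = ac (fob K (fob F X)) \<bullet> fmap T (galois X)"
proof -
  let ?P = "fob K (fob F X)"
  have "galois X \<bullet> mu_T X = ac ?P \<bullet> mu_T (trg (eta X)) \<bullet> fmap T (fmap T (eta X))"
    using assms mu_natural [of "eta X"] by (simp add: galois_def)
  also have "\<dots> = (ac ?P \<bullet> fmap T (ac ?P)) \<bullet> fmap T (fmap T (eta X))"
    using assms by (simp add: ac_mult)
  also have "\<dots> = ac ?P \<bullet> fmap T (galois X)"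
    using assms by (simp add: galois_def)
  finally show ?thesis .
qed

text \<open>Naturality of \<open>\<rho>\<close> at the counit and a triangle identity. The effect is
  that, once the Galois maps are invertible, the \<open>T\<close>-action on \<open>K Y\<close> and
  the \<open>Q F\<close>-action \<open>Q \<epsilon>\<close> on \<open>Q Y\<close> determine each
  other.\<close>

lemma K_eps: "Y \<in> Ob B \<Longrightarrow> fmap Q (eps Y) \<bullet> galois (fob Q Y) = ac (fob K Y)"
proof -
  assume Y: "Y \<in> Ob B"
  have "fmap Q (eps Y) \<bullet> galois (fob Q Y)
      = (fmap Q (eps Y) \<bullet> ac (fob K (src (eps Y)))) \<bullet> fmap T (eta (fob Q Y))"
    using Y by (simp add: galois_def)
  also have "\<dots> = ac (fob K Y) \<bullet> fmap T (fmap Q (eps Y) \<bullet> eta (fob Q Y))"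
    unfolding K_action [OF eps_arrow [OF Y]] using Y by (simp del: triangle2)
  finally show ?thesis using Y by simp
qed

lemma galois_nat_trans: "nat_trans C C T (Q \<circ>\<^sub>F F) (\<lambda>X. mor (galois X))"
proof -
  have "Arr (fob T X) (mor (galois X)) (fob Q (fob F X)) = galois X" if "X \<in> Ob C" for X
    using that by (intro arrow.expand) simp
  then show ?thesis
    unfolding nat_trans_iff using T.is_functor functor_compose [OF left_functor right_functor]
    by (auto simp: galois_natural simp del: arrow_triple)
qed

theorem galois_iso_if_equivalence:
  assumes "equivalence B H K" and X: "X \<in> Ob C"
  shows "\<exists>g. C.inverse_arrows (galois X) g"
proof -
  have full: "\<exists>f. arrow B f \<and> src f = Y \<and> trg f = Y' \<and> fmap K f = h"
    if "Y \<in> Ob B" "Y' \<in> Ob B" "arrow H h" "src h = fob K Y" "trg h = fob K Y'" for Y Y' h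
    using equivalence_imp(1) [OF B.category_axioms H.category_axioms assms(1)] that
    unfolding full_and_faithful_iff by blast
  obtain P where P [simp]: "P \<in> Ob H" "V P = fob T X" and act_P: "act P = n X"
    using free [OF X] by blast
  then have ac_P [simp]: "ac P = mu_T X" by (simp add: ac_def mu_T_def)
  obtain t where t: "arrow H t" "src t = P" "trg t = fob K (fob F X)" "underlying t = galois X"
    by (rule lift_arrow [of "galois X" P "fob K (fob F X)"]) (use X in \<open>simp_all add: galois_mult\<close>)
  obtain Y w w' where Y: "Y \<in> Ob B" and w: "H.inverse_arrows w w'" "src w = fob K Y" "trg w = P"
    using equivalence_imp(2) [OF B.category_axioms H.category_axioms assms(1)] P(1)
    unfolding essentially_surjective_def by (metis H.is_isoE arrow.sel(1,3))
  note w' [simp] = H.inverse_arrowsD [OF w(1), unfolded w(2,3)]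
  \<comment> \<open>The adjoint transpose of the restriction of \<open>w'\<close> along the unit. As
    the Galois map restricts to \<open>\<eta>\<close>, this is what has to be taken if
    \<open>fmap K k\<close> after \<open>t\<close> is to be \<open>w'\<close>.\<close>
  define k where "k = eps Y \<bullet>\<^bsub>B\<^esub> fmap F (underlying w' \<bullet> un X)"
  have k [simp]: "arrow B k" "src k = fob F X" "trg k = Y"
    using X Y w by (simp_all add: k_def)
  have "fmap Q k \<bullet> eta X = underlying w' \<bullet> un X"
  proof -
    let ?f = "underlying w' \<bullet> un X"
    have "fmap Q k \<bullet> eta X = fmap Q (eps Y) \<bullet> (fmap Q (fmap F ?f) \<bullet> eta (src ?f))"
      using X Y w by (simp add: k_def)
    also have "\<dots> = (fmap Q (eps Y) \<bullet> eta (fob Q Y)) \<bullet> ?f"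
      using X Y w eta_natural [of ?f] by (simp del: triangle2)
    finally show ?thesis using X Y w by simp
  qed
  then have k_un: "underlying (fmap K k \<bullet>\<^bsub>H\<^esub> t) \<bullet> un X = underlying w' \<bullet> un X"
    using X t by (simp add: galois_unit)
  \<comment> \<open>Both sides are linear maps out of the free object \<open>P\<close>, and they
    agree along the unit by \<open>k_un\<close>.\<close>
  have kt: "fmap K k \<bullet>\<^bsub>H\<^esub> t = w'"
  proof (rule underlying_inject)
    have "g = h" if "arrow H g" "arrow H h" "src g = P" "src h = P" "trg g = trg h"
      "underlying g \<bullet> un X = underlying h \<bullet> un X" for g h
    proof (rule underlying_inject)
      show "underlying g = underlying h"
        using extend_from_free [of "trg g" X "underlying g"] extend_from_free [of "trg h" X "underlying h"]
          underlying_action [of g] underlying_action [of h] that X by (metis H.arrow_trg P(2) ac_P structure_sel(7,8) underlying_arrow)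
    qed (use that in auto)
    then show "underlying (fmap K k \<bullet>\<^bsub>H\<^esub> t) = underlying w'"
      using k_un t w X Y by (metis H.arrow_comp K.preserves(2) comp_arrow_sel(1,2) fmap_sel(1,2) k w'(2,3,4))
  qed (use t in auto)
  define s where "s = w \<bullet>\<^bsub>H\<^esub> fmap K k"
  have s: "arrow H s" "src s = fob K (fob F X)" "trg s = P" "s \<bullet>\<^bsub>H\<^esub> t = id_arrow H P"
    using t w X by (simp_all add: s_def kt)
  have "underlying s \<bullet> galois X = id_arrow C (fob T X)"
    using arg_cong [OF s(4), of underlying] t(4) by simp
  moreover have "galois X \<bullet> underlying s = id_arrow C (fob Q (fob F X))"
  proof -
    \<comment> \<open>The endomorphism \<open>t . s\<close> of \<open>K (F X)\<close> is
      \<open>K a\<close> by fullness. Because \<open>s . t\<close> is an identity, \<open>a\<close>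
      has the same transpose as the identity of \<open>F X\<close>, hence equals it.\<close>
    obtain a where a: "arrow B a" "src a = fob F X" "trg a = fob F X" "fmap K a = t \<bullet>\<^bsub>H\<^esub> s"
      using full [of "fob F X" "fob F X" "t \<bullet>\<^bsub>H\<^esub> s"] t s X by auto
    have Qa: "fmap Q a = galois X \<bullet> underlying s"
      using arg_cong [OF a(4), of underlying] a(1) t(4) by simp
    have "fmap Q a \<bullet> eta X = galois X \<bullet> (underlying s \<bullet> galois X) \<bullet> un X"
      unfolding Qa using s X by (simp flip: galois_unit)
    also have "\<dots> = fmap Q (id_arrow B (fob F X)) \<bullet> eta X"
      unfolding calculation(1) using X \<open>underlying s \<bullet> galois X = _\<close> by (simp add: galois_unit)
    finally have "a = id_arrow B (fob F X)"
      by (rule transpose_inject [rotated -1]) (use a X in auto)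
    then show ?thesis using Qa X by simp
  qed
  ultimately have "C.inverse_arrows (galois X) (underlying s)"
    unfolding C.inverse_arrows_def using X s by simp
  then show ?thesis ..
qed

theorem equivalence_if_galois_iso:
  assumes galois: "\<And>X. X \<in> Ob C \<Longrightarrow> \<exists>g. C.inverse_arrows (galois X) g"
    and split: "nat_split_epi B B (F \<circ>\<^sub>F Q) id_func \<epsilon>"
    and cauchy: "cauchy_complete B"
  shows "equivalence B H K"
proof -
  obtain s where s [simp]: "\<And>Y. Y \<in> Ob B \<Longrightarrow> arrow B (s Y)" "\<And>Y. Y \<in> Ob B \<Longrightarrow> src (s Y) = Y"
    "\<And>Y. Y \<in> Ob B \<Longrightarrow> trg (s Y) = fob F (fob Q Y)" "\<And>Y. Y \<in> Ob B \<Longrightarrow> eps Y \<bullet>\<^bsub>B\<^esub> s Y = id_arrow B Y"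
    and s_nat: "\<And>f. arrow B f \<Longrightarrow> s (trg f) \<bullet>\<^bsub>B\<^esub> f = fmap F (fmap Q f) \<bullet>\<^bsub>B\<^esub> s (src f)"
    using split unfolding counit_split_epi_iff by blast
  have Qs [simp]: "fmap Q (eps Y) \<bullet> fmap Q (s Y) = id_arrow C (fob Q Y)" if "Y \<in> Ob B" for Y
    using that by (simp flip: Q.preserves(4))
  have full_faithful: "full_and_faithful B H K"
    unfolding full_and_faithful_iff
  proof (intro conjI allI ballI impI)
    show "is_functor B H K" by (rule K_functor)
  next
    fix f g
    assume fg: "arrow B f \<and> arrow B g \<and> src f = src g \<and> trg f = trg g \<and> fmap K f = fmap K g
      \<and> src f \<in> Ob B \<and> trg f \<in> Ob B"
    \<comment> \<open>The section recovers \<open>h\<close> from \<open>Q h\<close>: naturality of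
      \<open>\<epsilon>\<close> moves \<open>h\<close> past the counit, which then cancels against
      \<open>s\<close>.\<close>
    have "h = eps (trg h) \<bullet>\<^bsub>B\<^esub> fmap F (fmap Q h) \<bullet>\<^bsub>B\<^esub> s (src h)" if "arrow B h" for h
      using B.reassoc [OF eps_natural [OF that], of "s (src h)"] that by simp
    moreover have "fmap Q f = fmap Q g" using fg underlying_K by metis
    ultimately show "f = g" using fg by metis
  next
    fix Y Y' h
    assume Y: "Y \<in> Ob B" "Y' \<in> Ob B" and h: "arrow H h \<and> src h = fob K Y \<and> trg h = fob K Y'"
    let ?h = "underlying h"
    have h' [simp]: "arrow C ?h" "V (src h) = fob Q Y" "V (trg h) = fob Q Y'" using h Y by simp_all
    obtain g where g: "C.inverse_arrows (galois (fob Q Y)) g" using galois Q.preserves(1) [OF Y(1)] by blast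
    \<comment> \<open>\<open>K_eps\<close> rewrites both actions through the Galois map, and
      naturality of the latter gives an equation in which \<open>galois (fob Q Y)\<close> can be
      cancelled. So a \<open>T\<close>-linear map between values of \<open>K\<close> commutes with
      \<open>Q \<epsilon>\<close>.\<close>
    have "(?h \<bullet> fmap Q (eps Y)) \<bullet> galois (fob Q Y)
        = (fmap Q (eps Y') \<bullet> fmap Q (fmap F ?h)) \<bullet> galois (fob Q Y)"
    proof -
      have "(?h \<bullet> fmap Q (eps Y)) \<bullet> galois (fob Q Y) = ?h \<bullet> ac (fob K Y)"
        using Y by (simp add: K_eps)
      also have "\<dots> = ac (fob K Y') \<bullet> fmap T ?h"
        using h underlying_action [of h] by simp
      also have "\<dots> = fmap Q (eps Y') \<bullet> (galois (trg ?h) \<bullet> fmap T ?h)"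
        using Y by (simp flip: K_eps)
      also have "galois (trg ?h) \<bullet> fmap T ?h = fmap Q (fmap F ?h) \<bullet> galois (src ?h)"
        by (rule galois_natural) simp
      finally show ?thesis using Y by simp
    qed
    then have lin: "?h \<bullet> fmap Q (eps Y) = fmap Q (eps Y') \<bullet> fmap Q (fmap F ?h)"
      by (rule C.iso_right_cancel [OF g]) (use Y in simp_all)
    \<comment> \<open>The formula of the faithfulness part with \<open>?h\<close> in place of
      \<open>Q h\<close>. Its image under \<open>Q\<close> is \<open>?h\<close> because
      \<open>lin\<close> turns it into \<open>?h . Q (\<epsilon> . s)\<close>.\<close>
    let ?f = "eps Y' \<bullet>\<^bsub>B\<^esub> fmap F ?h \<bullet>\<^bsub>B\<^esub> s Y"
    have "fmap Q ?f = (fmap Q (eps Y') \<bullet> fmap Q (fmap F ?h)) \<bullet> fmap Q (s Y)"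
      using Y by simp
    also have "\<dots> = ?h"
      unfolding lin [symmetric] using Y by simp
    finally have "fmap K ?f = h"
      using Y h by (intro underlying_inject) simp_all
    then show "\<exists>f. arrow B f \<and> src f = Y \<and> trg f = Y' \<and> fmap K f = h"
      using Y by (intro exI [of _ ?f]) simp
  qed
  moreover have "essentially_surjective B H K"
    unfolding essentially_surjective_def
  proof
    fix P assume P [simp]: "P \<in> Ob H"
    let ?X = "V P" and ?M = "fob F (V P)"
    let ?Z = "fob Q ?M"
    obtain t' where t': "C.inverse_arrows (galois ?X) t'" using galois P by (metis V_Ob)
    obtain z where z: "C.inverse_arrows (galois ?Z) z" using galois [of ?Z] P by auto
    note t'D [simp] = C.inverse_arrowsD [OF t', simplified]
    define a where "a = ac P \<bullet> t'"
    have a [simp]: "arrow C a" "src a = ?Z" "trg a = ?X" by (simp_all add: a_def)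
    have a_galois: "a \<bullet> galois ?X = ac P" by (simp add: a_def)
    have a_eta: "a \<bullet> eta ?X = id_arrow C ?X"
      using ac_unit [OF P] by (simp flip: galois_unit add: C.reassoc [OF a_galois])
    \<comment> \<open>Associativity of the action \<open>a\<close>. The comparison of
      \<open>T T X\<close> with \<open>Q F Q F X\<close> composes the Galois maps at
      \<open>X\<close> and at \<open>Q F X\<close>, so invertibility is used at both objects. After
      precomposing with it, the claim follows from associativity of \<open>ac P\<close>,
      \<open>galois_mult\<close> and \<open>K_eps\<close>.\<close>
    have a_assoc: "a \<bullet> fmap Q (fmap F a) = a \<bullet> fmap Q (eps ?M)"
    proof (rule C.iso_right_cancel)
      show "C.inverse_arrows (galois ?Z \<bullet> fmap T (galois ?X)) (fmap T t' \<bullet> z)"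
        using z t' by (intro C.inverse_arrows_comp T.preserves_inverse) simp_all
      have "(a \<bullet> fmap Q (fmap F a)) \<bullet> galois ?Z \<bullet> fmap T (galois ?X)
        = a \<bullet> (fmap Q (fmap F a) \<bullet> galois (src a)) \<bullet> fmap T (galois ?X)" by simp
      also have "fmap Q (fmap F a) \<bullet> galois (src a) = galois (trg a) \<bullet> fmap T a"
        by (rule galois_natural [symmetric]) simp
      also have "a \<bullet> (galois (trg a) \<bullet> fmap T a) \<bullet> fmap T (galois ?X)
         = (a \<bullet> galois ?X) \<bullet> fmap T (a \<bullet> galois ?X)" by simp
      also have "\<dots> = (a \<bullet> galois ?X) \<bullet> mu_T ?X"
        unfolding a_galois by (simp add: ac_mult)
      also have "\<dots> = a \<bullet> ac (fob K ?M) \<bullet> fmap T (galois ?X)"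
        by (simp add: galois_mult)
      also have "\<dots> = (a \<bullet> fmap Q (eps ?M)) \<bullet> galois ?Z \<bullet> fmap T (galois ?X)"
        by (simp flip: K_eps)
      finally show "(a \<bullet> fmap Q (fmap F a)) \<bullet> galois ?Z \<bullet> fmap T (galois ?X)
        = (a \<bullet> fmap Q (eps ?M)) \<bullet> galois ?Z \<bullet> fmap T (galois ?X)" .
    qed simp_all
    \<comment> \<open>\<open>fmap F a\<close> and \<open>eps ?M\<close> form a contractible pair
      with contraction \<open>s ?M\<close>. Its coequalizer is the splitting of \<open>p\<close>,
      the candidate for an object that \<open>K\<close> sends to \<open>P\<close> up to
      isomorphism.\<close>
    define p where "p = fmap F a \<bullet>\<^bsub>B\<^esub> s ?M"
    have p: "arrow B p" "src p = ?M" "trg p = ?M" by (simp_all add: p_def)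
    have Fa_assoc: "fmap F a \<bullet>\<^bsub>B\<^esub> fmap F (fmap Q (fmap F a)) = fmap F a \<bullet>\<^bsub>B\<^esub> fmap F (fmap Q (eps ?M))"
      using arg_cong [OF a_assoc, of "fmap F"] by simp
    \<comment> \<open>Naturality of \<open>s\<close> at \<open>fmap F a\<close>, then associativity
      of \<open>a\<close>, then naturality of \<open>s\<close> at \<open>eps ?M\<close> read
      backwards.\<close>
    have p_Fa: "p \<bullet>\<^bsub>B\<^esub> fmap F a = p \<bullet>\<^bsub>B\<^esub> eps ?M"
    proof -
      have "p \<bullet>\<^bsub>B\<^esub> fmap F a = fmap F a \<bullet>\<^bsub>B\<^esub> (s (trg (fmap F a)) \<bullet>\<^bsub>B\<^esub> fmap F a)"
        by (simp add: p_def)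
      also have "\<dots> = (fmap F a \<bullet>\<^bsub>B\<^esub> fmap F (fmap Q (fmap F a))) \<bullet>\<^bsub>B\<^esub> s (fob F ?Z)"
        by (subst s_nat) simp_all
      also have "\<dots> = fmap F a \<bullet>\<^bsub>B\<^esub> (fmap F (fmap Q (eps ?M)) \<bullet>\<^bsub>B\<^esub> s (src (eps ?M)))"
        unfolding Fa_assoc by simp
      also have "\<dots> = p \<bullet>\<^bsub>B\<^esub> eps ?M"
        by (subst s_nat [symmetric]) (simp_all add: p_def)
      finally show ?thesis .
    qed
    have "p \<bullet>\<^bsub>B\<^esub> p = (p \<bullet>\<^bsub>B\<^esub> fmap F a) \<bullet>\<^bsub>B\<^esub> s ?M"
      using p by (subst (2) p_def) simp
    also have "\<dots> = p" unfolding p_Fa using p by simp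
    finally obtain r i where ri [simp]: "arrow B r" "arrow B i" "src r = ?M" "src i = trg r" "trg i = ?M"
      and r_i: "r \<bullet>\<^bsub>B\<^esub> i = id_arrow B (trg r)" and i_r: "i \<bullet>\<^bsub>B\<^esub> r = p"
      using B.cauchy_completeE [OF cauchy p(1)] p by metis
    define Y where "Y = trg r"
    have Y [simp]: "Y \<in> Ob B" "trg r = Y" by (simp_all add: Y_def)
    have r_p: "r \<bullet>\<^bsub>B\<^esub> p = r"
      unfolding i_r [symmetric] by (simp add: B.reassoc [OF r_i])
    \<comment> \<open>So \<open>r\<close> coequalizes the pair, as the quotient map in Beck's
      theorem does.\<close>
    have r_Fa: "r \<bullet>\<^bsub>B\<^esub> fmap F a = r \<bullet>\<^bsub>B\<^esub> eps ?M"
    proof -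
      have "r \<bullet>\<^bsub>B\<^esub> fmap F a = r \<bullet>\<^bsub>B\<^esub> (p \<bullet>\<^bsub>B\<^esub> fmap F a)"
        using p by (simp add: B.reassoc [OF r_p])
      also have "\<dots> = r \<bullet>\<^bsub>B\<^esub> eps ?M"
        unfolding p_Fa using p by (simp add: B.reassoc [OF r_p])
      finally show ?thesis .
    qed
    \<comment> \<open>\<open>?g\<close> is the transpose of the quotient map \<open>r\<close>. One
      composite is \<open>a . Q p . \<eta>\<close>, which \<open>a_assoc\<close> reduces to
      \<open>a . \<eta>\<close>; the other is \<open>Q (r . F a . F Q i) . \<eta>\<close>, where
      \<open>r_Fa\<close> and naturality of \<open>\<epsilon>\<close> leave a triangle
      identity.\<close>
    let ?f = "a \<bullet> fmap Q i" and ?g = "fmap Q r \<bullet> eta ?X"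
    have "?f \<bullet> ?g = a \<bullet> fmap Q (i \<bullet>\<^bsub>B\<^esub> r) \<bullet> eta ?X" by simp
    also have "\<dots> = (a \<bullet> fmap Q (fmap F a)) \<bullet> fmap Q (s ?M) \<bullet> eta ?X"
      unfolding i_r by (simp add: p_def)
    also have "\<dots> = a \<bullet> (fmap Q (eps ?M) \<bullet> fmap Q (s ?M)) \<bullet> eta ?X"
      unfolding a_assoc by (simp del: Qs)
    finally have fg: "?f \<bullet> ?g = id_arrow C ?X" by (simp add: a_eta)
    have "?g \<bullet> ?f = fmap Q r \<bullet> (eta (trg ?f) \<bullet> ?f)" by simp
    also have "\<dots> = fmap Q ((r \<bullet>\<^bsub>B\<^esub> fmap F a) \<bullet>\<^bsub>B\<^esub> fmap F (fmap Q i)) \<bullet> eta (fob Q Y)"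
      by (subst eta_natural) simp_all
    also have "(r \<bullet>\<^bsub>B\<^esub> fmap F a) \<bullet>\<^bsub>B\<^esub> fmap F (fmap Q i) = r \<bullet>\<^bsub>B\<^esub> (eps (trg i) \<bullet>\<^bsub>B\<^esub> fmap F (fmap Q i))"
      unfolding r_Fa by simp
    also have "\<dots> = eps Y"
      by (subst eps_natural) (simp_all add: B.reassoc [OF r_i])
    finally have gf: "?g \<bullet> ?f = id_arrow C (fob Q Y)" by simp
    have inv: "C.inverse_arrows ?f ?g" unfolding C.inverse_arrows_def using fg gf by simp
    \<comment> \<open>Linearity of \<open>?f\<close>: \<open>K_eps\<close> replaces the action by
      \<open>Q \<epsilon>\<close>, \<open>a_assoc\<close> trades \<open>Q \<epsilon>\<close> for
      \<open>Q F a\<close>, and naturality of the Galois map leads back to the action of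
      \<open>P\<close>.\<close>
    have "?f \<bullet> ac (fob K Y) = a \<bullet> fmap Q (i \<bullet>\<^bsub>B\<^esub> eps (src i)) \<bullet> galois (fob Q Y)"
      by (simp flip: K_eps)
    also have "\<dots> = (a \<bullet> fmap Q (eps ?M)) \<bullet> fmap Q (fmap F (fmap Q i)) \<bullet> galois (fob Q Y)"
      by (subst eps_natural [symmetric]) simp_all
    also have "\<dots> = a \<bullet> (fmap Q (fmap F ?f) \<bullet> galois (src ?f))"
      unfolding a_assoc [symmetric] by simp
    also have "\<dots> = (a \<bullet> galois ?X) \<bullet> fmap T ?f"
      by (subst galois_natural [symmetric]) simp_all
    finally have "?f \<bullet> ac (fob K Y) = ac P \<bullet> fmap T ?f"
      unfolding a_galois .
    then obtain f where f: "arrow H f" "src f = fob K Y" "trg f = P" "underlying f = ?f"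
      by (rule lift_arrow [rotated 5]) simp_all
    obtain g where "H.inverse_arrows f g" using underlying_reflects_iso [OF f(1), of ?g] inv f(4) by auto
    then have "is_iso H (fob K Y) P (mor f)"
      using f by (intro H.is_isoI [of _ _ _ g]) (metis arrow.collapse)
    then show "\<exists>Y\<in>Ob B. \<exists>f. is_iso H (fob K Y) P f" using Y(1) by blast
  qed
  ultimately show ?thesis
    by (intro equivalenceI B.category_axioms H.category_axioms)
qed

end

section \<open>Mixed distributive laws\<close>

locale monad = functor_between C C S
  for C :: "('o, 'm, 'z) cat_scheme" (structure) and S :: "('o, 'm, 'o, 'm) func" +
  fixes u n :: "'o \<Rightarrow> ('o, 'm) arrow"
  assumes u_arrow [simp]: "X \<in> Ob C \<Longrightarrow> arrow C (u X)" "src (u X) = X" "trg (u X) = fob S X"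
    and n_arrow [simp]: "X \<in> Ob C \<Longrightarrow> arrow C (n X)" "src (n X) = fob S (fob S X)" "trg (n X) = fob S X"
    and u_nat: "arrow C f \<Longrightarrow> u (trg f) \<bullet> f = fmap S f \<bullet> u (src f)"
    and n_nat: "arrow C f \<Longrightarrow> n (trg f) \<bullet> fmap S (fmap S f) = fmap S f \<bullet> n (src f)"
    and n_unit: "X \<in> Ob C \<Longrightarrow> n X \<bullet> u (fob S X) = id_arrow C (fob S X)"
      "X \<in> Ob C \<Longrightarrow> n X \<bullet> fmap S (u X) = id_arrow C (fob S X)"
    and n_assoc: "X \<in> Ob C \<Longrightarrow> n X \<bullet> fmap S (n X) = n X \<bullet> n (fob S X)"
begin

text \<open>An algebra is encoded by its action alone, the carrier being the target of that arrow.
  Coalgebras below are encoded by their coaction, with the source as carrier.\<close>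

definition algebra :: "('o, 'm) arrow \<Rightarrow> bool" where
  "algebra h \<longleftrightarrow> arrow C h \<and> src h = fob S (trg h) \<and>
     h \<bullet> fmap S h = h \<bullet> n (trg h) \<and> h \<bullet> u (trg h) = id_arrow C (trg h)"

lemma free_algebra: "X \<in> Ob C \<Longrightarrow> algebra (n X)"
  by (simp add: algebra_def n_unit n_assoc)

lemma algebraD:
  assumes "algebra h"
  shows "arrow C h" "src h = fob S (trg h)" "h \<bullet> fmap S h = h \<bullet> n (trg h)"
    "h \<bullet> u (trg h) = id_arrow C (trg h)"
  using assms by (simp_all add: algebra_def)

end

locale comonad = functor_between C C G
  for C :: "('o, 'm, 'z) cat_scheme" (structure) and G :: "('o, 'm, 'o, 'm) func" +
  fixes c d :: "'o \<Rightarrow> ('o, 'm) arrow"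
  assumes c_arrow [simp]: "X \<in> Ob C \<Longrightarrow> arrow C (c X)" "src (c X) = fob G X" "trg (c X) = X"
    and d_arrow [simp]: "X \<in> Ob C \<Longrightarrow> arrow C (d X)" "src (d X) = fob G X" "trg (d X) = fob G (fob G X)"
    and c_nat: "arrow C f \<Longrightarrow> c (trg f) \<bullet> fmap G f = f \<bullet> c (src f)"
    and d_nat: "arrow C f \<Longrightarrow> d (trg f) \<bullet> fmap G f = fmap G (fmap G f) \<bullet> d (src f)"
    and d_counit: "X \<in> Ob C \<Longrightarrow> c (fob G X) \<bullet> d X = id_arrow C (fob G X)"
      "X \<in> Ob C \<Longrightarrow> fmap G (c X) \<bullet> d X = id_arrow C (fob G X)"
    and d_coassoc: "X \<in> Ob C \<Longrightarrow> fmap G (d X) \<bullet> d X = d (fob G X) \<bullet> d X"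
begin

definition coalgebra :: "('o, 'm) arrow \<Rightarrow> bool" where
  "coalgebra \<theta> \<longleftrightarrow> arrow C \<theta> \<and> trg \<theta> = fob G (src \<theta>) \<and>
     fmap G \<theta> \<bullet> \<theta> = d (src \<theta>) \<bullet> \<theta> \<and> c (src \<theta>) \<bullet> \<theta> = id_arrow C (src \<theta>)"

lemma cofree_coalgebra: "X \<in> Ob C \<Longrightarrow> coalgebra (d X)"
  by (simp add: coalgebra_def d_counit d_coassoc)

lemma coalgebraD:
  assumes "coalgebra \<theta>"
  shows "arrow C \<theta>" "trg \<theta> = fob G (src \<theta>)" "fmap G \<theta> \<bullet> \<theta> = d (src \<theta>) \<bullet> \<theta>"
    "c (src \<theta>) \<bullet> \<theta> = id_arrow C (src \<theta>)"
  using assms by (simp_all add: coalgebra_def)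

end

locale mixed_distributive_law = S: monad C S u n + G: comonad C G c d
  for C :: "('o, 'm, 'z) cat_scheme" (structure) and S u n G c d +
  fixes l :: "'o \<Rightarrow> ('o, 'm) arrow"
  assumes l_arrow [simp]: "X \<in> Ob C \<Longrightarrow> arrow C (l X)" "src (l X) = fob S (fob G X)" "trg (l X) = fob G (fob S X)"
    and l_nat: "arrow C f \<Longrightarrow> l (trg f) \<bullet> fmap S (fmap G f) = fmap G (fmap S f) \<bullet> l (src f)"
    and l_u: "X \<in> Ob C \<Longrightarrow> l X \<bullet> u (fob G X) = fmap G (u X)"
    and l_n: "X \<in> Ob C \<Longrightarrow> l X \<bullet> n (fob G X) = fmap G (n X) \<bullet> l (fob S X) \<bullet> fmap S (l X)"
    and l_c: "X \<in> Ob C \<Longrightarrow> c (fob S X) \<bullet> l X = fmap S (c X)"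
    and l_d: "X \<in> Ob C \<Longrightarrow> d (fob S X) \<bullet> l X = fmap G (l X) \<bullet> l (fob G X) \<bullet> fmap S (d X)"
begin

text \<open>The law lifts \<open>S\<close> to coalgebras and \<open>G\<close> to algebras. This is
  the coaction which the first lifting puts on \<open>S X\<close>; \<open>cofree_action\<close> is
  the action which the second puts on \<open>G X\<close>.\<close>

definition lift_coaction :: "('o, 'm) arrow \<Rightarrow> ('o, 'm) arrow" where
  "lift_coaction \<theta> = l (src \<theta>) \<bullet> fmap S \<theta>"

definition cofree_action :: "('o, 'm) arrow \<Rightarrow> ('o, 'm) arrow" where
  "cofree_action h = fmap G h \<bullet> l (trg h)"

text \<open>Naturality of \<open>l\<close> brings \<open>G \<theta> . \<theta>\<close> under
  \<open>S\<close>, where coassociativity of \<open>\<theta>\<close> applies; \<open>l_d\<close>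
  then moves the comultiplication across the law. The counit law follows from \<open>l_c\<close> in
  the same way.\<close>

lemma lift_coalgebra:
  assumes "G.coalgebra \<theta>"
  shows "G.coalgebra (lift_coaction \<theta>)"
proof -
  let ?X = "src \<theta>"
  note \<theta> = G.coalgebraD [OF assms]
  note [simp] = \<theta>(1,2) S.C.arrow_src [OF \<theta>(1)]
  have "fmap G (lift_coaction \<theta>) \<bullet> lift_coaction \<theta>
      = fmap G (l ?X) \<bullet> (fmap G (fmap S \<theta>) \<bullet> l (src \<theta>)) \<bullet> fmap S \<theta>"
    by (simp add: lift_coaction_def)
  also have "\<dots> = fmap G (l ?X) \<bullet> l (fob G ?X) \<bullet> fmap S (fmap G \<theta> \<bullet> \<theta>)"
    by (simp flip: l_nat)
  also have "\<dots> = (d (fob S ?X) \<bullet> l ?X) \<bullet> fmap S \<theta>"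
    unfolding \<theta>(3) by (simp add: l_d)
  finally have "fmap G (lift_coaction \<theta>) \<bullet> lift_coaction \<theta> = d (fob S ?X) \<bullet> lift_coaction \<theta>"
    by (simp add: lift_coaction_def)
  moreover have "(c (fob S ?X) \<bullet> l ?X) \<bullet> fmap S \<theta> = fmap S (c ?X \<bullet> \<theta>)"
    by (simp add: l_c)
  then have "c (fob S ?X) \<bullet> lift_coaction \<theta> = id_arrow C (fob S ?X)"
    by (simp add: \<theta>(4) lift_coaction_def)
  ultimately show ?thesis by (simp add: G.coalgebra_def lift_coaction_def)
qed

text \<open>Here \<open>l_u\<close>, and \<open>l_n\<close> in \<open>n_coalgebra_morphism\<close>,
  make the unit and multiplication of \<open>S\<close> maps of coalgebras, so that they serve as
  unit and multiplication of the lifted monad.\<close>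

lemma u_coalgebra_morphism:
  assumes "G.coalgebra \<theta>"
  shows "fmap G (u (src \<theta>)) \<bullet> \<theta> = lift_coaction \<theta> \<bullet> u (src \<theta>)"
proof -
  note \<theta> = G.coalgebraD [OF assms]
  note [simp] = \<theta>(1,2) S.C.arrow_src [OF \<theta>(1)]
  have "lift_coaction \<theta> \<bullet> u (src \<theta>) = (l (src \<theta>) \<bullet> u (trg \<theta>)) \<bullet> \<theta>"
    using S.u_nat [OF \<theta>(1)] by (simp add: lift_coaction_def)
  then show ?thesis by (simp add: l_u)
qed

lemma n_coalgebra_morphism:
  assumes "G.coalgebra \<theta>"
  shows "fmap G (n (src \<theta>)) \<bullet> lift_coaction (lift_coaction \<theta>) = lift_coaction \<theta> \<bullet> n (src \<theta>)"
proof -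
  note \<theta> = G.coalgebraD [OF assms]
  note [simp] = \<theta>(1,2) S.C.arrow_src [OF \<theta>(1)]
  have "fmap G (n (src \<theta>)) \<bullet> lift_coaction (lift_coaction \<theta>)
      = (fmap G (n (src \<theta>)) \<bullet> l (fob S (src \<theta>)) \<bullet> fmap S (l (src \<theta>))) \<bullet> fmap S (fmap S \<theta>)"
    by (simp add: lift_coaction_def)
  also have "\<dots> = l (src \<theta>) \<bullet> n (trg \<theta>) \<bullet> fmap S (fmap S \<theta>)"
    by (simp flip: l_n)
  also have "\<dots> = lift_coaction \<theta> \<bullet> n (src \<theta>)"
    by (subst S.n_nat) (simp_all add: lift_coaction_def)
  finally show ?thesis .
qed

lemma lift_coaction_natural:
  assumes "arrow C f" "arrow C \<theta>" "arrow C \<kappa>" "src \<theta> = src f" "trg \<theta> = fob G (src f)"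
    "src \<kappa> = trg f" "trg \<kappa> = fob G (trg f)" "fmap G f \<bullet> \<theta> = \<kappa> \<bullet> f"
  shows "fmap G (fmap S f) \<bullet> lift_coaction \<theta> = lift_coaction \<kappa> \<bullet> fmap S f"
proof -
  have "fmap G (fmap S f) \<bullet> lift_coaction \<theta> = (fmap G (fmap S f) \<bullet> l (src f)) \<bullet> fmap S \<theta>"
    using assms(1-7) by (simp add: lift_coaction_def)
  also have "\<dots> = l (trg f) \<bullet> fmap S (fmap G f \<bullet> \<theta>)"
    using assms(1-7) by (simp flip: l_nat)
  also have "\<dots> = lift_coaction \<kappa> \<bullet> fmap S f"
    unfolding assms(8) using assms(1-7) by (simp add: lift_coaction_def)
  finally show ?thesis .
qed

text \<open>Dual to \<open>lift_coalgebra\<close>: \<open>l_n\<close> and \<open>l_u\<close> take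
  the places of \<open>l_d\<close> and \<open>l_c\<close>.\<close>

lemma cofree_algebra:
  assumes "S.algebra h"
  shows "S.algebra (cofree_action h)"
proof -
  let ?X = "trg h"
  note h = S.algebraD [OF assms]
  note [simp] = h(1,2) S.C.arrow_trg [OF h(1)]
  have "cofree_action h \<bullet> fmap S (cofree_action h)
      = fmap G h \<bullet> (l (trg h) \<bullet> fmap S (fmap G h)) \<bullet> fmap S (l ?X)"
    by (simp add: cofree_action_def)
  also have "\<dots> = fmap G (h \<bullet> fmap S h) \<bullet> l (fob S ?X) \<bullet> fmap S (l ?X)"
    by (subst l_nat) simp_all
  also have "\<dots> = fmap G h \<bullet> (fmap G (n ?X) \<bullet> l (fob S ?X) \<bullet> fmap S (l ?X))"
    unfolding h(3) by simp
  also have "\<dots> = cofree_action h \<bullet> n (fob G ?X)"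
    by (simp add: cofree_action_def flip: l_n)
  finally have "cofree_action h \<bullet> fmap S (cofree_action h) = cofree_action h \<bullet> n (fob G ?X)" .
  moreover have "cofree_action h \<bullet> u (fob G ?X) = fmap G (h \<bullet> u ?X)"
    by (simp add: cofree_action_def l_u)
  ultimately show ?thesis by (simp add: S.algebra_def h(4)) (simp add: cofree_action_def)
qed

text \<open>Naturality of \<open>d\<close> followed by \<open>l_d\<close>. This is the Hopf module
  condition for the cofree coalgebra on an algebra, the form in which the values of \<open>K\<close>
  satisfy it.\<close>

lemma cofree_hopf:
  assumes "S.algebra h"
  shows "d (trg h) \<bullet> cofree_action h = fmap G (cofree_action h) \<bullet> lift_coaction (d (trg h))"
proof -
  let ?X = "trg h"
  note h = S.algebraD [OF assms]
  note [simp] = h(1,2) S.C.arrow_trg [OF h(1)]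
  have "d ?X \<bullet> cofree_action h = (d (trg h) \<bullet> fmap G h) \<bullet> l ?X"
    by (simp add: cofree_action_def)
  also have "\<dots> = fmap G (fmap G h) \<bullet> d (fob S ?X) \<bullet> l ?X"
    by (subst G.d_nat) simp_all
  also have "\<dots> = fmap G (cofree_action h) \<bullet> lift_coaction (d ?X)"
    by (simp add: l_d cofree_action_def lift_coaction_def)
  finally show ?thesis .
qed

lemma cofree_action_natural:
  assumes "arrow C f" "arrow C h" "arrow C k" "trg h = src f" "src h = fob S (src f)"
    "trg k = trg f" "src k = fob S (trg f)" "f \<bullet> h = k \<bullet> fmap S f"
  shows "fmap G f \<bullet> cofree_action h = cofree_action k \<bullet> fmap S (fmap G f)"
proof -
  have "fmap G f \<bullet> cofree_action h = fmap G (f \<bullet> h) \<bullet> l (src f)"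
    using assms(1-7) by (simp add: cofree_action_def)
  also have "\<dots> = fmap G k \<bullet> fmap G (fmap S f) \<bullet> l (src f)"
    unfolding assms(8) using assms(1-7) by simp
  also have "\<dots> = cofree_action k \<bullet> fmap S (fmap G f)"
    using assms(1-7) by (simp add: cofree_action_def flip: l_nat)
  finally show ?thesis .
qed

end

section \<open>Monoidal categories\<close>

definition tensor_arrow ::
  "('o, 'm) mon_struct \<Rightarrow> ('o, 'm) arrow \<Rightarrow> ('o, 'm) arrow \<Rightarrow> ('o, 'm) arrow"
  (infixr "\<boxtimes>\<index>" 70) where
  "f \<boxtimes>\<^bsub>V\<^esub> g = Arr (src f \<otimes>\<^bsub>V\<^esub> src g) (mor f \<otimes>\<^sub>m\<^bsub>V\<^esub> mor g) (trg f \<otimes>\<^bsub>V\<^esub> trg g)"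

lemma tensor_arrow_sel [simp]:
  "src (f \<boxtimes>\<^bsub>V\<^esub> g) = src f \<otimes>\<^bsub>V\<^esub> src g" "trg (f \<boxtimes>\<^bsub>V\<^esub> g) = trg f \<otimes>\<^bsub>V\<^esub> trg g"
  "mor (f \<boxtimes>\<^bsub>V\<^esub> g) = mor f \<otimes>\<^sub>m\<^bsub>V\<^esub> mor g"
  by (simp_all add: tensor_arrow_def)

definition right_tensor ::
  "('o, 'm, 'z) cat_scheme \<Rightarrow> ('o, 'm) mon_struct \<Rightarrow> 'o \<Rightarrow> ('o, 'm, 'o, 'm) func" where
  "right_tensor C V M = \<lparr>fob = (\<lambda>X. X \<otimes>\<^bsub>V\<^esub> M), fmor = (\<lambda>X Y f. f \<otimes>\<^sub>m\<^bsub>V\<^esub> Id C M)\<rparr>"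

lemma right_tensor_simps [simp]:
  "fob (right_tensor C V M) X = X \<otimes>\<^bsub>V\<^esub> M"
  "fmap (right_tensor C V M) f = f \<boxtimes>\<^bsub>V\<^esub> id_arrow C M"
  by (simp_all add: right_tensor_def fmap_def tensor_arrow_def)

context monoidal
begin

declare tensor_Ob [simp] unit_Ob [simp]

lemma tensor_arrow_arrow [simp]: "\<lbrakk>arrow C f; arrow C g\<rbrakk> \<Longrightarrow> arrow C (f \<boxtimes>\<^bsub>V\<^esub> g)"
  using tensor_Hom by (simp add: arrow_def)

lemma tensor_id [simp]:
  "\<lbrakk>X \<in> Ob C; Y \<in> Ob C\<rbrakk> \<Longrightarrow> id_arrow C X \<boxtimes>\<^bsub>V\<^esub> id_arrow C Y = id_arrow C (X \<otimes>\<^bsub>V\<^esub> Y)"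
  using tensor_Id by (simp add: tensor_arrow_def id_arrow_def)

lemma interchange [simp]:
  "\<lbrakk>arrow C f; arrow C f'; arrow C g; arrow C g'; src f' = trg f; src g' = trg g\<rbrakk>
   \<Longrightarrow> (f' \<boxtimes>\<^bsub>V\<^esub> g') \<bullet> (f \<boxtimes>\<^bsub>V\<^esub> g) = (f' \<bullet> f) \<boxtimes>\<^bsub>V\<^esub> (g' \<bullet> g)"
  using tensor_Comp [of "mor f" "src f" "trg f" "mor f'" "trg f'" "mor g" "src g" "trg g" "mor g'" "trg g'"]
  by (simp add: tensor_arrow_def comp_arrow_def arrow_def)

lemma interchange_assoc [simp]:
  "\<lbrakk>arrow C f; arrow C f'; arrow C g; arrow C g'; src f' = trg f; src g' = trg g;
    arrow C h; trg h = src f \<otimes>\<^bsub>V\<^esub> src g\<rbrakk>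
   \<Longrightarrow> (f' \<boxtimes>\<^bsub>V\<^esub> g') \<bullet> (f \<boxtimes>\<^bsub>V\<^esub> g) \<bullet> h = ((f' \<bullet> f) \<boxtimes>\<^bsub>V\<^esub> (g' \<bullet> g)) \<bullet> h"
  by (rule reassoc) simp_all

definition "al X Y Z = Arr ((X \<otimes>\<^bsub>V\<^esub> Y) \<otimes>\<^bsub>V\<^esub> Z) (assoc V X Y Z) (X \<otimes>\<^bsub>V\<^esub> (Y \<otimes>\<^bsub>V\<^esub> Z))"
definition "al' X Y Z = Arr (X \<otimes>\<^bsub>V\<^esub> (Y \<otimes>\<^bsub>V\<^esub> Z)) (assoc_inv C V X Y Z) ((X \<otimes>\<^bsub>V\<^esub> Y) \<otimes>\<^bsub>V\<^esub> Z)"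
definition "lu X = Arr (unit_ob V \<otimes>\<^bsub>V\<^esub> X) (lunit V X) X"
definition "lu' X = Arr X (lunit_inv C V X) (unit_ob V \<otimes>\<^bsub>V\<^esub> X)"
definition "ru X = Arr (X \<otimes>\<^bsub>V\<^esub> unit_ob V) (runit V X) X"
definition "ru' X = Arr X (runit_inv C V X) (X \<otimes>\<^bsub>V\<^esub> unit_ob V)"

lemma constraint_sel [simp]:
  "src (al X Y Z) = (X \<otimes>\<^bsub>V\<^esub> Y) \<otimes>\<^bsub>V\<^esub> Z" "trg (al X Y Z) = X \<otimes>\<^bsub>V\<^esub> (Y \<otimes>\<^bsub>V\<^esub> Z)"
  "src (al' X Y Z) = X \<otimes>\<^bsub>V\<^esub> (Y \<otimes>\<^bsub>V\<^esub> Z)" "trg (al' X Y Z) = (X \<otimes>\<^bsub>V\<^esub> Y) \<otimes>\<^bsub>V\<^esub> Z"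
  "src (lu X) = unit_ob V \<otimes>\<^bsub>V\<^esub> X" "trg (lu X) = X"
  "src (lu' X) = X" "trg (lu' X) = unit_ob V \<otimes>\<^bsub>V\<^esub> X"
  "src (ru X) = X \<otimes>\<^bsub>V\<^esub> unit_ob V" "trg (ru X) = X"
  "src (ru' X) = X" "trg (ru' X) = X \<otimes>\<^bsub>V\<^esub> unit_ob V"
  by (simp_all add: al_def al'_def lu_def lu'_def ru_def ru'_def)

lemma al_inverse: "\<lbrakk>X \<in> Ob C; Y \<in> Ob C; Z \<in> Ob C\<rbrakk> \<Longrightarrow> inverse_arrows (al X Y Z) (al' X Y Z)"
  using inverse_of_mutual [OF assoc_iso] by (simp add: al_def al'_def assoc_inv_def mutually_inverse_iff)

lemma lu_inverse: "X \<in> Ob C \<Longrightarrow> inverse_arrows (lu X) (lu' X)"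
  using inverse_of_mutual [OF lunit_iso] by (simp add: lu_def lu'_def lunit_inv_def mutually_inverse_iff)

lemma ru_inverse: "X \<in> Ob C \<Longrightarrow> inverse_arrows (ru X) (ru' X)"
  using inverse_of_mutual [OF runit_iso] by (simp add: ru_def ru'_def runit_inv_def mutually_inverse_iff)

lemma constraint_arrow [simp]:
  "\<lbrakk>X \<in> Ob C; Y \<in> Ob C; Z \<in> Ob C\<rbrakk> \<Longrightarrow> arrow C (al X Y Z)"
  "\<lbrakk>X \<in> Ob C; Y \<in> Ob C; Z \<in> Ob C\<rbrakk> \<Longrightarrow> arrow C (al' X Y Z)"
  "X \<in> Ob C \<Longrightarrow> arrow C (lu X)" "X \<in> Ob C \<Longrightarrow> arrow C (lu' X)"
  "X \<in> Ob C \<Longrightarrow> arrow C (ru X)" "X \<in> Ob C \<Longrightarrow> arrow C (ru' X)"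
  by (auto dest: inverse_arrowsD(1,2) [OF al_inverse] inverse_arrowsD(1,2) [OF lu_inverse]
      inverse_arrowsD(1,2) [OF ru_inverse])

lemmas constraint_cancel [simp] =
  inverse_arrowsD(5,6) [OF al_inverse, simplified] inverse_arrows_cancel [OF al_inverse, simplified]
  inverse_arrowsD(5,6) [OF lu_inverse, simplified] inverse_arrows_cancel [OF lu_inverse, simplified]
  inverse_arrowsD(5,6) [OF ru_inverse, simplified] inverse_arrows_cancel [OF ru_inverse, simplified]

lemma al_nat: "\<lbrakk>arrow C f; arrow C g; arrow C h\<rbrakk> \<Longrightarrow>
    al (trg f) (trg g) (trg h) \<bullet> ((f \<boxtimes>\<^bsub>V\<^esub> g) \<boxtimes>\<^bsub>V\<^esub> h) = (f \<boxtimes>\<^bsub>V\<^esub> (g \<boxtimes>\<^bsub>V\<^esub> h)) \<bullet> al (src f) (src g) (src h)"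
  using assoc_nat [of "mor f" "src f" "trg f" "mor g" "src g" "trg g" "mor h" "src h" "trg h"]
  by (simp add: al_def tensor_arrow_def comp_triple arrow_def)

lemma ru_nat: "arrow C f \<Longrightarrow> ru (trg f) \<bullet> (f \<boxtimes>\<^bsub>V\<^esub> id_arrow C (unit_ob V)) = f \<bullet> ru (src f)"
  using runit_nat [of "mor f" "src f" "trg f"]
  by (simp add: ru_def tensor_arrow_def comp_arrow_def arrow_def)

lemma al'_nat: 
  assumes "arrow C f" "arrow C g" "arrow C h"
  shows "al' (trg f) (trg g) (trg h) \<bullet> (f \<boxtimes>\<^bsub>V\<^esub> (g \<boxtimes>\<^bsub>V\<^esub> h)) = ((f \<boxtimes>\<^bsub>V\<^esub> g) \<boxtimes>\<^bsub>V\<^esub> h) \<bullet> al' (src f) (src g) (src h)"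
  by (rule iso_left_cancel [OF al_inverse [of "trg f" "trg g" "trg h"]])
    (use assms reassoc [OF al_nat [OF assms], of "al' (src f) (src g) (src h)"] in simp_all)

lemma ru'_nat:
  assumes "arrow C f"
  shows "ru' (trg f) \<bullet> f = (f \<boxtimes>\<^bsub>V\<^esub> id_arrow C (unit_ob V)) \<bullet> ru' (src f)"
  by (rule iso_left_cancel [OF ru_inverse [of "trg f"]])
    (use assms reassoc [OF ru_nat [OF assms], of "ru' (src f)"] in simp_all)

lemma pentagon_arrow: "\<lbrakk>W \<in> Ob C; X \<in> Ob C; Y \<in> Ob C; Z \<in> Ob C\<rbrakk> \<Longrightarrow>
    (id_arrow C W \<boxtimes>\<^bsub>V\<^esub> al X Y Z) \<bullet> al W (X \<otimes>\<^bsub>V\<^esub> Y) Z \<bullet> (al W X Y \<boxtimes>\<^bsub>V\<^esub> id_arrow C Z)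
    = al W X (Y \<otimes>\<^bsub>V\<^esub> Z) \<bullet> al (W \<otimes>\<^bsub>V\<^esub> X) Y Z"
  using pentagon by (simp add: al_def tensor_arrow_def comp_arrow_def id_arrow_def)

lemma triangle_arrow: "\<lbrakk>X \<in> Ob C; Y \<in> Ob C\<rbrakk> \<Longrightarrow>
    (id_arrow C X \<boxtimes>\<^bsub>V\<^esub> lu Y) \<bullet> al X (unit_ob V) Y = ru X \<boxtimes>\<^bsub>V\<^esub> id_arrow C Y"
  using triangle by (simp add: al_def lu_def ru_def tensor_arrow_def comp_arrow_def id_arrow_def)

text \<open>Kelly's argument: the pentagon determines the map after tensoring with the unit object.\<close>

lemma ru_tensor:
  assumes XY [simp]: "X \<in> Ob C" "Y \<in> Ob C"
  shows "(id_arrow C X \<boxtimes>\<^bsub>V\<^esub> ru Y) \<bullet> al X Y (unit_ob V) = ru (X \<otimes>\<^bsub>V\<^esub> Y)"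
proof -
  let ?I = "unit_ob V" and ?i = "id_arrow C"
  let ?f = "(?i X \<boxtimes>\<^bsub>V\<^esub> ru Y) \<bullet> al X Y ?I"
  have "al X Y ?I \<bullet> (?f \<boxtimes>\<^bsub>V\<^esub> ?i ?I)
      = (al X Y ?I \<bullet> ((?i X \<boxtimes>\<^bsub>V\<^esub> ru Y) \<boxtimes>\<^bsub>V\<^esub> ?i ?I)) \<bullet> (al X Y ?I \<boxtimes>\<^bsub>V\<^esub> ?i ?I)"
    by simp
  also have "al X Y ?I \<bullet> ((?i X \<boxtimes>\<^bsub>V\<^esub> ru Y) \<boxtimes>\<^bsub>V\<^esub> ?i ?I) = (?i X \<boxtimes>\<^bsub>V\<^esub> (ru Y \<boxtimes>\<^bsub>V\<^esub> ?i ?I)) \<bullet> al X (Y \<otimes>\<^bsub>V\<^esub> ?I) ?I"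
    using al_nat [of "?i X" "ru Y" "?i ?I"] by simp
  also have "ru Y \<boxtimes>\<^bsub>V\<^esub> ?i ?I = (?i Y \<boxtimes>\<^bsub>V\<^esub> lu ?I) \<bullet> al Y ?I ?I"
    by (simp add: triangle_arrow)
  also have "((?i X \<boxtimes>\<^bsub>V\<^esub> ((?i Y \<boxtimes>\<^bsub>V\<^esub> lu ?I) \<bullet> al Y ?I ?I)) \<bullet> al X (Y \<otimes>\<^bsub>V\<^esub> ?I) ?I) \<bullet> (al X Y ?I \<boxtimes>\<^bsub>V\<^esub> ?i ?I)
      = (?i X \<boxtimes>\<^bsub>V\<^esub> (?i Y \<boxtimes>\<^bsub>V\<^esub> lu ?I)) \<bullet> ((?i X \<boxtimes>\<^bsub>V\<^esub> al Y ?I ?I) \<bullet> al X (Y \<otimes>\<^bsub>V\<^esub> ?I) ?I \<bullet> (al X Y ?I \<boxtimes>\<^bsub>V\<^esub> ?i ?I))"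
    by simp
  also have "\<dots> = ((?i X \<boxtimes>\<^bsub>V\<^esub> (?i Y \<boxtimes>\<^bsub>V\<^esub> lu ?I)) \<bullet> al X Y (?I \<otimes>\<^bsub>V\<^esub> ?I)) \<bullet> al (X \<otimes>\<^bsub>V\<^esub> Y) ?I ?I"
    by (subst pentagon_arrow) simp_all
  also have "(?i X \<boxtimes>\<^bsub>V\<^esub> (?i Y \<boxtimes>\<^bsub>V\<^esub> lu ?I)) \<bullet> al X Y (?I \<otimes>\<^bsub>V\<^esub> ?I) = al X Y ?I \<bullet> (?i (X \<otimes>\<^bsub>V\<^esub> Y) \<boxtimes>\<^bsub>V\<^esub> lu ?I)"
    using al_nat [of "?i X" "?i Y" "lu ?I"] by simp
  also have "(al X Y ?I \<bullet> (?i (X \<otimes>\<^bsub>V\<^esub> Y) \<boxtimes>\<^bsub>V\<^esub> lu ?I)) \<bullet> al (X \<otimes>\<^bsub>V\<^esub> Y) ?I ?I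
      = al X Y ?I \<bullet> (ru (X \<otimes>\<^bsub>V\<^esub> Y) \<boxtimes>\<^bsub>V\<^esub> ?i ?I)"
    by (simp add: triangle_arrow)
  finally have "?f \<boxtimes>\<^bsub>V\<^esub> ?i ?I = ru (X \<otimes>\<^bsub>V\<^esub> Y) \<boxtimes>\<^bsub>V\<^esub> ?i ?I"
    by (rule iso_left_cancel [OF al_inverse [OF XY unit_Ob]]) simp_all
  \<comment> \<open>Tensoring with the unit object is faithful, because \<open>ru\<close> is a
    natural isomorphism from it to the identity.\<close>
  then have "?f \<bullet> ru ((X \<otimes>\<^bsub>V\<^esub> Y) \<otimes>\<^bsub>V\<^esub> ?I) = ru (X \<otimes>\<^bsub>V\<^esub> Y) \<bullet> ru ((X \<otimes>\<^bsub>V\<^esub> Y) \<otimes>\<^bsub>V\<^esub> ?I)"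
    using ru_nat [of ?f] ru_nat [of "ru (X \<otimes>\<^bsub>V\<^esub> Y)"] by simp
  then show ?thesis
    by (rule iso_right_cancel [OF ru_inverse, rotated]) simp_all
qed

lemma right_tensor_functor: "M \<in> Ob C \<Longrightarrow> is_functor C C (right_tensor C V M)"
  by (simp add: is_functor_iff)

end

section \<open>Monads from monoids and comonads from comonoids\<close>

locale monoid_object = monoidal C V
  for C :: "('o, 'm, 'z) cat_scheme" (structure) and V :: "('o, 'm) mon_struct" +
  fixes M :: 'o and m e :: 'm
  assumes monoid: "is_monoid C V M m e"
begin

abbreviation "S \<equiv> right_tensor C V M"
definition "m_arrow = Arr (M \<otimes>\<^bsub>V\<^esub> M) m M"
definition "e_arrow = Arr (unit_ob V) e M"
definition "unit_at X = (id_arrow C X \<boxtimes>\<^bsub>V\<^esub> e_arrow) \<bullet> ru' X"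
definition "mult_at X = (id_arrow C X \<boxtimes>\<^bsub>V\<^esub> m_arrow) \<bullet> al X M M"

lemma M_Ob [simp]: "M \<in> Ob C"
  and m_arrow [simp]: "arrow C m_arrow" "src m_arrow = M \<otimes>\<^bsub>V\<^esub> M" "trg m_arrow = M"
  and e_arrow [simp]: "arrow C e_arrow" "src e_arrow = unit_ob V" "trg e_arrow = M"
  and m_assoc: "m_arrow \<bullet> (m_arrow \<boxtimes>\<^bsub>V\<^esub> id_arrow C M) = m_arrow \<bullet> (id_arrow C M \<boxtimes>\<^bsub>V\<^esub> m_arrow) \<bullet> al M M M"
  and m_e_left: "m_arrow \<bullet> (e_arrow \<boxtimes>\<^bsub>V\<^esub> id_arrow C M) = lu M"
  and m_e_right: "m_arrow \<bullet> (id_arrow C M \<boxtimes>\<^bsub>V\<^esub> e_arrow) = ru M"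
  using monoid unfolding is_monoid_def m_arrow_def e_arrow_def
  by (simp_all add: tensor_arrow_def id_arrow_def comp_arrow_def al_def lu_def ru_def)

text \<open>Associativity is the pentagon. Of the unit laws, the one with the unit at
  \<open>X \<otimes> M\<close> leaves the constraint \<open>ru (X \<otimes> M)\<close> behind and so
  rests on \<open>ru_tensor\<close>; the other is the triangle axiom.\<close>

sublocale S: monad C S unit_at mult_at
proof
  show "is_functor C C S" by (rule right_tensor_functor) simp
  show "arrow C (unit_at X)" if "X \<in> Ob C" for X using that by (simp add: unit_at_def)
  show "arrow C (mult_at X)" if "X \<in> Ob C" for X using that by (simp add: mult_at_def)
  show "src (unit_at X) = X" "trg (unit_at X) = fob S X"
    "src (mult_at X) = fob S (fob S X)" "trg (mult_at X) = fob S X" for X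
    by (simp_all add: unit_at_def mult_at_def)
  show "unit_at (trg f) \<bullet> f = fmap S f \<bullet> unit_at (src f)" if "arrow C f" for f
    using that by (simp add: unit_at_def ru'_nat)
  show "mult_at (trg f) \<bullet> fmap S (fmap S f) = fmap S f \<bullet> mult_at (src f)" if "arrow C f" for f
    using that al_nat [of f "id_arrow C M" "id_arrow C M"] by (simp add: mult_at_def)
  fix X assume X [simp]: "X \<in> Ob C"
  let ?i = "id_arrow C" and ?I = "unit_ob V"
  have "mult_at X \<bullet> unit_at (fob S X)
      = (?i X \<boxtimes>\<^bsub>V\<^esub> m_arrow) \<bullet> (al X M M \<bullet> ((?i X \<boxtimes>\<^bsub>V\<^esub> ?i M) \<boxtimes>\<^bsub>V\<^esub> e_arrow)) \<bullet> ru' (X \<otimes>\<^bsub>V\<^esub> M)"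
    by (simp add: mult_at_def unit_at_def)
  also have "al X M M \<bullet> ((?i X \<boxtimes>\<^bsub>V\<^esub> ?i M) \<boxtimes>\<^bsub>V\<^esub> e_arrow) = (?i X \<boxtimes>\<^bsub>V\<^esub> (?i M \<boxtimes>\<^bsub>V\<^esub> e_arrow)) \<bullet> al X M ?I"
    using al_nat [of "?i X" "?i M" e_arrow] by simp
  also have "(?i X \<boxtimes>\<^bsub>V\<^esub> m_arrow) \<bullet> ((?i X \<boxtimes>\<^bsub>V\<^esub> (?i M \<boxtimes>\<^bsub>V\<^esub> e_arrow)) \<bullet> al X M ?I) \<bullet> ru' (X \<otimes>\<^bsub>V\<^esub> M)
      = ((?i X \<boxtimes>\<^bsub>V\<^esub> ru M) \<bullet> al X M ?I) \<bullet> ru' (X \<otimes>\<^bsub>V\<^esub> M)"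
    by (simp add: m_e_right)
  finally show "mult_at X \<bullet> unit_at (fob S X) = id_arrow C (fob S X)"
    by (simp add: ru_tensor)
  have "mult_at X \<bullet> fmap S (unit_at X)
      = (?i X \<boxtimes>\<^bsub>V\<^esub> m_arrow) \<bullet> (al X M M \<bullet> ((?i X \<boxtimes>\<^bsub>V\<^esub> e_arrow) \<boxtimes>\<^bsub>V\<^esub> ?i M)) \<bullet> (ru' X \<boxtimes>\<^bsub>V\<^esub> ?i M)"
    by (simp add: mult_at_def unit_at_def)
  also have "al X M M \<bullet> ((?i X \<boxtimes>\<^bsub>V\<^esub> e_arrow) \<boxtimes>\<^bsub>V\<^esub> ?i M) = (?i X \<boxtimes>\<^bsub>V\<^esub> (e_arrow \<boxtimes>\<^bsub>V\<^esub> ?i M)) \<bullet> al X ?I M"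
    using al_nat [of "?i X" e_arrow "?i M"] by simp
  also have "(?i X \<boxtimes>\<^bsub>V\<^esub> m_arrow) \<bullet> ((?i X \<boxtimes>\<^bsub>V\<^esub> (e_arrow \<boxtimes>\<^bsub>V\<^esub> ?i M)) \<bullet> al X ?I M) \<bullet> (ru' X \<boxtimes>\<^bsub>V\<^esub> ?i M)
      = ((?i X \<boxtimes>\<^bsub>V\<^esub> lu M) \<bullet> al X ?I M) \<bullet> (ru' X \<boxtimes>\<^bsub>V\<^esub> ?i M)"
    by (simp add: m_e_left)
  finally show "mult_at X \<bullet> fmap S (unit_at X) = id_arrow C (fob S X)"
    by (simp add: triangle_arrow)
  have "mult_at X \<bullet> fmap S (mult_at X)
      = (?i X \<boxtimes>\<^bsub>V\<^esub> m_arrow) \<bullet> (al X M M \<bullet> ((?i X \<boxtimes>\<^bsub>V\<^esub> m_arrow) \<boxtimes>\<^bsub>V\<^esub> ?i M)) \<bullet> (al X M M \<boxtimes>\<^bsub>V\<^esub> ?i M)"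
    by (simp add: mult_at_def)
  also have "al X M M \<bullet> ((?i X \<boxtimes>\<^bsub>V\<^esub> m_arrow) \<boxtimes>\<^bsub>V\<^esub> ?i M) = (?i X \<boxtimes>\<^bsub>V\<^esub> (m_arrow \<boxtimes>\<^bsub>V\<^esub> ?i M)) \<bullet> al X (M \<otimes>\<^bsub>V\<^esub> M) M"
    using al_nat [of "?i X" m_arrow "?i M"] by simp
  also have "(?i X \<boxtimes>\<^bsub>V\<^esub> m_arrow) \<bullet> ((?i X \<boxtimes>\<^bsub>V\<^esub> (m_arrow \<boxtimes>\<^bsub>V\<^esub> ?i M)) \<bullet> al X (M \<otimes>\<^bsub>V\<^esub> M) M) \<bullet> (al X M M \<boxtimes>\<^bsub>V\<^esub> ?i M)
      = (?i X \<boxtimes>\<^bsub>V\<^esub> (m_arrow \<bullet> (?i M \<boxtimes>\<^bsub>V\<^esub> m_arrow))) \<bullet> ((?i X \<boxtimes>\<^bsub>V\<^esub> al M M M) \<bullet> al X (M \<otimes>\<^bsub>V\<^esub> M) M \<bullet> (al X M M \<boxtimes>\<^bsub>V\<^esub> ?i M))"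
    by (simp add: m_assoc)
  also have "\<dots> = (?i X \<boxtimes>\<^bsub>V\<^esub> m_arrow) \<bullet> ((?i X \<boxtimes>\<^bsub>V\<^esub> (?i M \<boxtimes>\<^bsub>V\<^esub> m_arrow)) \<bullet> al X M (M \<otimes>\<^bsub>V\<^esub> M)) \<bullet> al (X \<otimes>\<^bsub>V\<^esub> M) M M"
    by (subst pentagon_arrow) simp_all
  also have "(?i X \<boxtimes>\<^bsub>V\<^esub> (?i M \<boxtimes>\<^bsub>V\<^esub> m_arrow)) \<bullet> al X M (M \<otimes>\<^bsub>V\<^esub> M) = al X M M \<bullet> ((?i X \<boxtimes>\<^bsub>V\<^esub> ?i M) \<boxtimes>\<^bsub>V\<^esub> m_arrow)"
    using al_nat [of "?i X" "?i M" m_arrow] by simp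
  finally show "mult_at X \<bullet> fmap S (mult_at X) = mult_at X \<bullet> mult_at (fob S X)"
    by (simp add: mult_at_def)
qed

end

locale comonoid_object = monoidal C V
  for C :: "('o, 'm, 'z) cat_scheme" (structure) and V :: "('o, 'm) mon_struct" +
  fixes M :: 'o and \<delta> \<epsilon> :: 'm
  assumes comonoid: "is_comonoid C V M \<delta> \<epsilon>"
begin

abbreviation "G \<equiv> right_tensor C V M"
definition "d_arrow = Arr M \<delta> (M \<otimes>\<^bsub>V\<^esub> M)"
definition "c_arrow = Arr M \<epsilon> (unit_ob V)"
definition "counit_at X = ru X \<bullet> (id_arrow C X \<boxtimes>\<^bsub>V\<^esub> c_arrow)"
definition "comult_at X = al' X M M \<bullet> (id_arrow C X \<boxtimes>\<^bsub>V\<^esub> d_arrow)"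

lemma M_Ob [simp]: "M \<in> Ob C"
  and d_arrow [simp]: "arrow C d_arrow" "trg d_arrow = M \<otimes>\<^bsub>V\<^esub> M" "src d_arrow = M"
  and c_arrow [simp]: "arrow C c_arrow" "trg c_arrow = unit_ob V" "src c_arrow = M"
  and d_coassoc: "al M M M \<bullet> (d_arrow \<boxtimes>\<^bsub>V\<^esub> id_arrow C M) \<bullet> d_arrow = (id_arrow C M \<boxtimes>\<^bsub>V\<^esub> d_arrow) \<bullet> d_arrow"
  and d_c_left: "lu M \<bullet> (c_arrow \<boxtimes>\<^bsub>V\<^esub> id_arrow C M) \<bullet> d_arrow = id_arrow C M"
  and d_c_right: "ru M \<bullet> (id_arrow C M \<boxtimes>\<^bsub>V\<^esub> c_arrow) \<bullet> d_arrow = id_arrow C M"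
  using comonoid unfolding is_comonoid_def d_arrow_def c_arrow_def
  by (simp_all add: tensor_arrow_def id_arrow_def comp_arrow_def al_def lu_def ru_def)

text \<open>Dual to the monad of a monoid, with inverse associators throughout; their identities are
  obtained from \<open>ru_tensor\<close>, \<open>triangle_arrow\<close> and
  \<open>pentagon_arrow\<close> by cancelling associators.\<close>

sublocale G: comonad C G counit_at comult_at
proof
  show "is_functor C C G" by (rule right_tensor_functor) simp
  show "arrow C (counit_at X)" if "X \<in> Ob C" for X using that by (simp add: counit_at_def)
  show "arrow C (comult_at X)" if "X \<in> Ob C" for X using that by (simp add: comult_at_def)
  show "trg (counit_at X) = X" "src (counit_at X) = fob G X"
    "trg (comult_at X) = fob G (fob G X)" "src (comult_at X) = fob G X" for X
    by (simp_all add: counit_at_def comult_at_def)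
  show "counit_at (trg f) \<bullet> fmap G f = f \<bullet> counit_at (src f)" if "arrow C f" for f
  proof -
    have "counit_at (trg f) \<bullet> fmap G f = (ru (trg f) \<bullet> (f \<boxtimes>\<^bsub>V\<^esub> id_arrow C (unit_ob V))) \<bullet> (id_arrow C (src f) \<boxtimes>\<^bsub>V\<^esub> c_arrow)"
      using that by (simp add: counit_at_def)
    then show ?thesis using that by (simp add: ru_nat counit_at_def)
  qed
  show "comult_at (trg f) \<bullet> fmap G f = fmap G (fmap G f) \<bullet> comult_at (src f)" if "arrow C f" for f
  proof -
    have "comult_at (trg f) \<bullet> fmap G f
        = (al' (trg f) M M \<bullet> (f \<boxtimes>\<^bsub>V\<^esub> (id_arrow C M \<boxtimes>\<^bsub>V\<^esub> id_arrow C M))) \<bullet> (id_arrow C (src f) \<boxtimes>\<^bsub>V\<^esub> d_arrow)"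
      using that by (simp add: comult_at_def)
    also have "al' (trg f) M M \<bullet> (f \<boxtimes>\<^bsub>V\<^esub> (id_arrow C M \<boxtimes>\<^bsub>V\<^esub> id_arrow C M))
        = ((f \<boxtimes>\<^bsub>V\<^esub> id_arrow C M) \<boxtimes>\<^bsub>V\<^esub> id_arrow C M) \<bullet> al' (src f) M M"
      using that al'_nat [of f "id_arrow C M" "id_arrow C M"] by simp
    finally show ?thesis using that by (simp add: comult_at_def)
  qed
  fix X assume X [simp]: "X \<in> Ob C"
  let ?i = "id_arrow C" and ?I = "unit_ob V"
  have ru_al': "ru (X \<otimes>\<^bsub>V\<^esub> M) \<bullet> al' X M ?I = ?i X \<boxtimes>\<^bsub>V\<^esub> ru M"
    by (simp flip: ru_tensor)
  have "counit_at (fob G X) \<bullet> comult_at X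
      = ru (X \<otimes>\<^bsub>V\<^esub> M) \<bullet> (((?i X \<boxtimes>\<^bsub>V\<^esub> ?i M) \<boxtimes>\<^bsub>V\<^esub> c_arrow) \<bullet> al' X M M) \<bullet> (?i X \<boxtimes>\<^bsub>V\<^esub> d_arrow)"
    by (simp add: counit_at_def comult_at_def)
  also have "((?i X \<boxtimes>\<^bsub>V\<^esub> ?i M) \<boxtimes>\<^bsub>V\<^esub> c_arrow) \<bullet> al' X M M = al' X M ?I \<bullet> (?i X \<boxtimes>\<^bsub>V\<^esub> (?i M \<boxtimes>\<^bsub>V\<^esub> c_arrow))"
    using al'_nat [of "?i X" "?i M" c_arrow] by simp
  also have "ru (X \<otimes>\<^bsub>V\<^esub> M) \<bullet> (al' X M ?I \<bullet> (?i X \<boxtimes>\<^bsub>V\<^esub> (?i M \<boxtimes>\<^bsub>V\<^esub> c_arrow))) \<bullet> (?i X \<boxtimes>\<^bsub>V\<^esub> d_arrow)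
      = (ru (X \<otimes>\<^bsub>V\<^esub> M) \<bullet> al' X M ?I) \<bullet> (?i X \<boxtimes>\<^bsub>V\<^esub> ((?i M \<boxtimes>\<^bsub>V\<^esub> c_arrow) \<bullet> d_arrow))"
    by simp
  finally show "counit_at (fob G X) \<bullet> comult_at X = id_arrow C (fob G X)"
    unfolding ru_al' by (simp add: d_c_right)
  have ru_al'2: "(ru X \<boxtimes>\<^bsub>V\<^esub> ?i M) \<bullet> al' X ?I M = ?i X \<boxtimes>\<^bsub>V\<^esub> lu M"
    by (simp flip: triangle_arrow)
  have "fmap G (counit_at X) \<bullet> comult_at X
      = (ru X \<boxtimes>\<^bsub>V\<^esub> ?i M) \<bullet> (((?i X \<boxtimes>\<^bsub>V\<^esub> c_arrow) \<boxtimes>\<^bsub>V\<^esub> ?i M) \<bullet> al' X M M) \<bullet> (?i X \<boxtimes>\<^bsub>V\<^esub> d_arrow)"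
    by (simp add: counit_at_def comult_at_def)
  also have "((?i X \<boxtimes>\<^bsub>V\<^esub> c_arrow) \<boxtimes>\<^bsub>V\<^esub> ?i M) \<bullet> al' X M M = al' X ?I M \<bullet> (?i X \<boxtimes>\<^bsub>V\<^esub> (c_arrow \<boxtimes>\<^bsub>V\<^esub> ?i M))"
    using al'_nat [of "?i X" c_arrow "?i M"] by simp
  also have "(ru X \<boxtimes>\<^bsub>V\<^esub> ?i M) \<bullet> (al' X ?I M \<bullet> (?i X \<boxtimes>\<^bsub>V\<^esub> (c_arrow \<boxtimes>\<^bsub>V\<^esub> ?i M))) \<bullet> (?i X \<boxtimes>\<^bsub>V\<^esub> d_arrow)
      = ((ru X \<boxtimes>\<^bsub>V\<^esub> ?i M) \<bullet> al' X ?I M) \<bullet> (?i X \<boxtimes>\<^bsub>V\<^esub> ((c_arrow \<boxtimes>\<^bsub>V\<^esub> ?i M) \<bullet> d_arrow))"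
    by simp
  finally show "fmap G (counit_at X) \<bullet> comult_at X = id_arrow C (fob G X)"
    unfolding ru_al'2 by (simp add: d_c_left)
  let ?P = "(al' X M M \<boxtimes>\<^bsub>V\<^esub> ?i M) \<bullet> al' X (M \<otimes>\<^bsub>V\<^esub> M) M"
  have dd: "(d_arrow \<boxtimes>\<^bsub>V\<^esub> ?i M) \<bullet> d_arrow = al' M M M \<bullet> (?i M \<boxtimes>\<^bsub>V\<^esub> d_arrow) \<bullet> d_arrow"
    by (simp flip: d_coassoc)
  have "fmap G (comult_at X) \<bullet> comult_at X
      = (al' X M M \<boxtimes>\<^bsub>V\<^esub> ?i M) \<bullet> (((?i X \<boxtimes>\<^bsub>V\<^esub> d_arrow) \<boxtimes>\<^bsub>V\<^esub> ?i M) \<bullet> al' X M M) \<bullet> (?i X \<boxtimes>\<^bsub>V\<^esub> d_arrow)"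
    by (simp add: comult_at_def)
  also have "((?i X \<boxtimes>\<^bsub>V\<^esub> d_arrow) \<boxtimes>\<^bsub>V\<^esub> ?i M) \<bullet> al' X M M = al' X (M \<otimes>\<^bsub>V\<^esub> M) M \<bullet> (?i X \<boxtimes>\<^bsub>V\<^esub> (d_arrow \<boxtimes>\<^bsub>V\<^esub> ?i M))"
    using al'_nat [of "?i X" d_arrow "?i M"] by simp
  also have "(al' X M M \<boxtimes>\<^bsub>V\<^esub> ?i M) \<bullet> (al' X (M \<otimes>\<^bsub>V\<^esub> M) M \<bullet> (?i X \<boxtimes>\<^bsub>V\<^esub> (d_arrow \<boxtimes>\<^bsub>V\<^esub> ?i M))) \<bullet> (?i X \<boxtimes>\<^bsub>V\<^esub> d_arrow)
      = ?P \<bullet> (?i X \<boxtimes>\<^bsub>V\<^esub> ((d_arrow \<boxtimes>\<^bsub>V\<^esub> ?i M) \<bullet> d_arrow))"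
    by simp
  also have "\<dots> = (?P \<bullet> (?i X \<boxtimes>\<^bsub>V\<^esub> al' M M M)) \<bullet> (?i X \<boxtimes>\<^bsub>V\<^esub> ((?i M \<boxtimes>\<^bsub>V\<^esub> d_arrow) \<bullet> d_arrow))"
    unfolding dd by simp
  \<comment> \<open>The pentagon for inverse associators. Composing both sides with the invertible
    \<open>?a\<close> reduces it to the pentagon itself.\<close>
  also have "?P \<bullet> (?i X \<boxtimes>\<^bsub>V\<^esub> al' M M M) = al' (X \<otimes>\<^bsub>V\<^esub> M) M M \<bullet> al' X M (M \<otimes>\<^bsub>V\<^esub> M)"
  proof (rule iso_right_cancel)
    let ?a = "al X M (M \<otimes>\<^bsub>V\<^esub> M) \<bullet> al (X \<otimes>\<^bsub>V\<^esub> M) M M"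
    show "inverse_arrows ?a (al' (X \<otimes>\<^bsub>V\<^esub> M) M M \<bullet> al' X M (M \<otimes>\<^bsub>V\<^esub> M))"
      by (intro inverse_arrows_comp al_inverse) simp_all
    have "(?P \<bullet> (?i X \<boxtimes>\<^bsub>V\<^esub> al' M M M)) \<bullet> ?a
      = (?P \<bullet> (?i X \<boxtimes>\<^bsub>V\<^esub> al' M M M)) \<bullet> ((?i X \<boxtimes>\<^bsub>V\<^esub> al M M M) \<bullet> al X (M \<otimes>\<^bsub>V\<^esub> M) M \<bullet> (al X M M \<boxtimes>\<^bsub>V\<^esub> ?i M))"
      by (subst pentagon_arrow) simp_all
    then show "(?P \<bullet> (?i X \<boxtimes>\<^bsub>V\<^esub> al' M M M)) \<bullet> ?a = (al' (X \<otimes>\<^bsub>V\<^esub> M) M M \<bullet> al' X M (M \<otimes>\<^bsub>V\<^esub> M)) \<bullet> ?a"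
      by simp
  qed simp_all
  also have "(al' (X \<otimes>\<^bsub>V\<^esub> M) M M \<bullet> al' X M (M \<otimes>\<^bsub>V\<^esub> M)) \<bullet> (?i X \<boxtimes>\<^bsub>V\<^esub> ((?i M \<boxtimes>\<^bsub>V\<^esub> d_arrow) \<bullet> d_arrow))
      = al' (X \<otimes>\<^bsub>V\<^esub> M) M M \<bullet> (al' X M (M \<otimes>\<^bsub>V\<^esub> M) \<bullet> (?i X \<boxtimes>\<^bsub>V\<^esub> (?i M \<boxtimes>\<^bsub>V\<^esub> d_arrow))) \<bullet> (?i X \<boxtimes>\<^bsub>V\<^esub> d_arrow)"
    by simp
  also have "al' X M (M \<otimes>\<^bsub>V\<^esub> M) \<bullet> (?i X \<boxtimes>\<^bsub>V\<^esub> (?i M \<boxtimes>\<^bsub>V\<^esub> d_arrow)) = ((?i X \<boxtimes>\<^bsub>V\<^esub> ?i M) \<boxtimes>\<^bsub>V\<^esub> d_arrow) \<bullet> al' X M M"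
    using al'_nat [of "?i X" "?i M" d_arrow] by simp
  finally show "fmap G (comult_at X) \<bullet> comult_at X = comult_at (fob G X) \<bullet> comult_at X"
    by (simp add: comult_at_def)
qed

end

section \<open>Modules and comodules\<close>

text \<open>Modules, comodules and Hopf modules are all structured objects \<open>P\<close> over an
  object \<open>V P\<close>, with those morphisms of the base that respect the structure, as
  expressed by \<open>R\<close>. What differs is the closure of \<open>R\<close> under identities
  and composites.\<close>

lemma (in category) concrete_category:
  assumes Comp: "Comp H = Comp C"
    and Id: "\<And>P. P \<in> Ob H \<Longrightarrow> Id H P = Id C (V P)"
    and V: "\<And>P. P \<in> Ob H \<Longrightarrow> V P \<in> Ob C"
    and Hom: "\<And>P P' f. f \<in> Hom H P P' \<longleftrightarrow>
      P \<in> Ob H \<and> P' \<in> Ob H \<and> f \<in> Hom C (V P) (V P') \<and> R P P' (Arr (V P) f (V P'))"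
    and R_id: "\<And>P. P \<in> Ob H \<Longrightarrow> R P P (id_arrow C (V P))"
    and R_comp: "\<And>P P' P'' f g. \<lbrakk>P \<in> Ob H; P' \<in> Ob H; P'' \<in> Ob H; arrow C f; arrow C g;
      src f = V P; trg f = V P'; src g = V P'; trg g = V P''; R P P' f; R P' P'' g\<rbrakk> \<Longrightarrow> R P P'' (g \<bullet> f)"
  shows "category H"
proof
  fix f P P' assume "f \<in> Hom H P P'"
  then show "P \<in> Ob H \<and> P' \<in> Ob H" using Hom by blast
  show "Id H P' \<cdot>\<^bsub>H\<^esub> f = f" "f \<cdot>\<^bsub>H\<^esub> Id H P = f"
    using \<open>f \<in> Hom H P P'\<close> unfolding Hom Comp by (auto simp: Id intro: Id_left Id_right)
next
  fix P assume P: "P \<in> Ob H"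
  show "Id H P \<in> Hom H P P"
    using P Id_Hom [OF V [OF P]] R_id [OF P] unfolding Hom by (simp add: Id id_arrow_def)
next
  fix f g P P' P'' assume f: "f \<in> Hom H P P'" and g: "g \<in> Hom H P' P''"
  show "g \<cdot>\<^bsub>H\<^esub> f \<in> Hom H P P''"
    using f g R_comp [of P P' P'' "Arr (V P) f (V P')" "Arr (V P') g (V P'')"] Comp_Hom
    unfolding Hom Comp by (auto simp: comp_triple)
next
  fix f g h P P' P'' P'''
  assume "f \<in> Hom H P P'" "g \<in> Hom H P' P''" "h \<in> Hom H P'' P'''"
  then show "(h \<cdot>\<^bsub>H\<^esub> g) \<cdot>\<^bsub>H\<^esub> f = h \<cdot>\<^bsub>H\<^esub> (g \<cdot>\<^bsub>H\<^esub> f)"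
    unfolding Hom Comp by (blast intro: Comp_assoc)
qed

text \<open>The type of the second component is left open so that the same forgetful map serves Hopf
  modules, where that component is a pair of action and coaction.\<close>

definition base :: "('o \<times> 'n, 'm) arrow \<Rightarrow> ('o, 'm) arrow" where
  "base f = Arr (fst (src f)) (mor f) (fst (trg f))"

lemma base_sel [simp]: "src (base f) = fst (src f)" "mor (base f) = mor f" "trg (base f) = fst (trg f)"
  by (simp_all add: base_def)

lemma forget_simps [simp]: "fob forget P = fst P" "fmap forget f = base f"
  by (simp_all add: forget_def fmap_def base_def)

lemma base_inject: "\<lbrakk>base f = base g; src f = src g; trg f = trg g\<rbrakk> \<Longrightarrow> f = g"
  by (metis arrow.expand base_sel(2))

section \<open>Modules over a monoid\<close>

context monoid_object
begin

abbreviation "Mod \<equiv> modules C V M m e"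
abbreviation "free \<equiv> free_module C V M m"

definition act :: "'o \<times> 'm \<Rightarrow> ('o, 'm) arrow" where
  "act P = Arr (fst P \<otimes>\<^bsub>V\<^esub> M) (snd P) (fst P)"

lemma act_sel [simp]: "src (act P) = fst P \<otimes>\<^bsub>V\<^esub> M" "trg (act P) = fst P" "mor (act P) = snd P"
  by (simp_all add: act_def)

text \<open>The definition states the unit law against \<open>runit\<close>, whereas
  \<open>unit_at\<close> contains its inverse; the work lies in moving that isomorphism across. The
  associativity laws coincide after unfolding.\<close>

lemma is_module_iff: "is_module C V M m e X h \<longleftrightarrow> S.algebra (act (X, h))"
proof (cases "X \<in> Ob C \<and> arrow C (act (X, h))")
  case True
  let ?h = "act (X, h)"
  have [simp]: "X \<in> Ob C" "arrow C ?h" "h \<in> Hom C (X \<otimes>\<^bsub>V\<^esub> M) X"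
    using True by (simp_all add: act_def)
  have "?h \<bullet> unit_at X = id_arrow C X \<longleftrightarrow> ?h \<bullet> (id_arrow C X \<boxtimes>\<^bsub>V\<^esub> e_arrow) = ru X"
  proof
    assume "?h \<bullet> unit_at X = id_arrow C X"
    then have "(?h \<bullet> unit_at X) \<bullet> ru X = ru X" by simp
    then show "?h \<bullet> (id_arrow C X \<boxtimes>\<^bsub>V\<^esub> e_arrow) = ru X" by (simp add: unit_at_def)
  next
    assume "?h \<bullet> (id_arrow C X \<boxtimes>\<^bsub>V\<^esub> e_arrow) = ru X"
    then show "?h \<bullet> unit_at X = id_arrow C X"
      unfolding unit_at_def by (subst reassoc [where k = "ru X"]) simp_all
  qed
  also have "\<dots> \<longleftrightarrow> h \<cdot> (Id C X \<otimes>\<^sub>m\<^bsub>V\<^esub> e) = runit V X"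
    by (simp add: act_def tensor_arrow_def id_arrow_def comp_arrow_def e_arrow_def ru_def)
  finally show ?thesis
    using True
    by (auto simp: is_module_def S.algebra_def)
      (simp_all add: act_def tensor_arrow_def id_arrow_def comp_arrow_def mult_at_def m_arrow_def al_def)
next
  case False
  then show ?thesis
    using Hom_Ob [of h "X \<otimes>\<^bsub>V\<^esub> M" X] by (auto simp: is_module_def act_def dest!: S.algebraD(1))
qed

lemma modules_Ob: "P \<in> Ob Mod \<longleftrightarrow> S.algebra (act P)"
  by (cases P) (simp add: modules_def is_module_iff)

lemma modules_base [simp]: "base (g \<bullet>\<^bsub>Mod\<^esub> f) = base g \<bullet> base f"
    "base (id_arrow Mod P) = id_arrow C (fst P)"
  by (simp_all add: base_def comp_arrow_def id_arrow_def modules_def split: prod.split)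

lemma modules_Hom: "f \<in> Hom Mod P P' \<longleftrightarrow> P \<in> Ob Mod \<and> P' \<in> Ob Mod \<and> f \<in> Hom C (fst P) (fst P') \<and>
    Arr (fst P) f (fst P') \<bullet> act P = act P' \<bullet> fmap S (Arr (fst P) f (fst P'))"
  by (cases P; cases P')
    (auto simp: modules_def module_mor_def act_def comp_triple tensor_arrow_def id_arrow_def)

lemma modules_arrow: "arrow Mod f \<longleftrightarrow> src f \<in> Ob Mod \<and> trg f \<in> Ob Mod \<and> arrow C (base f) \<and>
    base f \<bullet> act (src f) = act (trg f) \<bullet> fmap S (base f)"
  by (simp add: arrow_def [of Mod] modules_Hom base_def)

lemma module_act [simp]: "P \<in> Ob Mod \<Longrightarrow> arrow C (act P)" "P \<in> Ob Mod \<Longrightarrow> fst P \<in> Ob C"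
  using S.algebraD(1) arrow_trg [of "act P"] by (auto simp: modules_Ob)

lemma modules_category: "category Mod"
proof (rule concrete_category [where V = fst and R = "\<lambda>P P' f. f \<bullet> act P = act P' \<bullet> fmap S f"])
  show "Comp Mod = Comp C" "\<And>P. Id Mod P = Id C (fst P)" by (auto simp: modules_def)
  show "f \<in> Hom Mod P P' \<longleftrightarrow> P \<in> Ob Mod \<and> P' \<in> Ob Mod \<and> f \<in> Hom C (fst P) (fst P') \<and>
    Arr (fst P) f (fst P') \<bullet> act P = act P' \<bullet> fmap S (Arr (fst P) f (fst P'))" for P P' f
    by (rule modules_Hom)
next
  fix P P' P'' f g
  assume [simp]: "P \<in> Ob Mod" "P' \<in> Ob Mod" "P'' \<in> Ob Mod" "arrow C f" "arrow C g"
      "src f = fst P" "trg f = fst P'" "src g = fst P'" "trg g = fst P''"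
    and f: "f \<bullet> act P = act P' \<bullet> fmap S f" and g: "g \<bullet> act P' = act P'' \<bullet> fmap S g"
  have "(g \<bullet> f) \<bullet> act P = (g \<bullet> act P') \<bullet> fmap S f" using f by simp
  then show "(g \<bullet> f) \<bullet> act P = act P'' \<bullet> fmap S (g \<bullet> f)" unfolding g by simp
qed simp_all

lemma free_module_simps [simp]:
  assumes "X \<in> Ob C"
  shows "fst (fob free X) = X \<otimes>\<^bsub>V\<^esub> M"
    "act (fob free X) = mult_at X"
    "fob free X \<in> Ob Mod"
proof -
  show *: "act (fob free X) = mult_at X"
    by (simp add: act_def mult_at_def free_module_def comp_arrow_def m_arrow_def al_def id_arrow_def)
  show "fst (fob free X) = X \<otimes>\<^bsub>V\<^esub> M" by (simp add: free_module_def)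
  show "fob free X \<in> Ob Mod"
    unfolding modules_Ob * using assms by (rule S.free_algebra)
qed

lemma free_module_base [simp]: "base (fmap free f) = fmap S f"
  by (simp add: base_def free_module_def tensor_arrow_def)

lemma free_module_functor: "is_functor C Mod free"
  unfolding is_functor_iff
  using S.n_nat by (auto intro!: base_inject simp: modules_arrow)

lemma forget_functor: "is_functor Mod C forget"
  unfolding is_functor_iff by (auto simp: modules_arrow)

text \<open>The counit at \<open>P\<close> is the action, which associativity makes a map out of the
  free module. The triangle identities are a unit law of the monad and the unit law of the
  module.\<close>

lemma free_forget_adjunction: "adjunction C Mod free forget (free_module_unit C V e) snd"
proof (rule adjunctionI [where e = unit_at
      and d = "\<lambda>P. Arr (fob free (fst P)) (snd P) P"])
  let ?d = "\<lambda>P. Arr (fob free (fst P)) (snd P) P"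
  interpret Mod: category Mod by (rule modules_category)
  have d: "base (?d P) = act P" for P by (simp add: base_def act_def free_module_def)
  show "category C" "category Mod" by unfold_locales
  show "is_functor C Mod free" "is_functor Mod C forget"
    by (rule free_module_functor forget_functor)+
  show "unit_at X = Arr X (free_module_unit C V e X) (fob forget (fob free X))" for X
    by (simp add: unit_at_def free_module_unit_def comp_arrow_def id_arrow_def e_arrow_def ru'_def free_module_def)
  show "?d Y = Arr (fob free (fob forget Y)) (snd Y) Y" for Y
    by simp
  show "arrow C (unit_at X)" if "X \<in> Ob C" for X using that by simp
  show d_arrow: "arrow Mod (?d P)" if P: "P \<in> Ob Mod" for P
    unfolding modules_arrow d using P S.algebraD [of "act P"] S.free_algebra [of "fst P"] by (simp add: modules_Ob)
  show "unit_at (trg f) \<bullet> f = fmap forget (fmap free f) \<bullet> unit_at (src f)" if "arrow C f" for f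
    using S.u_nat [OF that] by simp
  show "?d (trg f) \<bullet>\<^bsub>Mod\<^esub> fmap free (fmap forget f) = f \<bullet>\<^bsub>Mod\<^esub> ?d (src f)" if f: "arrow Mod f" for f
    using f [unfolded modules_arrow] by (intro base_inject) (auto simp: d)
  show "?d (fob free X) \<bullet>\<^bsub>Mod\<^esub> fmap free (unit_at X)
      = id_arrow Mod (fob free X)" if "X \<in> Ob C" for X
    using that S.n_unit(2) [of X] d [of "fob free X"] by (intro base_inject) auto
  show "fmap forget (?d Y) \<bullet> unit_at (fob forget Y) = id_arrow C (fob forget Y)" if "Y \<in> Ob Mod" for Y
    using that S.algebraD(4) [of "act Y"] by (simp add: modules_Ob d)
qed

text \<open>Split the underlying idempotent in the base and transport the action along
  \<open>r\<close> and \<open>i\<close>. Linearity of \<open>p\<close> makes the result a module and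
  both maps linear.\<close>

lemma modules_cauchy_complete:
  assumes "cauchy_complete C"
  shows "cauchy_complete Mod"
  unfolding cauchy_complete_def
proof (intro allI impI)
  interpret Mod: category Mod by (rule modules_category)
  fix P f assume f: "f \<in> Hom Mod P P \<and> f \<cdot>\<^bsub>Mod\<^esub> f = f"
  define p where "p = base (Arr P f P)"
  let ?h = "act P" and ?X = "fst P"
  have P [simp]: "P \<in> Ob Mod" and p [simp]: "arrow C p" "src p = ?X" "trg p = ?X"
    and p_lin: "p \<bullet> ?h = ?h \<bullet> fmap S p"
    using f by (auto simp: modules_Hom base_def p_def)
  have "Comp Mod = Comp C" by (simp add: modules_def)
  then have "p \<bullet> p = p" using f by (simp add: p_def base_def comp_triple)
  then obtain r i where ri [simp]: "arrow C r" "arrow C i" "src r = ?X" "src i = trg r" "trg i = ?X"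
    and r_i: "r \<bullet> i = id_arrow C (trg r)" and i_r: "i \<bullet> r = p"
    using cauchy_completeE [OF assms p(1)] p(2,3) by metis
  define Y where "Y = trg r"
  have Y [simp]: "Y \<in> Ob C" "trg r = Y" by (simp_all add: Y_def)
  have r_p: "r \<bullet> p = r" unfolding i_r [symmetric] by (simp add: reassoc [OF r_i])
  have p_i: "p \<bullet> i = i" unfolding i_r [symmetric] by (simp add: r_i)
  have h: "?h \<bullet> fmap S ?h = ?h \<bullet> mult_at ?X" "?h \<bullet> unit_at ?X = id_arrow C ?X"
    using S.algebraD [of ?h] P by (simp_all add: modules_Ob)
  define k where "k = r \<bullet> ?h \<bullet> fmap S i"
  have k [simp]: "arrow C k" "src k = Y \<otimes>\<^bsub>V\<^esub> M" "trg k = Y" by (simp_all add: k_def)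
  \<comment> \<open>Linearity moves \<open>p\<close> out of the argument of the action, where
    \<open>r\<close> absorbs it. This removes the inner \<open>i \<bullet> r\<close> when two copies
    of \<open>k\<close> are composed.\<close>
  have rh: "r \<bullet> ?h \<bullet> fmap S p = r \<bullet> ?h"
    unfolding p_lin [symmetric] by (simp add: reassoc [OF r_p])
  have "k \<bullet> fmap S k = (r \<bullet> ?h \<bullet> fmap S (i \<bullet> r)) \<bullet> fmap S ?h \<bullet> fmap S (fmap S i)"
    by (simp add: k_def)
  also have "\<dots> = r \<bullet> (?h \<bullet> fmap S ?h) \<bullet> fmap S (fmap S i)"
    unfolding i_r rh by simp
  also have "\<dots> = r \<bullet> ?h \<bullet> (mult_at (trg i) \<bullet> fmap S (fmap S i))"
    unfolding h(1) by simp
  also have "\<dots> = k \<bullet> mult_at Y"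
    by (subst S.n_nat) (simp_all add: k_def)
  finally have "k \<bullet> fmap S k = k \<bullet> mult_at Y" .
  moreover have "k \<bullet> unit_at Y = r \<bullet> (?h \<bullet> unit_at (trg i)) \<bullet> i"
    using S.u_nat [of i] by (simp add: k_def)
  then have "k \<bullet> unit_at Y = id_arrow C Y"
    by (simp add: h(2) r_i)
  ultimately have "S.algebra k" by (simp add: S.algebra_def)
  moreover have k_act: "act (Y, mor k) = k"
    unfolding act_def by (intro arrow.expand) simp
  ultimately have Q: "(Y, mor k) \<in> Ob Mod" by (simp add: modules_Ob)
  have "arrow Mod (Arr P (mor r) (Y, mor k))"
  proof -
    have "base (Arr P (mor r) (Y, mor k)) = r" unfolding base_def by (intro arrow.expand) simp
    moreover have "r \<bullet> ?h = k \<bullet> fmap S r"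
      using rh i_r by (simp add: k_def)
    ultimately show ?thesis unfolding modules_arrow using Q by (simp add: k_act)
  qed
  moreover have "arrow Mod (Arr (Y, mor k) (mor i) P)"
  proof -
    have "base (Arr (Y, mor k) (mor i) P) = i" unfolding base_def by (intro arrow.expand) simp
    moreover have "i \<bullet> k = (p \<bullet> ?h) \<bullet> fmap S i"
      by (simp add: k_def reassoc [OF i_r])
    then have "i \<bullet> k = ?h \<bullet> fmap S i"
      unfolding p_lin by (simp add: p_i)
    ultimately show ?thesis unfolding modules_arrow using Q by (simp add: k_act)
  qed
  moreover have "mor r \<cdot> mor i = Id C Y" "mor i \<cdot> mor r = f"
    using arg_cong [OF r_i, of mor] arg_cong [OF i_r, of mor] by (simp_all add: p_def)
  ultimately show "\<exists>Y r s. r \<in> Hom Mod P Y \<and> s \<in> Hom Mod Y P \<and> r \<cdot>\<^bsub>Mod\<^esub> s = Id Mod Y \<and> s \<cdot>\<^bsub>Mod\<^esub> r = f"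
    by (intro exI [of _ "(Y, mor k)"] exI [of _ "mor r"] exI [of _ "mor i"])
      (simp add: \<open>Comp Mod = Comp C\<close>, simp add: modules_def)
qed

end

section \<open>Comodules over a comonoid\<close>

context comonoid_object
begin

abbreviation "Comod \<equiv> comodules C V M \<delta> \<epsilon>"
abbreviation "cofree \<equiv> cofree_comodule C V M \<delta>"

definition coact :: "'o \<times> 'm \<Rightarrow> ('o, 'm) arrow" where
  "coact P = Arr (fst P) (snd P) (fst P \<otimes>\<^bsub>V\<^esub> M)"

lemma coact_sel [simp]: "trg (coact P) = fst P \<otimes>\<^bsub>V\<^esub> M" "src (coact P) = fst P" "mor (coact P) = snd P"
  by (simp_all add: coact_def)

text \<open>Here coassociativity is the law to be moved across an isomorphism: the definition uses
  \<open>assoc\<close>, while \<open>comult_at\<close> contains its inverse. The counit law matches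
  directly.\<close>

lemma is_comodule_iff: "is_comodule C V M \<delta> \<epsilon> X \<theta> \<longleftrightarrow> G.coalgebra (coact (X, \<theta>))"
proof (cases "X \<in> Ob C \<and> arrow C (coact (X, \<theta>))")
  case True
  let ?h = "coact (X, \<theta>)"
  have [simp]: "X \<in> Ob C" "arrow C ?h" "\<theta> \<in> Hom C X (X \<otimes>\<^bsub>V\<^esub> M)"
    using True by (simp_all add: coact_def)
  have "fmap G ?h \<bullet> ?h = comult_at X \<bullet> ?h
    \<longleftrightarrow> al X M M \<bullet> fmap G ?h \<bullet> ?h = (id_arrow C X \<boxtimes>\<^bsub>V\<^esub> d_arrow) \<bullet> ?h"
  proof
    assume "fmap G ?h \<bullet> ?h = comult_at X \<bullet> ?h"
    then show "al X M M \<bullet> fmap G ?h \<bullet> ?h = (id_arrow C X \<boxtimes>\<^bsub>V\<^esub> d_arrow) \<bullet> ?h"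
      by (simp add: comult_at_def)
  next
    assume "al X M M \<bullet> fmap G ?h \<bullet> ?h = (id_arrow C X \<boxtimes>\<^bsub>V\<^esub> d_arrow) \<bullet> ?h"
    then have "al' X M M \<bullet> al X M M \<bullet> fmap G ?h \<bullet> ?h = comult_at X \<bullet> ?h"
      by (simp add: comult_at_def del: constraint_cancel)
    then show "fmap G ?h \<bullet> ?h = comult_at X \<bullet> ?h" by simp
  qed
  also have "\<dots> \<longleftrightarrow> assoc V X M M \<cdot> (\<theta> \<otimes>\<^sub>m\<^bsub>V\<^esub> Id C M) \<cdot> \<theta> = (Id C X \<otimes>\<^sub>m\<^bsub>V\<^esub> \<delta>) \<cdot> \<theta>"
    by (simp add: coact_def tensor_arrow_def id_arrow_def comp_arrow_def d_arrow_def al_def)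
  finally have 1: "fmap G ?h \<bullet> ?h = comult_at X \<bullet> ?h
    \<longleftrightarrow> assoc V X M M \<cdot> (\<theta> \<otimes>\<^sub>m\<^bsub>V\<^esub> Id C M) \<cdot> \<theta> = (Id C X \<otimes>\<^sub>m\<^bsub>V\<^esub> \<delta>) \<cdot> \<theta>" .
  have "counit_at X \<bullet> ?h = id_arrow C X \<longleftrightarrow> ru X \<bullet> (id_arrow C X \<boxtimes>\<^bsub>V\<^esub> c_arrow) \<bullet> ?h = id_arrow C X"
    by (simp add: counit_at_def)
  also have "\<dots> \<longleftrightarrow> runit V X \<cdot> (Id C X \<otimes>\<^sub>m\<^bsub>V\<^esub> \<epsilon>) \<cdot> \<theta> = Id C X"
    by (simp add: coact_def tensor_arrow_def id_arrow_def comp_arrow_def c_arrow_def ru_def)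
  finally show ?thesis
    using 1 by (simp add: is_comodule_def G.coalgebra_def)
next
  case False
  then show ?thesis
    using Hom_Ob [of \<theta> X "X \<otimes>\<^bsub>V\<^esub> M"] by (auto simp: is_comodule_def coact_def dest!: G.coalgebraD(1))
qed

lemma comodules_Ob: "P \<in> Ob Comod \<longleftrightarrow> G.coalgebra (coact P)"
  by (cases P) (simp add: comodules_def is_comodule_iff)

lemma comodules_base [simp]: "base (g \<bullet>\<^bsub>Comod\<^esub> f) = base g \<bullet> base f"
    "base (id_arrow Comod P) = id_arrow C (fst P)"
  by (simp_all add: base_def comp_arrow_def id_arrow_def comodules_def split: prod.split)

lemma comodules_Hom: "f \<in> Hom Comod P P' \<longleftrightarrow> P \<in> Ob Comod \<and> P' \<in> Ob Comod \<and> f \<in> Hom C (fst P) (fst P') \<and>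
    fmap G (Arr (fst P) f (fst P')) \<bullet> coact P = coact P' \<bullet> Arr (fst P) f (fst P')"
  by (cases P; cases P')
    (auto simp: comodules_def comodule_mor_def coact_def comp_triple tensor_arrow_def id_arrow_def)

lemma comodules_arrow: "arrow Comod f \<longleftrightarrow> src f \<in> Ob Comod \<and> trg f \<in> Ob Comod \<and> arrow C (base f) \<and>
    fmap G (base f) \<bullet> coact (src f) = coact (trg f) \<bullet> base f"
  by (simp add: arrow_def [of Comod] comodules_Hom base_def)

lemma comodule_coact [simp]: "P \<in> Ob Comod \<Longrightarrow> arrow C (coact P)" "P \<in> Ob Comod \<Longrightarrow> fst P \<in> Ob C"
  using G.coalgebraD(1) arrow_src [of "coact P"] by (auto simp: comodules_Ob)

lemma comodules_category: "category Comod"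
proof (rule concrete_category [where V = fst and R = "\<lambda>P P' f. fmap G f \<bullet> coact P = coact P' \<bullet> f"])
  show "Comp Comod = Comp C" "\<And>P. Id Comod P = Id C (fst P)" by (auto simp: comodules_def)
  show "f \<in> Hom Comod P P' \<longleftrightarrow> P \<in> Ob Comod \<and> P' \<in> Ob Comod \<and> f \<in> Hom C (fst P) (fst P') \<and>
    fmap G (Arr (fst P) f (fst P')) \<bullet> coact P = coact P' \<bullet> Arr (fst P) f (fst P')" for P P' f
    by (rule comodules_Hom)
next
  fix P P' P'' f g
  assume [simp]: "P \<in> Ob Comod" "P' \<in> Ob Comod" "P'' \<in> Ob Comod" "arrow C f" "arrow C g"
      "src f = fst P" "trg f = fst P'" "src g = fst P'" "trg g = fst P''"
    and f: "fmap G f \<bullet> coact P = coact P' \<bullet> f" and g: "fmap G g \<bullet> coact P' = coact P'' \<bullet> g"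
  have "fmap G (g \<bullet> f) \<bullet> coact P = fmap G g \<bullet> (fmap G f \<bullet> coact P)" by simp
  also have "\<dots> = (fmap G g \<bullet> coact P') \<bullet> f" unfolding f by simp
  finally show "fmap G (g \<bullet> f) \<bullet> coact P = coact P'' \<bullet> g \<bullet> f" unfolding g by simp
qed simp_all

lemma cofree_comodule_simps [simp]:
  assumes "X \<in> Ob C"
  shows "fst (fob cofree X) = X \<otimes>\<^bsub>V\<^esub> M"
    "coact (fob cofree X) = comult_at X"
    "fob cofree X \<in> Ob Comod"
proof -
  show *: "coact (fob cofree X) = comult_at X"
    by (simp add: coact_def comult_at_def cofree_comodule_def comp_arrow_def d_arrow_def al'_def id_arrow_def)
  show "fst (fob cofree X) = X \<otimes>\<^bsub>V\<^esub> M" by (simp add: cofree_comodule_def)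
  show "fob cofree X \<in> Ob Comod"
    unfolding comodules_Ob * using assms by (rule G.cofree_coalgebra)
qed

lemma cofree_comodule_base [simp]: "base (fmap cofree f) = fmap G f"
  by (simp add: base_def cofree_comodule_def tensor_arrow_def)

lemma cofree_comodule_functor: "is_functor C Comod cofree"
  unfolding is_functor_iff
  using G.d_nat by (auto intro!: base_inject simp: comodules_arrow)

lemma forget_functor: "is_functor Comod C forget"
  unfolding is_functor_iff by (auto simp: comodules_arrow)

lemma forget_cofree_adjunction:
  "adjunction Comod C forget cofree snd (cofree_comodule_counit C V \<epsilon>)"
proof (rule adjunctionI [where d = counit_at
      and e = "\<lambda>P. Arr P (snd P) (fob cofree (fst P))"])
  let ?e = "\<lambda>P. Arr P (snd P) (fob cofree (fst P))"
  interpret Comod: category Comod by (rule comodules_category)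
  have e: "base (?e P) = coact P" for P by (simp add: base_def coact_def cofree_comodule_def)
  show "category C" "category Comod" by unfold_locales
  show "is_functor C Comod cofree" "is_functor Comod C forget"
    by (rule cofree_comodule_functor forget_functor)+
  show "counit_at X = Arr (fob forget (fob cofree X)) (cofree_comodule_counit C V \<epsilon> X) X" for X
    by (simp add: counit_at_def cofree_comodule_counit_def comp_arrow_def id_arrow_def c_arrow_def ru_def cofree_comodule_def)
  show "?e P = Arr P (snd P) (fob cofree (fob forget P))" for P
    by simp
  show "arrow C (counit_at X)" if "X \<in> Ob C" for X using that by simp
  show "arrow Comod (?e P)" if P: "P \<in> Ob Comod" for P
    unfolding comodules_arrow e using P G.coalgebraD [of "coact P"] G.cofree_coalgebra [of "fst P"]
    by (simp add: comodules_Ob)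
  show "counit_at (trg f) \<bullet> fmap forget (fmap cofree f) = f \<bullet> counit_at (src f)" if "arrow C f" for f
    using G.c_nat [OF that] by simp
  show "?e (trg f) \<bullet>\<^bsub>Comod\<^esub> f = fmap cofree (fmap forget f) \<bullet>\<^bsub>Comod\<^esub> ?e (src f)" if f: "arrow Comod f" for f
    using f [unfolded comodules_arrow] by (intro base_inject) (auto simp: e)
  show "fmap cofree (counit_at X) \<bullet>\<^bsub>Comod\<^esub> ?e (fob cofree X)
      = id_arrow Comod (fob cofree X)" if "X \<in> Ob C" for X
    using that G.d_counit(2) [of X] e [of "fob cofree X"] by (intro base_inject) auto
  show "counit_at (fob forget P) \<bullet> fmap forget (?e P) = id_arrow C (fob forget P)" if "P \<in> Ob Comod" for P
    using that G.coalgebraD(4) [of "coact P"] by (simp add: comodules_Ob e)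
qed

end

section \<open>Duoidal categories\<close>

abbreviation circ_arrow ("(_ \<odot>\<^sub>a\<index> _)" [71, 71] 70) where
  "f \<odot>\<^sub>a\<^bsub>D\<^esub> g \<equiv> f \<boxtimes>\<^bsub>circ D\<^esub> g"

abbreviation star_arrow ("(_ \<ast>\<^sub>a\<index> _)" [71, 71] 70) where
  "f \<ast>\<^sub>a\<^bsub>D\<^esub> g \<equiv> f \<boxtimes>\<^bsub>star D\<^esub> g"

context duoidal
begin

sublocale circ: monoidal D "circ D" by (rule circ_monoidal)
sublocale star: monoidal D "star D" by (rule star_monoidal)
sublocale J: monoid_object D "circ D" "\<J>" "mu D" "tau D"
  by unfold_locales (rule J_monoid)
sublocale I: comonoid_object D "star D" "\<I>" "Delta D" "tau D"
  by unfold_locales (rule I_comonoid)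

definition "ze W X Y Z = Arr ((W \<ast> X) \<odot> (Y \<ast> Z)) (zeta D W X Y Z) ((W \<odot> Y) \<ast> (X \<odot> Z))"

lemma ze_sel [simp]: "src (ze W X Y Z) = (W \<ast> X) \<odot> (Y \<ast> Z)" "trg (ze W X Y Z) = (W \<odot> Y) \<ast> (X \<odot> Z)"
  by (simp_all add: ze_def)

lemma ze_arrow [simp]: "\<lbrakk>W \<in> Ob D; X \<in> Ob D; Y \<in> Ob D; Z \<in> Ob D\<rbrakk> \<Longrightarrow> arrow D (ze W X Y Z)"
  using zeta_Hom by (simp add: ze_def)

lemma ze_nat: "\<lbrakk>arrow D f; arrow D g; arrow D h; arrow D k\<rbrakk> \<Longrightarrow>
    ze (trg f) (trg g) (trg h) (trg k) \<bullet> ((f \<ast>\<^sub>a g) \<odot>\<^sub>a (h \<ast>\<^sub>a k))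
    = ((f \<odot>\<^sub>a h) \<ast>\<^sub>a (g \<odot>\<^sub>a k)) \<bullet> ze (src f) (src g) (src h) (src k)"
  using zeta_nat [of "mor f" "src f" "trg f" "mor g" "src g" "trg g" "mor h" "src h" "trg h" "mor k" "src k" "trg k"]
  by (simp add: ze_def tensor_arrow_def comp_triple arrow_def)

lemma ze_circ_assoc: "\<lbrakk>U \<in> Ob D; V \<in> Ob D; W \<in> Ob D; X \<in> Ob D; Y \<in> Ob D; Z \<in> Ob D\<rbrakk> \<Longrightarrow>
    (circ.al U W Y \<ast>\<^sub>a circ.al V X Z) \<bullet> ze (U \<odot> W) (V \<odot> X) Y Z \<bullet> (ze U V W X \<odot>\<^sub>a id_arrow D (Y \<ast> Z))
    = ze U V (W \<odot> Y) (X \<odot> Z) \<bullet> (id_arrow D (U \<ast> V) \<odot>\<^sub>a ze W X Y Z) \<bullet> circ.al (U \<ast> V) (W \<ast> X) (Y \<ast> Z)"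
  using zeta_circ_assoc [of U V W X Y Z]
  by (simp add: ze_def tensor_arrow_def comp_arrow_def id_arrow_def circ.al_def)

lemma ze_star_assoc: "\<lbrakk>U \<in> Ob D; V \<in> Ob D; W \<in> Ob D; X \<in> Ob D; Y \<in> Ob D; Z \<in> Ob D\<rbrakk> \<Longrightarrow>
    star.al (U \<odot> X) (V \<odot> Y) (W \<odot> Z) \<bullet> (ze U V X Y \<ast>\<^sub>a id_arrow D (W \<odot> Z)) \<bullet> ze (U \<ast> V) W (X \<ast> Y) Z
    = (id_arrow D (U \<odot> X) \<ast>\<^sub>a ze V W Y Z) \<bullet> ze U (V \<ast> W) X (Y \<ast> Z) \<bullet> (star.al U V W \<odot>\<^sub>a star.al X Y Z)"
  using zeta_star_assoc [of U V W X Y Z]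
  by (simp add: ze_def tensor_arrow_def comp_arrow_def id_arrow_def star.al_def)

lemma Delta_right_arrow: "\<lbrakk>X \<in> Ob D; Y \<in> Ob D\<rbrakk> \<Longrightarrow>
    (circ.ru X \<ast>\<^sub>a circ.ru Y) \<bullet> ze X Y \<I> \<I> \<bullet> (id_arrow D (X \<ast> Y) \<odot>\<^sub>a I.d_arrow) = circ.ru (X \<ast> Y)"
  using Delta_right [of X Y]
  by (simp add: ze_def tensor_arrow_def comp_arrow_def id_arrow_def circ.ru_def I.d_arrow_def)

lemma mu_right_arrow: "\<lbrakk>X \<in> Ob D; Y \<in> Ob D\<rbrakk> \<Longrightarrow>
    star.ru (X \<odot> Y) \<bullet> (id_arrow D (X \<odot> Y) \<ast>\<^sub>a J.m_arrow) \<bullet> ze X \<J> Y \<J> \<bullet> (star.ru' X \<odot>\<^sub>a star.ru' Y)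
    = id_arrow D (X \<odot> Y)"
  using mu_right [of X Y]
  by (simp add: ze_def tensor_arrow_def comp_arrow_def id_arrow_def star.ru_def star.ru'_def J.m_arrow_def)

text \<open>Stated for an arbitrary comonoid because it is applied both to \<open>A\<close> and to
  the unit object \<open>I\<close> of the first product.\<close>

lemma phi_J_adjunction:
  assumes "is_comonoid D (star D) K \<delta> \<epsilon>"
  shows "adjunction (comodules D (star D) K \<delta> \<epsilon>) (J_modules D)
    (adj_left D) (adj_right D K \<delta>) (adj_unit D K \<delta> \<epsilon>) (adj_counit D K \<delta> \<epsilon>)"
proof -
  interpret K: comonoid_object D "star D" K \<delta> \<epsilon>
    by unfold_locales (rule assms)
  show ?thesis
    unfolding adj_left_def adj_right_def adj_unit_def adj_counit_def J_modules_def phi_J_def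
    by (rule adjunction_compose [OF K.forget_cofree_adjunction J.free_forget_adjunction])
qed

end

section \<open>The mixed distributive law of a bimonoid\<close>

locale bimonoid_object = duoidal D for D :: "('o, 'm) duoidal_data" (structure) +
  fixes A :: 'o and m e \<delta> \<epsilon> :: 'm
  assumes bimonoid: "bimonoid D A m e \<delta> \<epsilon>"
begin

sublocale alg: monoid_object D "circ D" A m e
  using bimonoid by unfold_locales (simp add: bimonoid_def)
sublocale coalg: comonoid_object D "star D" A \<delta> \<epsilon>
  using bimonoid by unfold_locales (simp add: bimonoid_def)

lemma bimonoid_arrows:
  "coalg.d_arrow \<bullet> alg.m_arrow = (alg.m_arrow \<ast>\<^sub>a alg.m_arrow) \<bullet> ze A A A A \<bullet> (coalg.d_arrow \<odot>\<^sub>a coalg.d_arrow)"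
  "coalg.c_arrow \<bullet> alg.m_arrow = J.m_arrow \<bullet> (coalg.c_arrow \<odot>\<^sub>a coalg.c_arrow)"
  "coalg.d_arrow \<bullet> alg.e_arrow = (alg.e_arrow \<ast>\<^sub>a alg.e_arrow) \<bullet> I.d_arrow"
  "coalg.c_arrow \<bullet> alg.e_arrow = J.e_arrow"
  using bimonoid unfolding bimonoid_def
  by (simp_all add: coalg.d_arrow_def alg.m_arrow_def coalg.c_arrow_def alg.e_arrow_def J.m_arrow_def
      J.e_arrow_def I.d_arrow_def tensor_arrow_def comp_arrow_def ze_def)

definition law :: "'o \<Rightarrow> ('o, 'm) arrow" where
  "law X = (id_arrow D (X \<odot> A) \<ast>\<^sub>a alg.m_arrow) \<bullet> ze X A A A \<bullet> (id_arrow D (X \<ast> A) \<odot>\<^sub>a coalg.d_arrow)"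

lemma law_natural:
  assumes "arrow D f"
  shows "law (trg f) \<bullet> fmap alg.S (fmap coalg.G f) = fmap coalg.G (fmap alg.S f) \<bullet> law (src f)"
proof -
  let ?i = "id_arrow D"
  have "law (trg f) \<bullet> fmap alg.S (fmap coalg.G f)
    = (?i (trg f \<odot> A) \<ast>\<^sub>a alg.m_arrow) \<bullet> (ze (trg f) A A A \<bullet> ((f \<ast>\<^sub>a ?i A) \<odot>\<^sub>a (?i A \<ast>\<^sub>a ?i A)))
       \<bullet> (?i (src f \<ast> A) \<odot>\<^sub>a coalg.d_arrow)"
    using assms by (simp add: law_def)
  also have "ze (trg f) A A A \<bullet> ((f \<ast>\<^sub>a ?i A) \<odot>\<^sub>a (?i A \<ast>\<^sub>a ?i A))
    = ((f \<odot>\<^sub>a ?i A) \<ast>\<^sub>a (?i A \<odot>\<^sub>a ?i A)) \<bullet> ze (src f) A A A"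
    using assms ze_nat [of f "?i A" "?i A" "?i A"] by simp
  finally show ?thesis using assms by (simp add: law_def)
qed

text \<open>\<open>\<delta> \<cdot> e = (e \<ast> e) \<cdot> \<Delta>\<close> and naturality of
  \<open>\<zeta>\<close> reduce to \<open>\<zeta>\<close> at two copies of \<open>I\<close>, which
  the axiom on \<open>\<Delta>\<close> turns into unit constraints. The unit law of \<open>m\<close>
  then cancels in the second factor.\<close>

lemma law_unit:
  assumes [simp]: "X \<in> Ob D"
  shows "law X \<bullet> alg.unit_at (fob coalg.G X) = fmap coalg.G (alg.unit_at X)"
proof -
  let ?i = "id_arrow D" and ?e = "alg.e_arrow"
  have "(circ.ru' X \<ast>\<^sub>a circ.ru' A) \<bullet> ((circ.ru X \<ast>\<^sub>a circ.ru A) \<bullet> ze X A \<I> \<I> \<bullet> (?i (X \<ast> A) \<odot>\<^sub>a I.d_arrow))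
      = ze X A \<I> \<I> \<bullet> (?i (X \<ast> A) \<odot>\<^sub>a I.d_arrow)"
    by simp
  then have ze_Delta: "ze X A \<I> \<I> \<bullet> (?i (X \<ast> A) \<odot>\<^sub>a I.d_arrow)
      = (circ.ru' X \<ast>\<^sub>a circ.ru' A) \<bullet> circ.ru (X \<ast> A)"
    unfolding Delta_right_arrow [OF assms alg.M_Ob] by simp
  have "law X \<bullet> alg.unit_at (fob coalg.G X)
      = (?i (X \<odot> A) \<ast>\<^sub>a alg.m_arrow) \<bullet> ze X A A A \<bullet> (?i (X \<ast> A) \<odot>\<^sub>a (coalg.d_arrow \<bullet> ?e)) \<bullet> circ.ru' (X \<ast> A)"
    by (simp add: law_def alg.unit_at_def)
  also have "\<dots> = (?i (X \<odot> A) \<ast>\<^sub>a alg.m_arrow) \<bullet> (ze X A A A \<bullet> ((?i X \<ast>\<^sub>a ?i A) \<odot>\<^sub>a (?e \<ast>\<^sub>a ?e)))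
      \<bullet> (?i (X \<ast> A) \<odot>\<^sub>a I.d_arrow) \<bullet> circ.ru' (X \<ast> A)"
    unfolding bimonoid_arrows by simp
  also have "ze X A A A \<bullet> ((?i X \<ast>\<^sub>a ?i A) \<odot>\<^sub>a (?e \<ast>\<^sub>a ?e)) = ((?i X \<odot>\<^sub>a ?e) \<ast>\<^sub>a (?i A \<odot>\<^sub>a ?e)) \<bullet> ze X A \<I> \<I>"
    using ze_nat [of "?i X" "?i A" ?e ?e] by simp
  also have "(?i (X \<odot> A) \<ast>\<^sub>a alg.m_arrow) \<bullet> (((?i X \<odot>\<^sub>a ?e) \<ast>\<^sub>a (?i A \<odot>\<^sub>a ?e)) \<bullet> ze X A \<I> \<I>)
      \<bullet> (?i (X \<ast> A) \<odot>\<^sub>a I.d_arrow) \<bullet> circ.ru' (X \<ast> A)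
      = ((?i X \<odot>\<^sub>a ?e) \<ast>\<^sub>a circ.ru A) \<bullet> (ze X A \<I> \<I> \<bullet> (?i (X \<ast> A) \<odot>\<^sub>a I.d_arrow)) \<bullet> circ.ru' (X \<ast> A)"
    by (simp add: alg.m_e_right)
  finally show ?thesis unfolding ze_Delta by (simp add: alg.unit_at_def)
qed

text \<open>\<open>\<epsilon> \<cdot> m = \<mu> \<cdot> (\<epsilon> \<odot> \<epsilon>)\<close> and
  naturality of \<open>\<zeta>\<close> push \<open>\<epsilon>\<close> to the right, where the counit
  law of \<open>A\<close> makes one copy a unit constraint. What remains is the axiom on
  \<open>\<mu>\<close> with \<open>J\<close> on the right.\<close>

lemma law_counit:
  assumes [simp]: "X \<in> Ob D"
  shows "coalg.counit_at (fob alg.S X) \<bullet> law X = fmap alg.S (coalg.counit_at X)"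
proof -
  let ?i = "id_arrow D" and ?c = "coalg.c_arrow"
  have c: "(?i A \<ast>\<^sub>a ?c) \<bullet> coalg.d_arrow = star.ru' A"
    using arg_cong [OF coalg.d_c_right, of "\<lambda>f. star.ru' A \<bullet> f"] by simp
  have "coalg.counit_at (fob alg.S X) \<bullet> law X
      = star.ru (X \<odot> A) \<bullet> (?i (X \<odot> A) \<ast>\<^sub>a (?c \<bullet> alg.m_arrow)) \<bullet> ze X A A A \<bullet> (?i (X \<ast> A) \<odot>\<^sub>a coalg.d_arrow)"
    by (simp add: law_def coalg.counit_at_def)
  also have "\<dots> = star.ru (X \<odot> A) \<bullet> (?i (X \<odot> A) \<ast>\<^sub>a J.m_arrow) \<bullet> (((?i X \<odot>\<^sub>a ?i A) \<ast>\<^sub>a (?c \<odot>\<^sub>a ?c)) \<bullet> ze X A A A)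
      \<bullet> (?i (X \<ast> A) \<odot>\<^sub>a coalg.d_arrow)"
    unfolding bimonoid_arrows by simp
  also have "((?i X \<odot>\<^sub>a ?i A) \<ast>\<^sub>a (?c \<odot>\<^sub>a ?c)) \<bullet> ze X A A A = ze X \<J> A \<J> \<bullet> ((?i X \<ast>\<^sub>a ?c) \<odot>\<^sub>a (?i A \<ast>\<^sub>a ?c))"
    using ze_nat [of "?i X" ?c "?i A" ?c] by simp
  also have "star.ru (X \<odot> A) \<bullet> (?i (X \<odot> A) \<ast>\<^sub>a J.m_arrow) \<bullet> (ze X \<J> A \<J> \<bullet> ((?i X \<ast>\<^sub>a ?c) \<odot>\<^sub>a (?i A \<ast>\<^sub>a ?c)))
      \<bullet> (?i (X \<ast> A) \<odot>\<^sub>a coalg.d_arrow)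
      = star.ru (X \<odot> A) \<bullet> (?i (X \<odot> A) \<ast>\<^sub>a J.m_arrow) \<bullet> ze X \<J> A \<J>
      \<bullet> ((?i X \<ast>\<^sub>a ?c) \<odot>\<^sub>a ((?i A \<ast>\<^sub>a ?c) \<bullet> coalg.d_arrow))"
    by simp
  also have "\<dots> = (star.ru (X \<odot> A) \<bullet> (?i (X \<odot> A) \<ast>\<^sub>a J.m_arrow) \<bullet> ze X \<J> A \<J> \<bullet> (star.ru' X \<odot>\<^sub>a star.ru' A))
      \<bullet> (coalg.counit_at X \<odot>\<^sub>a ?i A)"
    unfolding c by (simp add: coalg.counit_at_def)
  finally show ?thesis unfolding mu_right_arrow [OF assms alg.M_Ob] by simp
qed

text \<open>The formula for \<open>\<delta> \<cdot> m\<close> produces a second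
  \<open>\<zeta>\<close>, and associativity of \<open>\<zeta>\<close> for the first product
  rearranges the two into those of two successive laws. Associativity of \<open>m\<close> matches
  the remaining factors.\<close>

lemma law_mult:
  assumes [simp]: "X \<in> Ob D"
  shows "law X \<bullet> alg.mult_at (fob coalg.G X)
    = fmap coalg.G (alg.mult_at X) \<bullet> law (fob alg.S X) \<bullet> fmap alg.S (law X)"
proof -
  let ?i = "id_arrow D" and ?d = "coalg.d_arrow" and ?m = "alg.m_arrow"
  let ?R = "ze (X \<odot> A) (A \<odot> A) A A \<bullet> (ze X A A A \<odot>\<^sub>a ?i (A \<ast> A)) \<bullet> ((?i (X \<ast> A) \<odot>\<^sub>a ?d) \<odot>\<^sub>a ?d)"
  have "law X \<bullet> alg.mult_at (fob coalg.G X)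
      = (?i (X \<odot> A) \<ast>\<^sub>a ?m) \<bullet> ze X A A A \<bullet> (?i (X \<ast> A) \<odot>\<^sub>a (?d \<bullet> ?m)) \<bullet> circ.al (X \<ast> A) A A"
    by (simp add: law_def alg.mult_at_def)
  also have "\<dots> = (?i (X \<odot> A) \<ast>\<^sub>a ?m) \<bullet> (ze X A A A \<bullet> ((?i X \<ast>\<^sub>a ?i A) \<odot>\<^sub>a (?m \<ast>\<^sub>a ?m)))
      \<bullet> (?i (X \<ast> A) \<odot>\<^sub>a ze A A A A) \<bullet> ((?i (X \<ast> A) \<odot>\<^sub>a (?d \<odot>\<^sub>a ?d)) \<bullet> circ.al (X \<ast> A) A A)"
    unfolding bimonoid_arrows by simp
  also have "ze X A A A \<bullet> ((?i X \<ast>\<^sub>a ?i A) \<odot>\<^sub>a (?m \<ast>\<^sub>a ?m)) = ((?i X \<odot>\<^sub>a ?m) \<ast>\<^sub>a (?i A \<odot>\<^sub>a ?m)) \<bullet> ze X A (A \<odot> A) (A \<odot> A)"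
    using ze_nat [of "?i X" "?i A" ?m ?m] by simp
  also have "(?i (X \<ast> A) \<odot>\<^sub>a (?d \<odot>\<^sub>a ?d)) \<bullet> circ.al (X \<ast> A) A A
      = circ.al (X \<ast> A) (A \<ast> A) (A \<ast> A) \<bullet> ((?i (X \<ast> A) \<odot>\<^sub>a ?d) \<odot>\<^sub>a ?d)"
    using circ.al_nat [of "?i (X \<ast> A)" ?d ?d] by simp
  also have "(?i (X \<odot> A) \<ast>\<^sub>a ?m) \<bullet> (((?i X \<odot>\<^sub>a ?m) \<ast>\<^sub>a (?i A \<odot>\<^sub>a ?m)) \<bullet> ze X A (A \<odot> A) (A \<odot> A))
      \<bullet> (?i (X \<ast> A) \<odot>\<^sub>a ze A A A A) \<bullet> (circ.al (X \<ast> A) (A \<ast> A) (A \<ast> A) \<bullet> ((?i (X \<ast> A) \<odot>\<^sub>a ?d) \<odot>\<^sub>a ?d))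
      = ((?i X \<odot>\<^sub>a ?m) \<ast>\<^sub>a (?m \<bullet> (?i A \<odot>\<^sub>a ?m))) \<bullet> (ze X A (A \<odot> A) (A \<odot> A)
      \<bullet> (?i (X \<ast> A) \<odot>\<^sub>a ze A A A A) \<bullet> circ.al (X \<ast> A) (A \<ast> A) (A \<ast> A)) \<bullet> ((?i (X \<ast> A) \<odot>\<^sub>a ?d) \<odot>\<^sub>a ?d)"
    by simp
  also have "\<dots> = ((?i X \<odot>\<^sub>a ?m) \<ast>\<^sub>a (?m \<bullet> (?i A \<odot>\<^sub>a ?m))) \<bullet> (circ.al X A A \<ast>\<^sub>a circ.al A A A) \<bullet> ?R"
    by (subst ze_circ_assoc [symmetric]) simp_all
  also have "\<dots> = (alg.mult_at X \<ast>\<^sub>a (?m \<bullet> (?m \<odot>\<^sub>a ?i A))) \<bullet> ?R"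
    by (simp add: alg.mult_at_def alg.m_assoc)
  finally have l: "law X \<bullet> alg.mult_at (fob coalg.G X) = (alg.mult_at X \<ast>\<^sub>a (?m \<bullet> (?m \<odot>\<^sub>a ?i A))) \<bullet> ?R" .
  have "fmap coalg.G (alg.mult_at X) \<bullet> law (fob alg.S X) \<bullet> fmap alg.S (law X)
     = (alg.mult_at X \<ast>\<^sub>a ?m) \<bullet> (ze (X \<odot> A) A A A \<bullet> ((?i (X \<odot> A) \<ast>\<^sub>a ?m) \<odot>\<^sub>a (?i A \<ast>\<^sub>a ?i A)))
      \<bullet> (ze X A A A \<odot>\<^sub>a ?i (A \<ast> A)) \<bullet> ((?i (X \<ast> A) \<odot>\<^sub>a ?d) \<odot>\<^sub>a ?d)"
    by (simp add: law_def)
  also have "ze (X \<odot> A) A A A \<bullet> ((?i (X \<odot> A) \<ast>\<^sub>a ?m) \<odot>\<^sub>a (?i A \<ast>\<^sub>a ?i A))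
      = ((?i (X \<odot> A) \<odot>\<^sub>a ?i A) \<ast>\<^sub>a (?m \<odot>\<^sub>a ?i A)) \<bullet> ze (X \<odot> A) (A \<odot> A) A A"
    using ze_nat [of "?i (X \<odot> A)" ?m "?i A" "?i A"] by simp
  finally show ?thesis unfolding l by simp
qed

text \<open>Now two copies of \<open>\<zeta>\<close> come from the two successive laws on the right.
  Associativity of \<open>\<zeta>\<close> for the second product and coassociativity of
  \<open>\<delta>\<close> regroup them until the formula for \<open>\<delta> \<cdot> m\<close>
  absorbs one. Composing with an associator first cancels the inverse one in
  \<open>comult_at\<close>.\<close>

lemma law_comult:
  assumes [simp]: "X \<in> Ob D"
  shows "coalg.comult_at (fob alg.S X) \<bullet> law X
    = fmap coalg.G (law X) \<bullet> law (fob coalg.G X) \<bullet> fmap alg.S (coalg.comult_at X)"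
proof (rule iso_left_cancel [OF star.al_inverse [of "X \<odot> A" A A]])
  let ?i = "id_arrow D" and ?d = "coalg.d_arrow" and ?m = "alg.m_arrow"
  let ?a = "star.al" and ?a' = "star.al'"
  have "?a (X \<odot> A) A A \<bullet> fmap coalg.G (law X) \<bullet> law (fob coalg.G X) \<bullet> fmap alg.S (coalg.comult_at X)
    = (?a (X \<odot> A) A A \<bullet> ((?i (X \<odot> A) \<ast>\<^sub>a ?m) \<ast>\<^sub>a ?m)) \<bullet> (ze X A A A \<ast>\<^sub>a ?i (A \<odot> A))
      \<bullet> ((((?i X \<ast>\<^sub>a ?i A) \<odot>\<^sub>a ?d) \<ast>\<^sub>a (?i A \<odot>\<^sub>a ?i A)) \<bullet> ze (X \<ast> A) A A A)
      \<bullet> ((?a' X A A \<bullet> (?i X \<ast>\<^sub>a ?d)) \<odot>\<^sub>a ?d)"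
    by (simp add: law_def coalg.comult_at_def)
  also have "?a (X \<odot> A) A A \<bullet> ((?i (X \<odot> A) \<ast>\<^sub>a ?m) \<ast>\<^sub>a ?m)
      = (?i (X \<odot> A) \<ast>\<^sub>a (?m \<ast>\<^sub>a ?m)) \<bullet> ?a (X \<odot> A) (A \<odot> A) (A \<odot> A)"
    using star.al_nat [of "?i (X \<odot> A)" ?m ?m] by simp
  also have "(((?i X \<ast>\<^sub>a ?i A) \<odot>\<^sub>a ?d) \<ast>\<^sub>a (?i A \<odot>\<^sub>a ?i A)) \<bullet> ze (X \<ast> A) A A A
      = ze (X \<ast> A) A (A \<ast> A) A \<bullet> (((?i X \<ast>\<^sub>a ?i A) \<ast>\<^sub>a ?i A) \<odot>\<^sub>a (?d \<ast>\<^sub>a ?i A))"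
    using ze_nat [of "?i X \<ast>\<^sub>a ?i A" "?i A" ?d "?i A"] by simp
  also have "((?i (X \<odot> A) \<ast>\<^sub>a (?m \<ast>\<^sub>a ?m)) \<bullet> ?a (X \<odot> A) (A \<odot> A) (A \<odot> A)) \<bullet> (ze X A A A \<ast>\<^sub>a ?i (A \<odot> A))
      \<bullet> (ze (X \<ast> A) A (A \<ast> A) A \<bullet> (((?i X \<ast>\<^sub>a ?i A) \<ast>\<^sub>a ?i A) \<odot>\<^sub>a (?d \<ast>\<^sub>a ?i A)))
      \<bullet> ((?a' X A A \<bullet> (?i X \<ast>\<^sub>a ?d)) \<odot>\<^sub>a ?d)
    = (?i (X \<odot> A) \<ast>\<^sub>a (?m \<ast>\<^sub>a ?m)) \<bullet> (?a (X \<odot> A) (A \<odot> A) (A \<odot> A) \<bullet> (ze X A A A \<ast>\<^sub>a ?i (A \<odot> A)) \<bullet> ze (X \<ast> A) A (A \<ast> A) A)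
      \<bullet> ((?a' X A A \<bullet> (?i X \<ast>\<^sub>a ?d)) \<odot>\<^sub>a ((?d \<ast>\<^sub>a ?i A) \<bullet> ?d))"
    by simp
  also have "\<dots> = (?i (X \<odot> A) \<ast>\<^sub>a (?m \<ast>\<^sub>a ?m)) \<bullet> ((?i (X \<odot> A) \<ast>\<^sub>a ze A A A A) \<bullet> ze X (A \<ast> A) A (A \<ast> A) \<bullet> (?a X A A \<odot>\<^sub>a ?a A A A))
      \<bullet> ((?a' X A A \<bullet> (?i X \<ast>\<^sub>a ?d)) \<odot>\<^sub>a ((?d \<ast>\<^sub>a ?i A) \<bullet> ?d))"
    by (subst ze_star_assoc) simp_all
  also have "\<dots> = (?i (X \<odot> A) \<ast>\<^sub>a ((?m \<ast>\<^sub>a ?m) \<bullet> ze A A A A)) \<bullet> (ze X (A \<ast> A) A (A \<ast> A) \<bullet> ((?i X \<ast>\<^sub>a ?d) \<odot>\<^sub>a (?i A \<ast>\<^sub>a ?d)))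
      \<bullet> (?i (X \<ast> A) \<odot>\<^sub>a ?d)"
    by (simp add: coalg.d_coassoc)
  also have "ze X (A \<ast> A) A (A \<ast> A) \<bullet> ((?i X \<ast>\<^sub>a ?d) \<odot>\<^sub>a (?i A \<ast>\<^sub>a ?d))
      = ((?i X \<odot>\<^sub>a ?i A) \<ast>\<^sub>a (?d \<odot>\<^sub>a ?d)) \<bullet> ze X A A A"
    using ze_nat [of "?i X" ?d "?i A" ?d] by simp
  also have "(?i (X \<odot> A) \<ast>\<^sub>a ((?m \<ast>\<^sub>a ?m) \<bullet> ze A A A A)) \<bullet> (((?i X \<odot>\<^sub>a ?i A) \<ast>\<^sub>a (?d \<odot>\<^sub>a ?d)) \<bullet> ze X A A A)
      \<bullet> (?i (X \<ast> A) \<odot>\<^sub>a ?d)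
      = (?i (X \<odot> A) \<ast>\<^sub>a (?d \<bullet> ?m)) \<bullet> ze X A A A \<bullet> (?i (X \<ast> A) \<odot>\<^sub>a ?d)"
    unfolding bimonoid_arrows by simp
  also have "\<dots> = ?a (X \<odot> A) A A \<bullet> coalg.comult_at (fob alg.S X) \<bullet> law X"
    by (simp add: coalg.comult_at_def law_def)
  finally show "?a (X \<odot> A) A A \<bullet> coalg.comult_at (fob alg.S X) \<bullet> law X
    = ?a (X \<odot> A) A A \<bullet> fmap coalg.G (law X) \<bullet> law (fob coalg.G X) \<bullet> fmap alg.S (coalg.comult_at X)"
    by (rule sym)
qed (simp_all add: law_def coalg.comult_at_def)

sublocale L: mixed_distributive_law D alg.S alg.unit_at alg.mult_at coalg.G coalg.counit_at coalg.comult_at law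
proof
  show "arrow D (law X)" if "X \<in> Ob D" for X using that by (simp add: law_def)
  show "src (law X) = fob alg.S (fob coalg.G X)" "trg (law X) = fob coalg.G (fob alg.S X)" for X
    by (simp_all add: law_def)
qed (rule law_natural law_unit law_mult law_counit law_comult; assumption)+

end

section \<open>Modules over J and sections of the counit\<close>

context duoidal
begin

lemma J_modules_category: "category (J_modules D)"
  unfolding J_modules_def by (rule J.modules_category)

lemma phi_J_functor: "is_functor D (J_modules D) (phi_J D)"
  unfolding J_modules_def phi_J_def by (rule J.free_module_functor)

lemmas J_modules_simps [simp] =
  J.modules_base [folded J_modules_def] J.module_act [folded J_modules_def]
  J.free_module_simps [folded J_modules_def phi_J_def] J.free_module_base [folded phi_J_def]

lemmas J_modules_arrow = J.modules_arrow [folded J_modules_def]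

lemma J_modules_base_arrow [simp]: "arrow (J_modules D) f \<Longrightarrow> arrow D (base f)"
  using J_modules_arrow by blast

lemma J_module_act_unit: "P \<in> Ob (J_modules D) \<Longrightarrow> J.act P \<bullet> J.unit_at (fst P) = id_arrow D (fst P)"
  using J.S.algebraD(4) [of "J.act P"] by (simp add: J_modules_def J.modules_Ob)

lemma J_module_act_e:
  assumes "P \<in> Ob (J_modules D)"
  shows "J.act P \<bullet> (id_arrow D (fst P) \<odot>\<^sub>a J.e_arrow) = circ.ru (fst P)"
proof -
  have "J.act P \<bullet> (id_arrow D (fst P) \<odot>\<^sub>a J.e_arrow) = (J.act P \<bullet> J.unit_at (fst P)) \<bullet> circ.ru (fst P)"
    using assms by (simp add: J.unit_at_def)
  then show ?thesis using assms by (simp add: J_module_act_unit)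
qed

lemma J_module_arrowI:
  assumes "P \<in> Ob (J_modules D)" "P' \<in> Ob (J_modules D)" "arrow D f" "src f = fst P" "trg f = fst P'"
    "f \<bullet> J.act P = J.act P' \<bullet> (f \<odot>\<^sub>a id_arrow D \<J>)"
  shows "arrow (J_modules D) (Arr P (mor f) P')" "base (Arr P (mor f) P') = f"
proof -
  show "base (Arr P (mor f) P') = f" using assms(4,5) by (intro arrow.expand) simp
  then show "arrow (J_modules D) (Arr P (mor f) P')"
    using assms unfolding J_modules_arrow by simp
qed

lemma adj_simps:
  "fob (adj_left D) (fob (adj_right D K \<delta>) P) = fob (phi_J D) (fst P \<ast> K)"
  "base (fmap (adj_left D) (fmap (adj_right D K \<delta>) f)) = (base f \<ast>\<^sub>a id_arrow D K) \<odot>\<^sub>a id_arrow D \<J>"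
proof -
  have "base (fmap (cofree_comodule D (star D) K \<delta>) h) = h \<ast>\<^sub>a id_arrow D K" for h
    by (simp add: base_def cofree_comodule_def tensor_arrow_def)
  then show "base (fmap (adj_left D) (fmap (adj_right D K \<delta>) f)) = (base f \<ast>\<^sub>a id_arrow D K) \<odot>\<^sub>a id_arrow D \<J>"
    by (simp add: adj_left_def adj_right_def)
qed (simp add: adj_left_def adj_right_def cofree_comodule_def)

text \<open>The comonoid enters the counit only through \<open>\<epsilon>\<close>. Hence a morphism
  \<open>g\<close> with \<open>\<epsilon>' \<cdot> g = \<epsilon>\<close> relates two such
  counits.\<close>

lemma adj_counit_base:
  assumes "is_comonoid D (star D) K \<delta> \<epsilon>" "P \<in> Ob (J_modules D)"
  shows "base (Arr (fob (phi_J D) (fst P \<ast> K)) (adj_counit D K \<delta> \<epsilon> P) P)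
    = J.act P \<bullet> ((star.ru (fst P) \<bullet> (id_arrow D (fst P) \<ast>\<^sub>a Arr K \<epsilon> \<J>)) \<odot>\<^sub>a id_arrow D \<J>)"
proof -
  have "K \<in> Ob D" using assms(1) by (simp add: is_comonoid_def)
  then show ?thesis
    using assms(2)
    by (intro arrow.expand)
      (simp add: adj_counit_def composite_counit_def cofree_comodule_counit_def phi_J_def free_module_def
        J_modules_def modules_def star.ru_def)
qed

text \<open>The map \<open>(X \<ast> g) \<odot> J\<close> is natural in \<open>X\<close>, and the
  counit for \<open>K'\<close> after it is the counit for \<open>K\<close>. So composing a section
  with it yields a section for \<open>K'\<close>. The intended \<open>g\<close> is
  \<open>e : I -> A\<close>.\<close>

lemma comonoid_morphism_counit_split:
  assumes K: "is_comonoid D (star D) K \<delta> \<epsilon>" and K': "is_comonoid D (star D) K' \<delta>' \<epsilon>'"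
    and g: "g \<in> Hom D K K'" "\<epsilon>' \<cdot> g = \<epsilon>"
    and split: "nat_split_epi (J_modules D) (J_modules D) (adj_left D \<circ>\<^sub>F adj_right D K \<delta>) id_func (adj_counit D K \<delta> \<epsilon>)"
  shows "nat_split_epi (J_modules D) (J_modules D) (adj_left D \<circ>\<^sub>F adj_right D K' \<delta>') id_func (adj_counit D K' \<delta>' \<epsilon>')"
proof -
  let ?B = "J_modules D" and ?i = "id_arrow D"
  interpret K: adjunction "comodules D (star D) K \<delta> \<epsilon>" ?B "adj_left D" "adj_right D K \<delta>"
    "adj_unit D K \<delta> \<epsilon>" "adj_counit D K \<delta> \<epsilon>"
    by (rule phi_J_adjunction [OF K])
  interpret K': adjunction "comodules D (star D) K' \<delta>' \<epsilon>'" ?B "adj_left D" "adj_right D K' \<delta>'"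
    "adj_unit D K' \<delta>' \<epsilon>'" "adj_counit D K' \<delta>' \<epsilon>'"
    by (rule phi_J_adjunction [OF K'])
  interpret phi: functor_between D ?B "phi_J D"
    by unfold_locales (rule phi_J_functor)
  have [simp]: "K \<in> Ob D" "K' \<in> Ob D" using K K' by (simp_all add: is_comonoid_def)
  define g' where "g' = Arr K g K'"
  have g' [simp]: "arrow D g'" "src g' = K" "trg g' = K'" by (simp_all add: g'_def g)
  have eps_g: "Arr K' \<epsilon>' \<J> \<bullet> g' = Arr K \<epsilon> \<J>" using g by (simp add: g'_def comp_triple)
  have [simp]: "\<epsilon> \<in> Hom D K \<J>" "\<epsilon>' \<in> Hom D K' \<J>"
    using K K' by (simp_all add: is_comonoid_def)
  obtain s where s [simp]: "\<And>P. P \<in> Ob ?B \<Longrightarrow> arrow ?B (s P)" "\<And>P. P \<in> Ob ?B \<Longrightarrow> src (s P) = P"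
      "\<And>P. P \<in> Ob ?B \<Longrightarrow> trg (s P) = fob (phi_J D) (fst P \<ast> K)"
      "\<And>P. P \<in> Ob ?B \<Longrightarrow> K.eps P \<bullet>\<^bsub>?B\<^esub> s P = id_arrow ?B P"
    and s_nat: "\<And>f. arrow ?B f \<Longrightarrow> s (trg f) \<bullet>\<^bsub>?B\<^esub> f
      = fmap (adj_left D) (fmap (adj_right D K \<delta>) f) \<bullet>\<^bsub>?B\<^esub> s (src f)"
    using split unfolding K.counit_split_epi_iff adj_simps(1) by blast
  define s' where "s' P = fmap (phi_J D) (?i (fst P) \<ast>\<^sub>a g') \<bullet>\<^bsub>?B\<^esub> s P" for P
  have s' [simp]: "arrow ?B (s' P)" "src (s' P) = P" "trg (s' P) = fob (phi_J D) (fst P \<ast> K')"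
    if "P \<in> Ob ?B" for P
    using that by (simp_all add: s'_def)
  have "K'.eps P \<bullet>\<^bsub>?B\<^esub> s' P = id_arrow ?B P" if P: "P \<in> Ob ?B" for P
  proof -
    have eps: "base (K.eps P) = J.act P \<bullet> ((star.ru (fst P) \<bullet> (?i (fst P) \<ast>\<^sub>a Arr K \<epsilon> \<J>)) \<odot>\<^sub>a ?i \<J>)"
      "base (K'.eps P) = J.act P \<bullet> ((star.ru (fst P) \<bullet> (?i (fst P) \<ast>\<^sub>a Arr K' \<epsilon>' \<J>)) \<odot>\<^sub>a ?i \<J>)"
      using adj_counit_base [OF K P] adj_counit_base [OF K' P] by (simp_all add: K.eps_def K'.eps_def adj_simps)
    have "K'.eps P \<bullet>\<^bsub>?B\<^esub> fmap (phi_J D) (?i (fst P) \<ast>\<^sub>a g') = K.eps P"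
      using P by (intro base_inject) (simp_all add: eps eps_g adj_simps)
    then show ?thesis
      using P category.reassoc [OF J_modules_category, of "K'.eps P" "fmap (phi_J D) (?i (fst P) \<ast>\<^sub>a g')" "K.eps P" "s P"]
      by (simp add: s'_def adj_simps)
  qed
  moreover have "s' (trg f) \<bullet>\<^bsub>?B\<^esub> f = fmap (adj_left D) (fmap (adj_right D K' \<delta>') f) \<bullet>\<^bsub>?B\<^esub> s' (src f)"
    if f: "arrow ?B f" for f
  proof -
    have [simp]: "src f \<in> Ob ?B" "trg f \<in> Ob ?B"
      using f by simp_all
    show ?thesis
      using f by (intro base_inject) (simp_all add: s'_def s_nat adj_simps)
  qed
  ultimately show ?thesis
    unfolding K'.counit_split_epi_iff adj_simps(1) by (intro exI [of _ s']) simp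
qed

text \<open>With \<open>s\<close> a section of \<open>\<tau>\<close>, the unit law
  \<open>act \<cdot> (X \<odot> \<tau>) = ru\<close> gives
  \<open>act = ru \<cdot> (X \<odot> s)\<close>. So every \<open>J\<close>-action is the same
  natural expression in \<open>X\<close>, and any morphism respects it.\<close>

lemma J_module_arrow_if_tau_split:
  assumes "split_epi D \<I> \<J> (tau D)" and P [simp]: "P \<in> Ob (J_modules D)" "P' \<in> Ob (J_modules D)"
    and f [simp]: "arrow D f" "src f = fst P" "trg f = fst P'"
  shows "f \<bullet> J.act P = J.act P' \<bullet> (f \<odot>\<^sub>a id_arrow D \<J>)"
proof -
  let ?i = "id_arrow D"
  obtain t where "t \<in> Hom D \<J> \<I>" "tau D \<cdot> t = Id D \<J>" using assms(1) by (auto simp: split_epi_def)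
  then obtain s where s [simp]: "arrow D s" "src s = \<J>" "trg s = \<I>" and e_s: "J.e_arrow \<bullet> s = ?i \<J>"
    by (intro that [of "Arr \<J> t \<I>"]) (simp_all add: J.e_arrow_def comp_triple id_arrow_def)
  have act_s: "J.act R = circ.ru (fst R) \<bullet> (?i (fst R) \<odot>\<^sub>a s)" if "R \<in> Ob (J_modules D)" for R
  proof -
    have "J.act R = (J.act R \<bullet> (?i (fst R) \<odot>\<^sub>a J.e_arrow)) \<bullet> (?i (fst R) \<odot>\<^sub>a s)"
      using that by (simp add: e_s)
    then show ?thesis unfolding J_module_act_e [OF that] .
  qed
  have "f \<bullet> J.act P = (f \<bullet> circ.ru (src f)) \<bullet> (?i (fst P) \<odot>\<^sub>a s)"
    by (simp add: act_s)
  also have "\<dots> = J.act P' \<bullet> (f \<odot>\<^sub>a ?i \<J>)"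
    by (subst circ.ru_nat [symmetric]) (simp_all add: act_s)
  finally show ?thesis .
qed

lemma counit_split_if_tau_split:
  assumes tau: "split_epi D \<I> \<J> (tau D)"
  shows "nat_split_epi (J_modules D) (J_modules D) (adj_left D \<circ>\<^sub>F adj_right D \<I> (Delta D)) id_func
    (adj_counit D \<I> (Delta D) (tau D))"
proof -
  let ?B = "J_modules D" and ?i = "id_arrow D"
  interpret K: adjunction "comodules D (star D) \<I> (Delta D) (tau D)" ?B "adj_left D" "adj_right D \<I> (Delta D)"
    "adj_unit D \<I> (Delta D) (tau D)" "adj_counit D \<I> (Delta D) (tau D)"
    by (rule phi_J_adjunction [OF I_comonoid])
  obtain t where "t \<in> Hom D \<J> \<I>" "tau D \<cdot> t = Id D \<J>" using tau by (auto simp: split_epi_def)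
  then obtain s where s [simp]: "arrow D s" "src s = \<J>" "trg s = \<I>" and e_s: "J.e_arrow \<bullet> s = ?i \<J>"
    by (intro that [of "Arr \<J> t \<I>"]) (simp_all add: J.e_arrow_def comp_triple id_arrow_def)
  \<comment> \<open>The unit constraint \<open>X -> X \<ast> J\<close>, then the section
    \<open>J -> I\<close>, then the unit of the free module. Linearity is automatic by
    \<open>J_module_arrow_if_tau_split\<close>, and \<open>\<tau> \<cdot> s = id\<close> makes it a
    section of the counit.\<close>
  define r where "r P = J.unit_at (fst P \<ast> \<I>) \<bullet> (?i (fst P) \<ast>\<^sub>a s) \<bullet> star.ru' (fst P)" for P :: "'o \<times> 'm"
  have r [simp]: "arrow D (r P)" "src (r P) = fst P" "trg (r P) = (fst P \<ast> \<I>) \<odot> \<J>"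
    if "P \<in> Ob ?B" for P
    using that by (simp_all add: r_def)
  define q where "q P = Arr P (mor (r P)) (fob (phi_J D) (fst P \<ast> \<I>))" for P
  have q_sel [simp]: "src (q P) = P" "trg (q P) = fob (phi_J D) (fst P \<ast> \<I>)" for P
    by (simp_all add: q_def)
  have q [simp]: "arrow ?B (q P)" "base (q P) = r P" if P: "P \<in> Ob ?B" for P
  proof -
    have "r P \<bullet> J.act P = J.act (fob (phi_J D) (fst P \<ast> \<I>)) \<bullet> (r P \<odot>\<^sub>a ?i \<J>)"
      using P by (intro J_module_arrow_if_tau_split tau) simp_all
    from J_module_arrowI [OF P _ _ _ _ this] show "arrow ?B (q P)" "base (q P) = r P"
      using P by (simp_all add: q_def)
  qed
  have "K.eps P \<bullet>\<^bsub>?B\<^esub> q P = id_arrow ?B P" if P [simp]: "P \<in> Ob ?B" for P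
  proof -
    let ?c = "star.ru (fst P) \<bullet> (?i (fst P) \<ast>\<^sub>a J.e_arrow)"
    have "base (K.eps P) = J.act P \<bullet> (?c \<odot>\<^sub>a ?i \<J>)"
      using adj_counit_base [OF I_comonoid P] by (simp add: K.eps_def adj_simps J.e_arrow_def)
    then have "base (K.eps P \<bullet>\<^bsub>?B\<^esub> q P)
        = J.act P \<bullet> (fmap J.S ?c \<bullet> J.unit_at (src ?c)) \<bullet> (?i (fst P) \<ast>\<^sub>a s) \<bullet> star.ru' (fst P)"
      by (simp add: r_def)
    also have "fmap J.S ?c \<bullet> J.unit_at (src ?c) = J.unit_at (fst P) \<bullet> ?c"
      by (subst J.S.u_nat [symmetric]) simp_all
    also have "J.act P \<bullet> (J.unit_at (fst P) \<bullet> ?c) \<bullet> (?i (fst P) \<ast>\<^sub>a s) \<bullet> star.ru' (fst P)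
        = (J.act P \<bullet> J.unit_at (fst P)) \<bullet> star.ru (fst P) \<bullet> (?i (fst P) \<ast>\<^sub>a (J.e_arrow \<bullet> s)) \<bullet> star.ru' (fst P)"
      by simp
    also have "\<dots> = ?i (fst P)"
      unfolding e_s J_module_act_unit [OF P] by simp
    finally show ?thesis by (intro base_inject) (simp_all add: adj_simps)
  qed
  moreover have "q (trg f) \<bullet>\<^bsub>?B\<^esub> f = fmap (adj_left D) (fmap (adj_right D \<I> (Delta D)) f) \<bullet>\<^bsub>?B\<^esub> q (src f)"
    if f [simp]: "arrow ?B f" for f
  proof -
    let ?f = "base f"
    have "src f \<in> Ob ?B" "trg f \<in> Ob ?B" by simp_all
    note [simp] = J_modules_simps(4) [OF this(1)] J_modules_simps(4) [OF this(2)]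
    have "r (trg f) \<bullet> ?f = J.unit_at (fst (trg f) \<ast> \<I>) \<bullet> (?i (fst (trg f)) \<ast>\<^sub>a s) \<bullet> (star.ru' (trg ?f) \<bullet> ?f)"
      by (simp add: r_def)
    also have "star.ru' (trg ?f) \<bullet> ?f = (?f \<ast>\<^sub>a ?i \<J>) \<bullet> star.ru' (src ?f)"
      by (rule star.ru'_nat) simp
    also have "J.unit_at (fst (trg f) \<ast> \<I>) \<bullet> (?i (fst (trg f)) \<ast>\<^sub>a s) \<bullet> ((?f \<ast>\<^sub>a ?i \<J>) \<bullet> star.ru' (src ?f))
        = (J.unit_at (trg (?f \<ast>\<^sub>a ?i \<I>)) \<bullet> (?f \<ast>\<^sub>a ?i \<I>)) \<bullet> (?i (fst (src f)) \<ast>\<^sub>a s) \<bullet> star.ru' (fst (src f))"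
      by simp
    also have "\<dots> = ((?f \<ast>\<^sub>a ?i \<I>) \<odot>\<^sub>a ?i \<J>) \<bullet> r (src f)"
      by (subst J.S.u_nat) (simp_all add: r_def)
    finally show ?thesis by (intro base_inject) (simp_all add: adj_simps)
  qed
  ultimately show ?thesis
    unfolding K.counit_split_epi_iff adj_simps(1) by (intro exI [of _ q]) simp
qed

end

section \<open>Hopf modules\<close>

context bimonoid_object
begin

abbreviation "Hopf \<equiv> hopf_modules D A m e \<delta> \<epsilon>"
abbreviation "T \<equiv> lifted_monad D A m \<delta>"
abbreviation "K \<equiv> comparison_functor D A m \<delta>"

definition hopf_act :: "'o \<times> 'm \<times> 'm \<Rightarrow> ('o, 'm) arrow" where
  "hopf_act P = alg.act (fst P, fst (snd P))"

text \<open>On objects this is the forgetful functor from Hopf modules to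
  \<open>A\<close>-comodules, the \<open>V\<close> of \<open>monadic_comparison\<close>.\<close>

definition hopf_comodule :: "'o \<times> 'm \<times> 'm \<Rightarrow> 'o \<times> 'm" where
  "hopf_comodule P = (fst P, snd (snd P))"

lemma hopf_sel [simp]:
  "src (hopf_act P) = fst P \<odot> A" "trg (hopf_act P) = fst P" "mor (hopf_act P) = fst (snd P)"
  "fst (hopf_comodule P) = fst P" "snd (hopf_comodule P) = snd (snd P)"
  by (simp_all add: hopf_act_def hopf_comodule_def)

lemma mor_lift_coaction:
  "mor (L.lift_coaction (coalg.coact P)) = mixed_law D A m \<delta> (fst P) \<cdot> (snd P \<odot>\<^sub>m Id D A)"
  by (simp add: L.lift_coaction_def law_def mixed_law_def ze_def alg.m_arrow_def coalg.d_arrow_def)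

text \<open>In this form the compatibility condition says that the action is a comodule map out of
  the lifted monad, so that a Hopf module is an algebra for that monad on comodules.\<close>

lemma hopf_Ob: "P \<in> Ob Hopf \<longleftrightarrow> alg.S.algebra (hopf_act P) \<and> hopf_comodule P \<in> Ob coalg.Comod \<and>
    fmap coalg.G (hopf_act P) \<bullet> L.lift_coaction (coalg.coact (hopf_comodule P))
    = coalg.coact (hopf_comodule P) \<bullet> hopf_act P"
proof -
  obtain X h \<theta> where P: "P = (X, h, \<theta>)" by (cases P)
  have "fmap coalg.G (hopf_act P) \<bullet> L.lift_coaction (coalg.coact (hopf_comodule P))
      = coalg.coact (hopf_comodule P) \<bullet> hopf_act P
    \<longleftrightarrow> \<theta> \<cdot> h = (h \<ast>\<^sub>m Id D A) \<cdot> mixed_law D A m \<delta> X \<cdot> (\<theta> \<odot>\<^sub>m Id D A)"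
    using mor_lift_coaction [of "hopf_comodule P"]
    by (auto simp: comp_arrow_def L.lift_coaction_def P hopf_comodule_def hopf_act_def law_def)
  then show ?thesis
    by (simp add: P hopf_modules_def is_hopf_module_def alg.is_module_iff coalg.comodules_Ob
        coalg.is_comodule_iff hopf_act_def hopf_comodule_def)
qed

lemma hopf_base [simp]: "base (g \<bullet>\<^bsub>Hopf\<^esub> f) = base g \<bullet> base f"
    "base (id_arrow Hopf P) = id_arrow D (fst P)"
  by (simp_all add: base_def comp_arrow_def id_arrow_def hopf_modules_def split: prod.split)

lemma hopf_Hom_Comod: "f \<in> Hom Hopf P P' \<longleftrightarrow> P \<in> Ob Hopf \<and> P' \<in> Ob Hopf \<and>
    f \<in> Hom coalg.Comod (hopf_comodule P) (hopf_comodule P') \<and>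
    f \<cdot> fst (snd P) = fst (snd P') \<cdot> (f \<odot>\<^sub>m Id D A)"
  by (cases P; cases P')
    (auto simp: hopf_modules_def is_hopf_module_def comodules_def module_mor_def comodule_mor_def
      hopf_comodule_def)

lemma hopf_Hom: "f \<in> Hom Hopf P P' \<longleftrightarrow> P \<in> Ob Hopf \<and> P' \<in> Ob Hopf \<and> f \<in> Hom D (fst P) (fst P') \<and>
    (Arr (fst P) f (fst P') \<bullet> hopf_act P = hopf_act P' \<bullet> fmap alg.S (Arr (fst P) f (fst P')) \<and>
     fmap coalg.G (Arr (fst P) f (fst P')) \<bullet> coalg.coact (hopf_comodule P)
     = coalg.coact (hopf_comodule P') \<bullet> Arr (fst P) f (fst P'))"
  unfolding hopf_Hom_Comod coalg.comodules_Hom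
  by (auto simp: hopf_Ob comp_arrow_def)

lemma hopf_arrow: "arrow Hopf f \<longleftrightarrow> src f \<in> Ob Hopf \<and> trg f \<in> Ob Hopf \<and> arrow D (base f) \<and>
    base f \<bullet> hopf_act (src f) = hopf_act (trg f) \<bullet> fmap alg.S (base f) \<and>
    fmap coalg.G (base f) \<bullet> coalg.coact (hopf_comodule (src f))
    = coalg.coact (hopf_comodule (trg f)) \<bullet> base f"
  by (simp add: arrow_def [of Hopf] hopf_Hom base_def)

lemma hopf_module_arrows [simp]:
  assumes "P \<in> Ob Hopf"
  shows "arrow D (hopf_act P)" "hopf_comodule P \<in> Ob coalg.Comod" "fst P \<in> Ob D"
proof -
  show "arrow D (hopf_act P)" "hopf_comodule P \<in> Ob coalg.Comod"
    using assms alg.S.algebraD(1) by (auto simp: hopf_Ob)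
  from coalg.comodule_coact(2) [OF this(2)] show "fst P \<in> Ob D" by simp
qed

lemma hopf_category: "category Hopf"
proof (rule concrete_category [where V = fst and R = "\<lambda>P P' f.
    f \<bullet> hopf_act P = hopf_act P' \<bullet> fmap alg.S f \<and>
    fmap coalg.G f \<bullet> coalg.coact (hopf_comodule P) = coalg.coact (hopf_comodule P') \<bullet> f"])
  show "Comp Hopf = Comp D" "\<And>P. Id Hopf P = Id D (fst P)" by (auto simp: hopf_modules_def)
next
  fix P P' P'' f g
  assume P: "P \<in> Ob Hopf" "P' \<in> Ob Hopf" "P'' \<in> Ob Hopf"
    and fg [simp]: "arrow D f" "arrow D g" "src f = fst P" "trg f = fst P'" "src g = fst P'" "trg g = fst P''"
    and f: "f \<bullet> hopf_act P = hopf_act P' \<bullet> fmap alg.S f \<and>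
      fmap coalg.G f \<bullet> coalg.coact (hopf_comodule P) = coalg.coact (hopf_comodule P') \<bullet> f"
    and g: "g \<bullet> hopf_act P' = hopf_act P'' \<bullet> fmap alg.S g \<and>
      fmap coalg.G g \<bullet> coalg.coact (hopf_comodule P') = coalg.coact (hopf_comodule P'') \<bullet> g"
  note [simp] = hopf_module_arrows [OF P(1)] hopf_module_arrows [OF P(2)] hopf_module_arrows [OF P(3)]
  have "(g \<bullet> f) \<bullet> hopf_act P = (g \<bullet> hopf_act P') \<bullet> fmap alg.S f" using f by simp
  also have "\<dots> = (hopf_act P'' \<bullet> fmap alg.S g) \<bullet> fmap alg.S f" using g by metis
  also have "\<dots> = hopf_act P'' \<bullet> fmap alg.S (g \<bullet> f)" by simp
  finally have 1: "(g \<bullet> f) \<bullet> hopf_act P = hopf_act P'' \<bullet> fmap alg.S (g \<bullet> f)" .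
  have "fmap coalg.G (g \<bullet> f) \<bullet> coalg.coact (hopf_comodule P)
      = fmap coalg.G g \<bullet> (fmap coalg.G f \<bullet> coalg.coact (hopf_comodule P))" by simp
  also have "\<dots> = (fmap coalg.G g \<bullet> coalg.coact (hopf_comodule P')) \<bullet> f" using f by simp
  also have "\<dots> = (coalg.coact (hopf_comodule P'') \<bullet> g) \<bullet> f" using g by metis
  also have "\<dots> = coalg.coact (hopf_comodule P'') \<bullet> g \<bullet> f" by simp
  finally show "(g \<bullet> f) \<bullet> hopf_act P = hopf_act P'' \<bullet> fmap alg.S (g \<bullet> f) \<and>
      fmap coalg.G (g \<bullet> f) \<bullet> coalg.coact (hopf_comodule P) = coalg.coact (hopf_comodule P'') \<bullet> g \<bullet> f"
    using 1 by blast
qed (simp_all add: hopf_Hom)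

lemma lifted_monad_fst [simp]: "fst (fob T P) = fst P \<odot> A"
  by (simp add: lifted_monad_def split: prod.split)

lemma lifted_monad_simps [simp]:
  assumes "P \<in> Ob coalg.Comod"
  shows "coalg.coact (fob T P) = L.lift_coaction (coalg.coact P)" "fob T P \<in> Ob coalg.Comod"
proof -
  have "coalg.G.coalgebra (coalg.coact P)" using assms by (simp add: coalg.comodules_Ob)
  note * = L.lift_coalgebra [OF this]
  show "coalg.coact (fob T P) = L.lift_coaction (coalg.coact P)"
    using mor_lift_coaction [of P]
    by (intro arrow.expand) (auto simp: lifted_monad_def L.lift_coaction_def law_def split: prod.split)
  then show "fob T P \<in> Ob coalg.Comod" using * by (simp add: coalg.comodules_Ob)
qed

lemma lifted_monad_base [simp]: "base (fmap T f) = fmap alg.S (base f)"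
  by (simp add: base_def lifted_monad_def tensor_arrow_def split: prod.split)

lemma comodule_arrowI:
  assumes "P \<in> Ob coalg.Comod" "P' \<in> Ob coalg.Comod" "arrow D f" "src f = fst P" "trg f = fst P'"
    "fmap coalg.G f \<bullet> coalg.coact P = coalg.coact P' \<bullet> f"
  shows "arrow coalg.Comod (Arr P (mor f) P')" "base (Arr P (mor f) P') = f"
proof -
  show "base (Arr P (mor f) P') = f" using assms(4,5) by (intro arrow.expand) simp
  then show "arrow coalg.Comod (Arr P (mor f) P')"
    using assms unfolding coalg.comodules_arrow by simp
qed

lemma comodule_base_arrow [simp]: "arrow coalg.Comod f \<Longrightarrow> arrow D (base f)"
  using coalg.comodules_arrow by blast

lemma lifted_monad_functor: "is_functor coalg.Comod coalg.Comod T"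
proof -
  interpret Comod: category coalg.Comod by (rule coalg.comodules_category)
  have "arrow coalg.Comod (fmap T f)" if f: "arrow coalg.Comod f" for f
  proof -
    have "src f \<in> Ob coalg.Comod" "trg f \<in> Ob coalg.Comod" using f by simp_all
    moreover have "fmap coalg.G (base f) \<bullet> coalg.coact (src f) = coalg.coact (trg f) \<bullet> base f"
      using f coalg.comodules_arrow by blast
    ultimately show ?thesis
      unfolding coalg.comodules_arrow [of "fmap T f"] lifted_monad_base
      using f L.lift_coaction_natural [of "base f" "coalg.coact (src f)" "coalg.coact (trg f)"]
      by simp
  qed
  moreover have "X \<in> Ob D" if "(X, \<theta>) \<in> Ob coalg.Comod" for X \<theta>
    using coalg.comodule_coact(2) [OF that] by simp
  ultimately show ?thesis
    unfolding is_functor_iff by (auto intro!: base_inject)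
qed

definition unit_T :: "'o \<times> 'm \<Rightarrow> ('o \<times> 'm, 'm) arrow" where
  "unit_T P = Arr P (mor (alg.unit_at (fst P))) (fob T P)"

definition mult_T :: "'o \<times> 'm \<Rightarrow> ('o \<times> 'm, 'm) arrow" where
  "mult_T P = Arr (fob T (fob T P)) (mor (alg.mult_at (fst P))) (fob T P)"

lemma unit_T_arrow:
  assumes "P \<in> Ob coalg.Comod"
  shows "arrow coalg.Comod (unit_T P)" "base (unit_T P) = alg.unit_at (fst P)"
  using comodule_arrowI [of P "fob T P" "alg.unit_at (fst P)"]
    L.u_coalgebra_morphism [of "coalg.coact P"] assms
  by (simp_all add: unit_T_def coalg.comodules_Ob [of P])

lemma mult_T_arrow:
  assumes "P \<in> Ob coalg.Comod"
  shows "arrow coalg.Comod (mult_T P)" "base (mult_T P) = alg.mult_at (fst P)"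
  using comodule_arrowI [of "fob T (fob T P)" "fob T P" "alg.mult_at (fst P)"]
    L.n_coalgebra_morphism [of "coalg.coact P"] assms
  by (simp_all add: mult_T_def coalg.comodules_Ob [of P])

text \<open>The free algebra of the lifted monad; its compatibility condition is
  \<open>n_coalgebra_morphism\<close>.\<close>

lemma hopf_free:
  assumes P: "P \<in> Ob coalg.Comod"
  shows "\<exists>R \<in> Ob Hopf. hopf_comodule R = fob T P \<and> fst (snd R) = mor (alg.mult_at (fst P))"
proof
  let ?R = "(fst P \<odot> A, mor (alg.mult_at (fst P)), snd (fob T P))"
  have c: "hopf_comodule ?R = fob T P"
    using P by (simp add: hopf_comodule_def prod_eq_iff)
  have a: "hopf_act ?R = alg.mult_at (fst P)"
    using P by (intro arrow.expand) simp
  have "coalg.G.coalgebra (coalg.coact P)" using P by (simp add: coalg.comodules_Ob)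
  from L.n_coalgebra_morphism [OF this] show "?R \<in> Ob Hopf"
    unfolding hopf_Ob a c using P alg.S.free_algebra [of "fst P"] by simp
  show "hopf_comodule ?R = fob T P \<and> fst (snd ?R) = mor (alg.mult_at (fst P))"
    using c by simp
qed

text \<open>Restriction of scalars along \<open>\<epsilon> : A -> J\<close>, which two of the
  bimonoid axioms make a morphism of monoids for the first product.\<close>

definition restricted_act :: "'o \<times> 'm \<Rightarrow> ('o, 'm) arrow" where
  "restricted_act P = J.act P \<bullet> (id_arrow D (fst P) \<odot>\<^sub>a coalg.c_arrow)"

lemma restricted_act_algebra:
  assumes P: "P \<in> Ob (J_modules D)"
  shows "alg.S.algebra (restricted_act P)"
proof -
  let ?i = "id_arrow D" and ?h = "J.act P" and ?c = "coalg.c_arrow" and ?X = "fst P"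
  note [simp] = J_modules_simps(3,4) [OF P]
  have h: "?h \<bullet> fmap J.S ?h = ?h \<bullet> J.mult_at ?X"
    using P J.S.algebraD(3) [of ?h] by (simp add: J_modules_def J.modules_Ob)
  have "restricted_act P \<bullet> fmap alg.S (restricted_act P)
      = (?h \<bullet> fmap J.S ?h) \<bullet> ((?i ?X \<odot>\<^sub>a ?c) \<odot>\<^sub>a ?c)"
    by (simp add: restricted_act_def)
  also have "\<dots> = ?h \<bullet> (?i ?X \<odot>\<^sub>a J.m_arrow) \<bullet> (circ.al ?X \<J> \<J> \<bullet> ((?i ?X \<odot>\<^sub>a ?c) \<odot>\<^sub>a ?c))"
    unfolding h by (simp add: J.mult_at_def)
  also have "circ.al ?X \<J> \<J> \<bullet> ((?i ?X \<odot>\<^sub>a ?c) \<odot>\<^sub>a ?c) = (?i ?X \<odot>\<^sub>a (?c \<odot>\<^sub>a ?c)) \<bullet> circ.al ?X A A"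
    using circ.al_nat [of "?i ?X" ?c ?c] by simp
  also have "?h \<bullet> (?i ?X \<odot>\<^sub>a J.m_arrow) \<bullet> ((?i ?X \<odot>\<^sub>a (?c \<odot>\<^sub>a ?c)) \<bullet> circ.al ?X A A)
      = restricted_act P \<bullet> alg.mult_at ?X"
    by (simp add: restricted_act_def alg.mult_at_def bimonoid_arrows)
  finally have "restricted_act P \<bullet> fmap alg.S (restricted_act P) = restricted_act P \<bullet> alg.mult_at ?X" .
  moreover have "restricted_act P \<bullet> alg.unit_at ?X = ?h \<bullet> J.unit_at ?X"
    by (simp add: restricted_act_def alg.unit_at_def J.unit_at_def bimonoid_arrows)
  ultimately show ?thesis
    unfolding alg.S.algebra_def using J_module_act_unit [OF P] by (simp add: restricted_act_def)
qed

lemma comparison_simps [simp]: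
  assumes P: "P \<in> Ob (J_modules D)"
  shows "fst (fob K P) = fst P \<ast> A" "hopf_act (fob K P) = L.cofree_action (restricted_act P)"
    "hopf_comodule (fob K P) = fob (adj_right D A \<delta>) P"
    "coalg.coact (fob (adj_right D A \<delta>) P) = coalg.comult_at (fst P)"
    "fob K P \<in> Ob Hopf"
proof -
  let ?i = "id_arrow D" and ?h = "J.act P" and ?c = "coalg.c_arrow" and ?X = "fst P"
  note [simp] = J_modules_simps(3,4) [OF P]
  show "fst (fob K P) = ?X \<ast> A" by (simp add: comparison_functor_def split: prod.split)
  \<comment> \<open>The counit law of \<open>A\<close> solved for the composite of
    \<open>\<delta>\<close> with \<open>\<epsilon>\<close> on the left. It accounts for the unit
    constraint in \<open>comparison_action\<close>, a formula that mentions neither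
    \<open>\<delta>\<close> nor \<open>\<epsilon>\<close>.\<close>
  have c: "(?c \<ast>\<^sub>a ?i A) \<bullet> coalg.d_arrow = star.lu' A"
    using arg_cong [OF coalg.d_c_left, of "\<lambda>f. star.lu' A \<bullet> f"] by simp
  have "L.cofree_action (restricted_act P)
      = (?h \<ast>\<^sub>a alg.m_arrow) \<bullet> (((?i ?X \<odot>\<^sub>a ?c) \<ast>\<^sub>a (?i A \<odot>\<^sub>a ?i A)) \<bullet> ze ?X A A A) \<bullet> (?i (?X \<ast> A) \<odot>\<^sub>a coalg.d_arrow)"
    by (simp add: L.cofree_action_def restricted_act_def law_def)
  also have "((?i ?X \<odot>\<^sub>a ?c) \<ast>\<^sub>a (?i A \<odot>\<^sub>a ?i A)) \<bullet> ze ?X A A A = ze ?X A \<J> A \<bullet> ((?i ?X \<ast>\<^sub>a ?i A) \<odot>\<^sub>a (?c \<ast>\<^sub>a ?i A))"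
    using ze_nat [of "?i ?X" "?i A" ?c "?i A"] by simp
  also have "(?h \<ast>\<^sub>a alg.m_arrow) \<bullet> (ze ?X A \<J> A \<bullet> ((?i ?X \<ast>\<^sub>a ?i A) \<odot>\<^sub>a (?c \<ast>\<^sub>a ?i A))) \<bullet> (?i (?X \<ast> A) \<odot>\<^sub>a coalg.d_arrow)
      = (?h \<ast>\<^sub>a alg.m_arrow) \<bullet> ze ?X A \<J> A \<bullet> (?i (?X \<ast> A) \<odot>\<^sub>a star.lu' A)"
    by (simp add: c)
  finally have "L.cofree_action (restricted_act P)
      = (?h \<ast>\<^sub>a alg.m_arrow) \<bullet> ze ?X A \<J> A \<bullet> (?i (?X \<ast> A) \<odot>\<^sub>a star.lu' A)" .
  then show act: "hopf_act (fob K P) = L.cofree_action (restricted_act P)"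
    by (intro arrow.expand)
      (auto simp: comparison_functor_def comparison_action_def ze_def alg.m_arrow_def star.lu'_def split: prod.split)
  show comod: "hopf_comodule (fob K P) = fob (adj_right D A \<delta>) P"
    by (simp add: hopf_comodule_def comparison_functor_def adj_right_def cofree_comodule_def split: prod.split)
  show coact: "coalg.coact (fob (adj_right D A \<delta>) P) = coalg.comult_at (fst P)"
    by (simp add: adj_right_def)
  have alg: "alg.S.algebra (restricted_act P)" by (rule restricted_act_algebra [OF P])
  have "fob (adj_right D A \<delta>) P \<in> Ob coalg.Comod" by (simp add: adj_right_def)
  then show "fob K P \<in> Ob Hopf"
    unfolding hopf_Ob act comod coact
    using L.cofree_algebra [OF alg] L.cofree_hopf [OF alg] by (simp add: restricted_act_def)
qed

lemma comparison_base: "base (fmap K f) = fmap coalg.G (base f)"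
  by (simp add: base_def comparison_functor_def tensor_arrow_def split: prod.split)

lemma comparison_functor_functor: "is_functor (J_modules D) Hopf K"
proof -
  interpret JM: category "J_modules D" by (rule J_modules_category)
  have "arrow Hopf (fmap K f)" if f: "arrow (J_modules D) f" for f
  proof -
    have [simp]: "src f \<in> Ob (J_modules D)" "trg f \<in> Ob (J_modules D)" "arrow D (base f)"
      using f by simp_all
    note [simp] = J_modules_simps(3,4) [OF \<open>src f \<in> _\<close>] J_modules_simps(3,4) [OF \<open>trg f \<in> _\<close>]
    have lin: "base f \<bullet> J.act (src f) = J.act (trg f) \<bullet> (base f \<odot>\<^sub>a id_arrow D \<J>)"
      using f J_modules_arrow by auto
    have "base f \<bullet> restricted_act (src f) = (base f \<bullet> J.act (src f)) \<bullet> (id_arrow D (fst (src f)) \<odot>\<^sub>a coalg.c_arrow)"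
      by (simp add: restricted_act_def)
    also have "\<dots> = restricted_act (trg f) \<bullet> fmap alg.S (base f)"
      unfolding lin by (simp add: restricted_act_def)
    finally have "fmap coalg.G (base f) \<bullet> L.cofree_action (restricted_act (src f))
        = L.cofree_action (restricted_act (trg f)) \<bullet> fmap alg.S (fmap coalg.G (base f))"
      by (intro L.cofree_action_natural) (simp_all add: restricted_act_def)
    then show ?thesis
      using coalg.G.d_nat [of "base f"] unfolding hopf_arrow comparison_base by simp
  qed
  moreover have "X \<in> Ob D" if "(X, h) \<in> Ob (J_modules D)" for X h
    using J_modules_simps(4) [OF that] by simp
  ultimately show ?thesis
    unfolding is_functor_iff by (auto intro!: base_inject simp: comparison_base)
qed

section \<open>Hopf modules as algebras of the lifted monad\<close>

sublocale adjunction coalg.Comod "J_modules D" "adj_left D" "adj_right D A \<delta>"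
    "adj_unit D A \<delta> \<epsilon>" "adj_counit D A \<delta> \<epsilon>"
  by (rule phi_J_adjunction [OF coalg.comonoid])

text \<open>This places Hopf modules over comodules as the Eilenberg-Moore category of the lifted
  monad, with the middle component of the triple as action. What follows rests on the abstract
  comparison theorem, with no further computation in tensor products.\<close>

sublocale MC: monadic_comparison coalg.Comod "J_modules D" "adj_left D" "adj_right D A \<delta>"
    "adj_unit D A \<delta> \<epsilon>" "adj_counit D A \<delta> \<epsilon>" Hopf T
    "\<lambda>P. mor (alg.unit_at (fst P))" "\<lambda>P. mor (alg.mult_at (fst P))"
    hopf_comodule "\<lambda>P. fst (snd P)" K
proof (intro monadic_comparison.intro functor_between.intro functor_between_axioms.intro
    monadic_comparison_axioms.intro adjunction_axioms hopf_category coalg.comodules_category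
    lifted_monad_functor comparison_functor_functor)
  have Comp_Comod: "Comp coalg.Comod = Comp D" by (simp add: comodules_def)
  show "Comp Hopf = Comp coalg.Comod" by (simp add: comodules_def hopf_modules_def)
  show "Id Hopf P = Id coalg.Comod (hopf_comodule P)" for P
    by (simp add: comodules_def hopf_modules_def hopf_comodule_def split: prod.split)
  have fmor_T: "fmor T X Y f = f \<odot>\<^sub>m Id D A" for X Y f by (simp add: lifted_monad_def)
  show "Hom Hopf P P' = {f \<in> Hom coalg.Comod (hopf_comodule P) (hopf_comodule P').
      f \<cdot>\<^bsub>coalg.Comod\<^esub> fst (snd P) = fst (snd P') \<cdot>\<^bsub>coalg.Comod\<^esub> fmor T (hopf_comodule P) (hopf_comodule P') f}"
    if "P \<in> Ob Hopf" "P' \<in> Ob Hopf" for P P'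
    using that by (auto simp: hopf_Hom_Comod fmor_T Comp_Comod)
  show "nat_trans coalg.Comod coalg.Comod id_func T (\<lambda>P. mor (alg.unit_at (fst P)))"
  proof -
    have "unit_T (trg f) \<bullet>\<^bsub>coalg.Comod\<^esub> f = fmap T f \<bullet>\<^bsub>coalg.Comod\<^esub> unit_T (src f)"
      if f: "arrow coalg.Comod f" for f
      using f alg.S.u_nat [of "base f"]
      by (intro base_inject) (simp_all add: unit_T_arrow, simp_all add: unit_T_def)
    then show ?thesis
      unfolding nat_trans_iff unit_T_def [symmetric] id_func_simps
      using id_functor lifted_monad_functor unit_T_arrow(1) by blast
  qed
  show "nat_trans coalg.Comod coalg.Comod (T \<circ>\<^sub>F T) T (\<lambda>P. mor (alg.mult_at (fst P)))"
  proof -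
    have "mult_T (trg f) \<bullet>\<^bsub>coalg.Comod\<^esub> fmap T (fmap T f) = fmap T f \<bullet>\<^bsub>coalg.Comod\<^esub> mult_T (src f)"
      if f: "arrow coalg.Comod f" for f
      using f alg.S.n_nat [of "base f"]
      by (intro base_inject) (simp_all add: mult_T_arrow, simp_all add: mult_T_def)
    then show ?thesis
      unfolding nat_trans_iff mult_T_def [symmetric] comp_func_simps
      using functor_compose [OF lifted_monad_functor lifted_monad_functor] lifted_monad_functor mult_T_arrow(1)
      by blast
  qed
  show "mor (alg.mult_at (fst P)) \<cdot>\<^bsub>coalg.Comod\<^esub> fmor T P (fob T P) (mor (alg.unit_at (fst P)))
      = Id coalg.Comod (fob T P)" if "P \<in> Ob coalg.Comod" for P
    using arg_cong [OF alg.S.n_unit(2) [of "fst P"], of mor] that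
    by (simp add: fmor_T Comp_Comod) (simp add: comodules_def lifted_monad_def split: prod.split)
  show "hopf_comodule P \<in> Ob coalg.Comod" if "P \<in> Ob Hopf" for P using that by simp
  fix P assume P: "P \<in> Ob Hopf"
  let ?X = "hopf_comodule P"
  have h: "alg.S.algebra (hopf_act P)"
    and lin: "fmap coalg.G (hopf_act P) \<bullet> L.lift_coaction (coalg.coact ?X) = coalg.coact ?X \<bullet> hopf_act P"
    using P by (simp_all add: hopf_Ob)
  show "fst (snd P) \<in> Hom coalg.Comod (fob T ?X) ?X"
    using comodule_arrowI(1) [of "fob T ?X" ?X "hopf_act P"] P lin by simp
  show "fst (snd P) \<cdot>\<^bsub>coalg.Comod\<^esub> mor (alg.unit_at (fst ?X)) = Id coalg.Comod ?X"
    using arg_cong [OF alg.S.algebraD(4) [OF h], of mor]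
    by (simp add: Comp_Comod) (simp add: comodules_def hopf_comodule_def)
  show "fst (snd P) \<cdot>\<^bsub>coalg.Comod\<^esub> fmor T (fob T ?X) ?X (fst (snd P))
      = fst (snd P) \<cdot>\<^bsub>coalg.Comod\<^esub> mor (alg.mult_at (fst ?X))"
    using arg_cong [OF alg.S.algebraD(3) [OF h], of mor] by (simp add: Comp_Comod fmor_T)
next
  show "\<exists>R \<in> Ob Hopf. hopf_comodule R = fob T P \<and> fst (snd R) = mor (alg.mult_at (fst P))"
    if "P \<in> Ob coalg.Comod" for P
    using that by (rule hopf_free)
  show "hopf_comodule (fob K Y) = fob (adj_right D A \<delta>) Y" if "Y \<in> Ob (J_modules D)" for Y
    using that by simp
  show "fmor K Y Y' f = fmor (adj_right D A \<delta>) Y Y' f" for Y Y' f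
    by (simp add: comparison_functor_def adj_right_def comp_func_def cofree_comodule_def forget_def)
qed

text \<open>Both maps are \<open>\<rho> F . T \<eta>\<close>, because the action component of
  \<open>fob K Y\<close> is \<open>comparison_action\<close>.\<close>

lemma mor_galois: "mor (MC.galois P) = galois_mor D A m \<delta> \<epsilon> P"
proof -
  have "fst (snd (fob K Y)) = comparison_action D A m Y" for Y
    by (simp add: comparison_functor_def split: prod.split)
  then show ?thesis by (simp add: MC.galois_def MC.ac_def eta_def galois_mor_def)
qed

text \<open>Naturality holds for every bimonoid by \<open>galois_nat_trans\<close>, so the Galois
  condition amounts to invertibility at each comodule.\<close>

lemma is_galois_iff:
  "is_galois D A m \<delta> \<epsilon> \<longleftrightarrow> (\<forall>P \<in> Ob coalg.Comod. \<exists>g. C.inverse_arrows (MC.galois P) g)"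
proof -
  have "is_iso coalg.Comod (fob T P) (fob (adj_right D A \<delta>) (fob (adj_left D) P)) (galois_mor D A m \<delta> \<epsilon> P)
      \<longleftrightarrow> (\<exists>g. C.inverse_arrows (MC.galois P) g)" if "P \<in> Ob coalg.Comod" for P
  proof -
    have "Arr (fob T P) (galois_mor D A m \<delta> \<epsilon> P) (fob (adj_right D A \<delta>) (fob (adj_left D) P)) = MC.galois P"
      using that by (intro arrow.expand) (simp add: mor_galois)
    then show ?thesis by (metis C.is_isoE C.is_isoI)
  qed
  then show ?thesis
    unfolding is_galois_def nat_iso_def using MC.galois_nat_trans by (simp add: mor_galois)
qed

end

theorem theorem3p11:
  fixes D :: "('o, 'm) duoidal_data"
    and A :: 'o and m e \<delta> \<epsilon> :: 'm
  assumes "duoidal D"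
    and "cauchy_complete D"
    and "split_epi D (unit_ob (circ D)) (unit_ob (star D)) (tau D)
       \<or> nat_split_epi (J_modules D) (J_modules D)
           (adj_left D \<circ>\<^sub>F adj_right D (unit_ob (circ D)) (Delta D)) id_func
           (adj_counit D (unit_ob (circ D)) (Delta D) (tau D))
       \<or> full_and_faithful (J_modules D)
           (comodules D (star D) (unit_ob (circ D)) (Delta D) (tau D))
           (adj_right D (unit_ob (circ D)) (Delta D))"
    and "bimonoid D A m e \<delta> \<epsilon>"
  shows "equivalence (J_modules D) (hopf_modules D A m e \<delta> \<epsilon>) (comparison_functor D A m \<delta>)
         \<longleftrightarrow> is_galois D A m \<delta> \<epsilon>"
proof -
  interpret duoidal D by fact
  interpret bimonoid_object D A m e \<delta> \<epsilon>
    by unfold_locales fact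
  \<comment> \<open>Each of the three alternatives yields this: the second is the claim itself, and
    the other two are reduced to it.\<close>
  have "nat_split_epi (J_modules D) (J_modules D) (adj_left D \<circ>\<^sub>F adj_right D (unit_ob (circ D)) (Delta D)) id_func
      (adj_counit D (unit_ob (circ D)) (Delta D) (tau D))"
    using assms(3) counit_split_if_tau_split
      adjunction.counit_split_epi_if_full_and_faithful [OF phi_J_adjunction [OF I_comonoid]]
    by blast
  \<comment> \<open>Since \<open>\<tau>\<close> is the counit of the comonoid \<open>I\<close>, the
    bimonoid axiom on \<open>\<epsilon> \<cdot> e\<close> says that \<open>e\<close> respects
    counits.\<close>
  moreover have "e \<in> Hom D (unit_ob (circ D)) A" "\<epsilon> \<cdot>\<^bsub>D\<^esub> e = tau D"
    using assms(4) by (auto simp: bimonoid_def is_monoid_def)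
  ultimately have "nat_split_epi (J_modules D) (J_modules D) (adj_left D \<circ>\<^sub>F adj_right D A \<delta>) id_func
      (adj_counit D A \<delta> \<epsilon>)"
    using comonoid_morphism_counit_split [OF I_comonoid coalg.comonoid] by blast
  moreover have "cauchy_complete (J_modules D)"
    unfolding J_modules_def using assms(2) by (rule J.modules_cauchy_complete)
  ultimately show ?thesis
    unfolding is_galois_iff
    using MC.galois_iso_if_equivalence MC.equivalence_if_galois_iso by blast
qed

end
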